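(* Let $k\ge 0$ and let $p=p(\rho)$ be the pressure law. There exists a constant $C>0$ such that the following hold for global weak solutions (in the sense defined in the context) of the Euler–Poisson equations (EP) in $\mathbb{R}^N$. (i) The case $N\ge 3$. Let $w\in L^1_{loc}([0,\infty))$ be positive and non-increasing on $[0,\infty)$, let $K_1\ge 0$ be a constant, and let the initial data $(\rho_0,v_0)$ satisfy $$\int_{\mathbb{R}^N}\rho_0(x)|v_0(x)|\left[\int_0^{|x|}w(r)\,dr\right]dx<\infty.$$ Suppose $(\rho,v,\Phi)$ is a global weak solution to (EP) with initial data $(\rho_0,v_0)$ such that $$\text{(A)}\quad \limsup_{\tau\to\infty}\int_\tau^{2\tau}\int_{\mathbb{R}^N}\frac{\rho(x,t)}{1+t^2}\left[\int_0^{|x|}\int_0^r w(s)\,ds\,dr\right]dx\,dt\le K_1$$ and, for all $T>0$, $$\text{(B)}\quad \int_0^T\int_{\mathbb{R}^N}\left(\rho|v|^2+p+k|\nabla\Phi|^2\right)\left[w(|x|)+\frac{1}{|x|}\int_0^{|x|}w(s)\,ds+\frac{1}{|x|^2}\int_0^{|x|}\int_0^r w(s)\,ds\,dr\right]dx\,dt<\infty .$$ Then $$\begin{aligned} &\int_0^\infty\int_{\mathbb{R}^N}\rho(x,t)\left[w(|x|)\frac{(v\cdot x)^2}{|x|^2}+\frac{1}{|x|}\int_0^{|x|}w(r)\,dr\left(|v|^2-\frac{(v\cdot x)^2}{|x|^2}\right)\right]dx\,dt\\ &+\int_0^\infty\int_{\mathbb{R}^N}p(x,t)\left[w(|x|)+\frac{N-1}{|x|}\int_0^{|x|}w(r)\,dr\right]dx\,dt\\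 &+\frac{(N-3)k}{2}\int_0^\infty\int_{\mathbb{R}^N}\frac{|\nabla\Phi|^2}{|x|}\left[\int_0^{|x|}w(s)\,ds\right]dx\,dt\\ &+k\int_0^\infty\int_{\mathbb{R}^N}\left[\frac{1}{|x|}\int_0^{|x|}w(s)\,ds-w(|x|)\right]\frac{(x\cdot\nabla\Phi)^2}{|x|^2}\,dx\,dt\\ &+\frac{k}{2}\int_0^\infty\int_{\mathbb{R}^N}|\nabla\Phi|^2w(|x|)\,dx\,dt +\int_{\mathbb{R}^N}\rho_0(x)v_0(x)\cdot\frac{x}{|x|}\left[\int_0^{|x|}w(r)\,dr\right]dx\ \le\ CK_1 . \end{aligned}$$ Therefore, if $$\int_{\mathbb{R}^N}\rho_0(x)v_0(x)\cdot\frac{x}{|x|}\left[\int_0^{|x|}w(r)\,dr\right]dx>CK_1,$$ then there exists no global weak solution to (EP) with initial data $(\rho_0,v_0)$ satisfying (A) and (B). (ii) The case $N=2$. Let $K_1\ge 0$ be a constant and let $(\rho_0,v_0)$ satisfy $$\int_{\mathbb{R}^2}\rho_0(x)|v_0(x)||x|\,dx<\infty.$$ Suppose $(\rho,v,\Phi)$ is a global weak solution to (EP) with initial data $(\rho_0,v_0)$ such that $$\text{(A')}\quad \limsup_{\tau\to\infty}\int_\tau^{2\tau}\int_{\mathbb{R}^2}\frac{\rho(x,t)}{1+t^2}|x|^2\,dx\,dt\le K_1$$ and, for all $T>0$, $$\text{(B')}\quad \int_0^T\int_{\mathbb{R}^2}\left(\rho|v|^2+p+k|\nabla\Phi|^2\right)dx\,dt<\infty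 .$$ Then $$\int_0^\infty\int_{\mathbb{R}^2}\left(\rho|v|^2+2p\right)dx\,dt+\int_{\mathbb{R}^2}\rho_0(x)v_0(x)\cdot x\,dx\le CK_1 .$$ Therefore, if $$\int_{\mathbb{R}^2}\rho_0(x)v_0(x)\cdot x\,dx>CK_1,$$ then there exists no global weak solution to (EP) with initial data $(\rho_0,v_0)$ satisfying (A') and (B').
   Context: The constant $k$ is real with $k\ge 0$. The Euler–Poisson system (EP) is $\partial_t\rho+\mathrm{div}(\rho v)=0$, $\partial_t(\rho v)+\mathrm{div}(\rho v\otimes v)=-\nabla p+k\rho\nabla\Phi$, $\Delta\Phi=\rho$, where $\rho\ge 0$ and $p=p(\rho)\ge 0$ is a given function of $\rho$ with $p=0$ only if $\rho=0$. Initial data $(\rho_0,v_0)$ are a measurable density $\rho_0\ge 0$ and a measurable velocity field $v_0$ such that the integrals below involving them make sense. A triple $(\rho,v,\Phi)\in L^1_{loc}((0,\infty);L^\infty_{loc}(\mathbb{R}^N))\times[L^1_{loc}((0,\infty);L^2_{loc}(\mathbb{R}^N))]^N\times L^2_{loc}((0,\infty);W^{2,2}_{loc}(\mathbb{R}^N))$ is a global weak solution of (EP) with initial data $(\rho_0,v_0)$ if (1) for all $\psi\in C_0^\infty(\mathbb{R}^N)$ and $\xi\in C_0^1([0,\infty))$, $$\xi(0)\int_{\mathbb{R}^N}\rho_0\psi\,dx+\int_0^\infty\int_{\mathbb{R}^N}\rho(x,t)\psi(x)\xi'(t)\,dx\,dt+\int_0^\infty\int_{\mathbb{R}^N}\rho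 v(x,t)\cdot\nabla\psi(x)\xi(t)\,dx\,dt=0;$$ (2) for all $\phi\in[C_0^\infty(\mathbb{R}^N)]^N$ and $\xi\in C_0^1([0,\infty))$, $$\begin{aligned}&\xi(0)\int_{\mathbb{R}^N}\rho_0v_0\cdot\phi\,dx+\int_0^\infty\int_{\mathbb{R}^N}\rho v\cdot\phi(x)\,\xi'(t)\,dx\,dt+\int_0^\infty\int_{\mathbb{R}^N}\rho v\otimes v:\nabla\phi(x)\,\xi(t)\,dx\,dt\\&\quad=-\int_0^\infty\int_{\mathbb{R}^N}p\,\mathrm{div}\,\phi(x)\,\xi(t)\,dx\,dt-k\int_0^\infty\int_{\mathbb{R}^N}\rho\nabla\Phi\cdot\phi(x)\,\xi(t)\,dx\,dt;\end{aligned}$$ (3) $\Delta\Phi=\rho$ almost everywhere on $\mathbb{R}^N\times[0,\infty)$; (4) $\rho\ge 0$ and $p=p(\rho)\ge 0$ (with $p=0$ only if $\rho=0$) almost everywhere on $\mathbb{R}^N\times[0,\infty)$. Here $C_0^\infty(\mathbb{R}^N)$ and $C_0^1([0,\infty))$ denote compactly supported functions, and $\xi'(0)$ means $\xi'(0+)$. *)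

theory Defs
  imports "HOL-Probability.Probability"
begin

section \<open>Test functions\<close>

definition partial :: "'n::finite \<Rightarrow> (real^'n \<Rightarrow> real) \<Rightarrow> real^'n \<Rightarrow> real" where
  "partial i f x = frechet_derivative f (at x) (axis i 1)"

definition grad :: "(real^'n::finite \<Rightarrow> real) \<Rightarrow> real^'n \<Rightarrow> real^'n" where
  "grad f x = (\<chi> i. partial i f x)"

definition divergence :: "(real^'n::finite \<Rightarrow> real^'n) \<Rightarrow> real^'n \<Rightarrow> real" where
  "divergence \<phi> x = (\<Sum>i\<in>UNIV. partial i (\<lambda>y. \<phi> y $ i) x)"

text \<open>A function is smooth iff all its iterated partial derivatives exist and are
  (totally) differentiable; continuity of each of them is then automatic.\<close>

definition smooth :: "(real^'n::finite \<Rightarrow> real) \<Rightarrow> bool" where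
  "smooth f \<longleftrightarrow> (\<forall>js x. foldr partial js f differentiable (at x))"

definition test_fun :: "(real^'n::finite \<Rightarrow> real) \<Rightarrow> bool" where
  "test_fun \<psi> \<longleftrightarrow> smooth \<psi> \<and> compact (closure {x. \<psi> x \<noteq> 0})"

definition test_field :: "(real^'n::finite \<Rightarrow> real^'n) \<Rightarrow> bool" where
  "test_field \<phi> \<longleftrightarrow> (\<forall>i. test_fun (\<lambda>x. \<phi> x $ i))"

text \<open>The class \<open>C\<^sub>0\<^sup>1([0,\<infinity>))\<close>, together with the derivative; at \<open>0\<close> the derivative is
  one-sided, and the function need not vanish there.\<close>

definition test_time :: "(real \<Rightarrow> real) \<Rightarrow> (real \<Rightarrow> real) \<Rightarrow> bool" where
  "test_time \<xi> \<xi>' \<longleftrightarrow>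
     (\<forall>t\<ge>0. (\<xi> has_real_derivative \<xi>' t) (at t within {0..})) \<and>
     continuous_on {0..} \<xi>' \<and> (\<exists>T. \<forall>t>T. \<xi> t = 0)"


section \<open>Function spaces\<close>

text \<open>Space-time \<open>\<real>\<^sup>N \<times> [0,\<infinity>)\<close> with Lebesgue measure. Since the integrands below are
  either nonnegative or required to be integrable, an integral over it is the iterated integral
  over time and space.\<close>

abbreviation spacetime :: "((real^'n::finite) \<times> real) measure" where
  "spacetime \<equiv> lebesgue_on (UNIV \<times> {0..})"

definition locally_integrable :: "('a::euclidean_space \<Rightarrow> real) \<Rightarrow> bool" where
  "locally_integrable f \<longleftrightarrow> (\<forall>K. compact K \<longrightarrow> integrable (lebesgue_on K) f)"

text \<open>\<open>L\<^sup>1\<^sub>l\<^sub>o\<^sub>c((0,\<infinity>); L\<^sup>\<infinity>\<^sub>l\<^sub>o\<^sub>c(\<real>\<^sup>N))\<close>.\<close>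

definition L1loc_Linfloc :: "(real^'n::finite \<Rightarrow> real \<Rightarrow> real) \<Rightarrow> bool" where
  "L1loc_Linfloc u \<longleftrightarrow>
     (\<lambda>(x, t). u x t) \<in> borel_measurable spacetime \<and>
     (\<forall>K J. compact K \<and> compact J \<and> J \<subseteq> {0<..} \<longrightarrow>
        (\<integral>\<^sup>+ t. e2ennreal (esssup (lebesgue_on K) (\<lambda>x. ereal \<bar>u x t\<bar>)) \<partial>lebesgue_on J) < \<infinity>)"

text \<open>\<open>L\<^sup>q\<^sub>l\<^sub>o\<^sub>c((0,\<infinity>); L\<^sup>2\<^sub>l\<^sub>o\<^sub>c(\<real>\<^sup>N))\<close>.\<close>

definition Lqloc_L2loc :: "nat \<Rightarrow> (real^'n::finite \<Rightarrow> real \<Rightarrow> real) \<Rightarrow> bool" where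
  "Lqloc_L2loc q u \<longleftrightarrow>
     (\<lambda>(x, t). u x t) \<in> borel_measurable spacetime \<and>
     (\<forall>K J. compact K \<and> compact J \<and> J \<subseteq> {0<..} \<longrightarrow>
        (AE t in lebesgue_on J. integrable (lebesgue_on K) (\<lambda>x. (u x t)\<^sup>2)) \<and>
        integrable (lebesgue_on J) (\<lambda>t. sqrt (\<integral>x. (u x t)\<^sup>2 \<partial>lebesgue_on K) ^ q))"

definition weak_partial ::
    "'n::finite \<Rightarrow> (real^'n \<Rightarrow> real) \<Rightarrow> (real^'n \<Rightarrow> real) \<Rightarrow> bool" where
  "weak_partial i f g \<longleftrightarrow>
     locally_integrable f \<and> locally_integrable g \<and>
     (\<forall>\<psi>. test_fun \<psi> \<longrightarrow>
        (\<integral>x. f x * partial i \<psi> x \<partial>lebesgue) = - (\<integral>x. g x * \<psi> x \<partial>lebesgue))"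

text \<open>Weak spatial derivatives of a function on space-time. Joint measurability is part of the
  definition, because choosing an almost-everywhere representative separately for each time could
  destroy it; with it, the derivative is unique almost everywhere on space-time.\<close>

definition spatial_weak_partial ::
    "'n::finite \<Rightarrow> (real^'n \<Rightarrow> real \<Rightarrow> real) \<Rightarrow> (real^'n \<Rightarrow> real \<Rightarrow> real) \<Rightarrow> bool" where
  "spatial_weak_partial i u g \<longleftrightarrow>
     (\<lambda>(x, t). g x t) \<in> borel_measurable spacetime \<and>
     (AE t in lebesgue_on {0..}. weak_partial i (\<lambda>x. u x t) (\<lambda>x. g x t))"

definition wpartial ::
    "'n::finite \<Rightarrow> (real^'n \<Rightarrow> real \<Rightarrow> real) \<Rightarrow> real^'n \<Rightarrow> real \<Rightarrow> real" where
  "wpartial i u = (SOME g. spatial_weak_partial i u g)"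

definition wgrad :: "(real^'n::finite \<Rightarrow> real \<Rightarrow> real) \<Rightarrow> real^'n \<Rightarrow> real \<Rightarrow> real^'n" where
  "wgrad u x t = (\<chi> i. wpartial i u x t)"

definition wlaplacian :: "(real^'n::finite \<Rightarrow> real \<Rightarrow> real) \<Rightarrow> real^'n \<Rightarrow> real \<Rightarrow> real" where
  "wlaplacian u x t = (\<Sum>i\<in>UNIV. wpartial i (wpartial i u) x t)"

text \<open>\<open>L\<^sup>2\<^sub>l\<^sub>o\<^sub>c((0,\<infinity>); W\<^sup>2\<^sup>,\<^sup>2\<^sub>l\<^sub>o\<^sub>c(\<real>\<^sup>N))\<close>.\<close>

definition L2loc_W22loc :: "(real^'n::finite \<Rightarrow> real \<Rightarrow> real) \<Rightarrow> bool" where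
  "L2loc_W22loc u \<longleftrightarrow>
     Lqloc_L2loc 2 u \<and>
     (\<forall>i. (\<exists>g. spatial_weak_partial i u g) \<and> Lqloc_L2loc 2 (wpartial i u) \<and>
       (\<forall>j. (\<exists>h. spatial_weak_partial j (wpartial i u) h) \<and>
            Lqloc_L2loc 2 (wpartial j (wpartial i u))))"


section \<open>The Euler--Poisson system\<close>

definition pressure_law :: "(real \<Rightarrow> real) \<Rightarrow> bool" where
  "pressure_law p \<longleftrightarrow> (\<forall>r\<ge>0. p r \<ge> 0 \<and> (p r = 0 \<longrightarrow> r = 0))"

text \<open>The last two conditions say that the integrals of the initial data in the weak formulation
  make sense.\<close>

definition initial_data :: "(real^'n::finite \<Rightarrow> real) \<Rightarrow> (real^'n \<Rightarrow> real^'n) \<Rightarrow> bool" where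
  "initial_data \<rho>\<^sub>0 v\<^sub>0 \<longleftrightarrow>
     \<rho>\<^sub>0 \<in> borel_measurable lebesgue \<and> v\<^sub>0 \<in> borel_measurable lebesgue \<and>
     (AE x in lebesgue. \<rho>\<^sub>0 x \<ge> 0) \<and>
     (\<forall>\<psi>. test_fun \<psi> \<longrightarrow> integrable lebesgue (\<lambda>x. \<rho>\<^sub>0 x * \<psi> x)) \<and>
     (\<forall>\<phi>. test_field \<phi> \<longrightarrow> integrable lebesgue (\<lambda>x. \<rho>\<^sub>0 x * (v\<^sub>0 x \<bullet> \<phi> x)))"

text \<open>In the weak equations the Lebesgue integrals are required to exist. This has to be said:
  the integral of a non-integrable function is \<open>0\<close> in HOL, and the function spaces for
  \<open>\<rho>, v, \<Phi>\<close> alone do not guarantee integrability of the products, nor integrability up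
  to time \<open>0\<close>.\<close>

definition weak_continuity ::
    "(real^'n::finite \<Rightarrow> real) \<Rightarrow> (real^'n \<Rightarrow> real \<Rightarrow> real) \<Rightarrow> (real^'n \<Rightarrow> real \<Rightarrow> real^'n) \<Rightarrow> bool"
where
  "weak_continuity \<rho>\<^sub>0 \<rho> v \<longleftrightarrow>
     (\<forall>\<psi> \<xi> \<xi>'. test_fun \<psi> \<and> test_time \<xi> \<xi>' \<longrightarrow>
        integrable spacetime (\<lambda>(x, t). \<rho> x t * \<psi> x * \<xi>' t) \<and>
        integrable spacetime (\<lambda>(x, t). \<rho> x t * (v x t \<bullet> grad \<psi> x) * \<xi> t) \<and>
        \<xi> 0 * (\<integral>x. \<rho>\<^sub>0 x * \<psi> x \<partial>lebesgue)
          + (\<integral>(x, t). \<rho> x t * \<psi> x * \<xi>' t \<partial>spacetime)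
          + (\<integral>(x, t). \<rho> x t * (v x t \<bullet> grad \<psi> x) * \<xi> t \<partial>spacetime) = 0)"

definition tensor_contract :: "real^'n::finite \<Rightarrow> (real^'n \<Rightarrow> real^'n) \<Rightarrow> real^'n \<Rightarrow> real" where
  \<comment> \<open>\<open>(a \<otimes> a) : \<nabla>\<phi>(x)\<close>\<close>
  "tensor_contract a \<phi> x =
     (\<Sum>i\<in>UNIV. \<Sum>j\<in>UNIV. a $ i * a $ j * partial i (\<lambda>y. \<phi> y $ j) x)"

definition weak_momentum ::
    "real \<Rightarrow> (real \<Rightarrow> real) \<Rightarrow> (real^'n::finite \<Rightarrow> real) \<Rightarrow> (real^'n \<Rightarrow> real^'n) \<Rightarrow>
     (real^'n \<Rightarrow> real \<Rightarrow> real) \<Rightarrow> (real^'n \<Rightarrow> real \<Rightarrow> real^'n) \<Rightarrow> (real^'n \<Rightarrow> real \<Rightarrow> real) \<Rightarrow> bool"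
where
  "weak_momentum k p \<rho>\<^sub>0 v\<^sub>0 \<rho> v \<Phi> \<longleftrightarrow>
     (\<forall>\<phi> \<xi> \<xi>'. test_field \<phi> \<and> test_time \<xi> \<xi>' \<longrightarrow>
        integrable spacetime (\<lambda>(x, t). \<rho> x t * (v x t \<bullet> \<phi> x) * \<xi>' t) \<and>
        integrable spacetime (\<lambda>(x, t). \<rho> x t * tensor_contract (v x t) \<phi> x * \<xi> t) \<and>
        integrable spacetime (\<lambda>(x, t). p (\<rho> x t) * divergence \<phi> x * \<xi> t) \<and>
        integrable spacetime (\<lambda>(x, t). k * (\<rho> x t * (wgrad \<Phi> x t \<bullet> \<phi> x) * \<xi> t)) \<and>
        \<xi> 0 * (\<integral>x. \<rho>\<^sub>0 x * (v\<^sub>0 x \<bullet> \<phi> x) \<partial>lebesgue)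
          + (\<integral>(x, t). \<rho> x t * (v x t \<bullet> \<phi> x) * \<xi>' t \<partial>spacetime)
          + (\<integral>(x, t). \<rho> x t * tensor_contract (v x t) \<phi> x * \<xi> t \<partial>spacetime)
        = - (\<integral>(x, t). p (\<rho> x t) * divergence \<phi> x * \<xi> t \<partial>spacetime)
          - k * (\<integral>(x, t). \<rho> x t * (wgrad \<Phi> x t \<bullet> \<phi> x) * \<xi> t \<partial>spacetime))"

definition global_weak_solution ::
    "real \<Rightarrow> (real \<Rightarrow> real) \<Rightarrow> (real^'n::finite \<Rightarrow> real) \<Rightarrow> (real^'n \<Rightarrow> real^'n) \<Rightarrow>
     (real^'n \<Rightarrow> real \<Rightarrow> real) \<Rightarrow> (real^'n \<Rightarrow> real \<Rightarrow> real^'n) \<Rightarrow> (real^'n \<Rightarrow> real \<Rightarrow> real) \<Rightarrow> bool"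
where
  "global_weak_solution k p \<rho>\<^sub>0 v\<^sub>0 \<rho> v \<Phi> \<longleftrightarrow>
     L1loc_Linfloc \<rho> \<and> (\<forall>i. Lqloc_L2loc 1 (\<lambda>x t. v x t $ i)) \<and> L2loc_W22loc \<Phi> \<and>
     weak_continuity \<rho>\<^sub>0 \<rho> v \<and>
     weak_momentum k p \<rho>\<^sub>0 v\<^sub>0 \<rho> v \<Phi> \<and>
     (AE (x, t) in spacetime. wlaplacian \<Phi> x t = \<rho> x t) \<and>
     (AE (x, t) in spacetime. \<rho> x t \<ge> 0 \<and> p (\<rho> x t) \<ge> 0 \<and> (p (\<rho> x t) = 0 \<longrightarrow> \<rho> x t = 0))"


section \<open>Weights and growth conditions\<close>

text \<open>Only the values of the weight on \<open>(0,\<infinity>)\<close> are constrained (a single point being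
  negligible), so that an integrable singularity at the origin is admitted.\<close>

definition admissible_weight :: "(real \<Rightarrow> real) \<Rightarrow> bool" where
  "admissible_weight w \<longleftrightarrow>
     (\<forall>R>0. set_integrable lebesgue {0..R} w) \<and> (\<forall>r>0. w r > 0) \<and> antimono_on {0<..} w"

definition int1 :: "(real \<Rightarrow> real) \<Rightarrow> real \<Rightarrow> real" where
  "int1 w r = (LINT s:{0..r}|lebesgue. w s)"

definition int2 :: "(real \<Rightarrow> real) \<Rightarrow> real \<Rightarrow> real" where
  "int2 w r = (LINT s:{0..r}|lebesgue. int1 w s)"

definition condition_A :: "(real \<Rightarrow> real) \<Rightarrow> real \<Rightarrow> (real^'n::finite \<Rightarrow> real \<Rightarrow> real) \<Rightarrow> bool" where
  "condition_A w K\<^sub>1 \<rho> \<longleftrightarrow>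
     Limsup at_top (\<lambda>\<tau>. \<integral>\<^sup>+ (x, t). ennreal (\<rho> x t / (1 + t\<^sup>2) * int2 w (norm x))
                           \<partial>lebesgue_on (UNIV \<times> {\<tau>..2*\<tau>})) \<le> ennreal K\<^sub>1"

definition condition_B ::
    "real \<Rightarrow> (real \<Rightarrow> real) \<Rightarrow> (real \<Rightarrow> real) \<Rightarrow> (real^'n::finite \<Rightarrow> real \<Rightarrow> real) \<Rightarrow>
     (real^'n \<Rightarrow> real \<Rightarrow> real^'n) \<Rightarrow> (real^'n \<Rightarrow> real \<Rightarrow> real) \<Rightarrow> bool"
where
  "condition_B k p w \<rho> v \<Phi> \<longleftrightarrow>
     (\<forall>T>0. (\<integral>\<^sup>+ (x, t). ennreal
         ((\<rho> x t * (norm (v x t))\<^sup>2 + p (\<rho> x t) + k * (norm (wgrad \<Phi> x t))\<^sup>2) *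
          (w (norm x) + int1 w (norm x) / norm x + int2 w (norm x) / (norm x)\<^sup>2))
       \<partial>lebesgue_on (UNIV \<times> {0..T})) < \<infinity>)"

definition condition_A2 :: "real \<Rightarrow> (real^2 \<Rightarrow> real \<Rightarrow> real) \<Rightarrow> bool" where
  "condition_A2 K\<^sub>1 \<rho> \<longleftrightarrow>
     Limsup at_top (\<lambda>\<tau>. \<integral>\<^sup>+ (x, t). ennreal (\<rho> x t / (1 + t\<^sup>2) * (norm x)\<^sup>2)
                           \<partial>lebesgue_on (UNIV \<times> {\<tau>..2*\<tau>})) \<le> ennreal K\<^sub>1"

definition condition_B2 ::
    "real \<Rightarrow> (real \<Rightarrow> real) \<Rightarrow> (real^2 \<Rightarrow> real \<Rightarrow> real) \<Rightarrow>
     (real^2 \<Rightarrow> real \<Rightarrow> real^2) \<Rightarrow> (real^2 \<Rightarrow> real \<Rightarrow> real) \<Rightarrow> bool"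
where
  "condition_B2 k p \<rho> v \<Phi> \<longleftrightarrow>
     (\<forall>T>0. (\<integral>\<^sup>+ (x, t). ennreal
         (\<rho> x t * (norm (v x t))\<^sup>2 + p (\<rho> x t) + k * (norm (wgrad \<Phi> x t))\<^sup>2)
       \<partial>lebesgue_on (UNIV \<times> {0..T})) < \<infinity>)"

end

theory Submission
  imports Defs
begin

text \<open>
  The inequality is a virial identity. Let \<open>W\<close> be the radial potential with \<open>W'' = w\<close> and
  \<open>W(0) = W'(0) = 0\<close>, and let \<open>\<xi>\<close> be a function of time that is \<open>1\<close> near \<open>0\<close> and has compact
  support. Testing the momentum equation with \<open>\<xi>(t) \<nabla>W(|x|)\<close> and the continuity equation with
  \<open>\<xi>'(t) W(|x|)\<close> and eliminating the common term \<open>\<integral>\<integral> \<rho> v \<bullet> \<nabla>W \<xi>'\<close> gives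
  \<open>\<integral> \<rho>\<^sub>0 v\<^sub>0 \<bullet> \<nabla>W + \<integral>\<integral> (\<rho> v \<otimes> v : \<nabla>\<^sup>2W + p \<Delta>W + k \<rho> \<nabla>\<Phi> \<bullet> \<nabla>W) \<xi> = \<integral>\<integral> \<rho> W \<xi>''\<close>.
  The Poisson equation turns \<open>\<rho> \<nabla>\<Phi> = \<Delta>\<Phi> \<nabla>\<Phi>\<close> into the divergence of a quadratic expression in
  \<open>\<nabla>\<Phi>\<close>, so that \<open>\<integral> \<rho> \<nabla>\<Phi> \<bullet> \<nabla>W = \<integral> |\<nabla>\<Phi>|\<^sup>2 \<Delta>W / 2 - \<nabla>\<^sup>2W(\<nabla>\<Phi>, \<nabla>\<Phi>)\<close>. With the Hessian of \<open>W\<close>, which is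
  \<open>w\<close> in the radial direction and the mean of \<open>w\<close> over \<open>[0, |x|]\<close> in the tangential ones, the
  integrand on the left is the one of the theorem. It is nonnegative for \<open>N \<ge> 3\<close> because a
  non-increasing weight is below its mean, and the field terms cancel for \<open>N = 2\<close>, \<open>w = 1\<close>. If
  \<open>\<xi>\<close> is a fixed step function stretched to \<open>[\<tau>, 2\<tau>]\<close>, then \<open>|\<xi>''| \<le> c / (1 + t\<^sup>2)\<close> there and \<open>\<xi>'' = 0\<close>
  elsewhere; the growth condition bounds the right-hand side by \<open>c K\<^sub>1\<close> in the limit, and \<open>\<tau> \<rightarrow> \<infinity>\<close>
  gives the claim with a constant \<open>c\<close> that depends on the step function only
  (\<open>virial_inequality\<close>).

  What remains is to justify the use of \<open>W\<close>, which is neither smooth nor compactly supported.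

  \<^item> For the formula for \<open>\<Delta>\<Phi> \<nabla>\<Phi>\<close> at almost every time (\<open>poisson_slice\<close>), the product rule for weak
    derivatives and the symmetry of the second weak derivatives are needed. Both follow by
    testing with mollifications (\<open>weak_product_rule\<close>, \<open>weak_partial_commute\<close>), for which it is
    enough that mollification converges weakly in \<open>L\<^sup>2\<close> (\<open>conv_tendsto\<close>); this rests on the
    continuity of translations. The formula is integrated in time by Fubini's theorem
    (\<open>poisson_spacetime\<close>).
  \<^item> The identity then holds for smooth radial potentials \<open>G(|x|\<^sup>2)\<close> of compact support
    (\<open>radial_identity\<close>), in particular for polynomials \<open>G\<close> times a smooth cut-off. By the
    Weierstrass theorem it extends to twice continuously differentiable functions times that
    cut-off (\<open>C2_identity\<close>).
  \<^item> The weight is approximated from below by continuous functions that are constant near the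
    origin, its averages over short intervals to the right. Their potentials, cut off at large
    radii, have Hessians dominated by the weight of the integrability hypothesis
    (\<open>cut_average_bounds\<close>) and converging almost everywhere (\<open>cut_average_tendsto\<close>), so
    dominated convergence yields the identity, now as an inequality, for the weight itself
    (\<open>limit_inequality\<close>).
\<close>

section \<open>Smooth functions\<close>

lemma partial_eq:
  fixes f :: "real^'n::finite \<Rightarrow> real"
  assumes "(f has_derivative f') (at x)"
  shows "partial i f x = f' (axis i 1)"
  unfolding partial_def using frechet_derivative_at[OF assms] by simp

text \<open>Total differentiability of all iterated partial derivatives of order at most \<open>n\<close>.\<close>

primrec diffn :: "nat \<Rightarrow> (real^'n::finite \<Rightarrow> real) \<Rightarrow> bool" where
  "diffn 0 f \<longleftrightarrow> (\<forall>x. f differentiable (at x))"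
| "diffn (Suc n) f \<longleftrightarrow> (\<forall>x. f differentiable (at x)) \<and> (\<forall>i. diffn n (partial i f))"

lemma diffn_differentiable: "diffn n f \<Longrightarrow> f differentiable (at x)"
  by (cases n) auto

lemma diffn_Suc_imp: "diffn (Suc n) f \<Longrightarrow> diffn n f"
  by (induction n arbitrary: f) auto

lemma diffn_foldr: "diffn n f \<Longrightarrow> length js = n \<Longrightarrow> foldr partial js f differentiable (at x)"
proof (induction js arbitrary: f n rule: rev_induct)
  case Nil
  then show ?case by (simp add: diffn_differentiable)
next
  case (snoc i js)
  then obtain m where m: "n = Suc m" "length js = m" by simp
  then have "diffn m (partial i f)" using snoc.prems by simp
  then show ?case using snoc.IH m by simp
qed

lemma smooth_imp_diffn: "smooth f \<Longrightarrow> diffn n f"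
proof (induction n arbitrary: f)
  case 0
  then have "foldr partial [] f differentiable (at x)" for x unfolding smooth_def by blast
  then show ?case by simp
next
  case (Suc n)
  have "foldr partial [] f differentiable (at x)" for x using Suc.prems unfolding smooth_def by blast
  moreover have "smooth (partial i f)" for i
    unfolding smooth_def
  proof (intro allI)
    fix js x
    have "foldr partial (js @ [i]) f differentiable (at x)"
      using Suc.prems unfolding smooth_def by blast
    then show "foldr partial js (partial i f) differentiable (at x)" by simp
  qed
  ultimately show ?case using Suc.IH by simp
qed

lemma smooth_iff_diffn: "smooth f \<longleftrightarrow> (\<forall>n. diffn n f)"
  using smooth_imp_diffn diffn_foldr unfolding smooth_def by blast

lemma smooth_partial: "smooth f \<Longrightarrow> smooth (partial i f)"
  by (metis smooth_iff_diffn diffn.simps(2))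

lemma smooth_differentiable: "smooth f \<Longrightarrow> f differentiable (at x)"
  using smooth_iff_diffn diffn_differentiable by blast

lemma partial_const: "partial i (\<lambda>x. c) = (\<lambda>x. 0)"
  by (rule ext, subst partial_eq[where f'="\<lambda>_. 0"]) auto

lemma partial_proj: "partial i (\<lambda>x. x $ j) = (\<lambda>x. if i = j then 1 else 0)"
proof (rule ext)
  fix x :: "real^'a"
  have "((\<lambda>x::real^'a. x $ j) has_derivative (\<lambda>h. h $ j)) (at x)"
    by (rule bounded_linear_imp_has_derivative[OF bounded_linear_vec_nth])
  from partial_eq[OF this, of i] show "partial i (\<lambda>x. x $ j) x = (if i = j then 1 else 0)"
    by (auto simp: axis_def)
qed

lemma partial_add:
  assumes "f differentiable (at x)" "g differentiable (at x)"
  shows "partial i (\<lambda>x. f x + g x) x = partial i f x + partial i g x"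
proof -
  note d = assms[unfolded frechet_derivative_works]
  show ?thesis
    using partial_eq[OF has_derivative_add[OF d(1) d(2)], of i] by (simp add: partial_def)
qed

lemma partial_mult:
  assumes "f differentiable (at x)" "g differentiable (at x)"
  shows "partial i (\<lambda>x. f x * g x) x = f x * partial i g x + partial i f x * g x"
proof -
  note d = assms[unfolded frechet_derivative_works]
  show ?thesis
    using partial_eq[OF has_derivative_mult[OF d(1) d(2)], of i] by (simp add: partial_def)
qed

lemma partial_compose:
  assumes "f differentiable (at x)" "(h has_real_derivative h') (at (f x))"
  shows "partial i (\<lambda>x. h (f x)) x = h' * partial i f x"
proof -
  note d = assms(1)[unfolded frechet_derivative_works]
  have "((\<lambda>x. h (f x)) has_derivative (\<lambda>y. h' * frechet_derivative f (at x) y)) (at x)"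
    using has_derivative_compose[OF d assms(2)[unfolded has_field_derivative_def]] by simp
  from partial_eq[OF this, of i] show ?thesis by (simp add: partial_def)
qed

lemma diffn_const: "diffn n (\<lambda>x. c)"
  by (induction n arbitrary: c) (auto simp: partial_const)

lemma diffn_proj: "diffn n (\<lambda>x. x $ j)"
proof -
  have *: "(\<lambda>x::real^'a. x $ j) differentiable (at x)" for x
    unfolding differentiable_def using bounded_linear_imp_has_derivative[OF bounded_linear_vec_nth] by blast
  show ?thesis
    by (cases n) (use * in \<open>auto simp: partial_proj diffn_const\<close>)
qed

lemma diffn_add: "diffn n f \<Longrightarrow> diffn n g \<Longrightarrow> diffn n (\<lambda>x. f x + g x)"
proof (induction n arbitrary: f g)
  case (Suc n)
  then have "partial i (\<lambda>x. f x + g x) = (\<lambda>x. partial i f x + partial i g x)" for i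
    by (intro ext partial_add) auto
  then show ?case using Suc by auto
qed auto

lemma diffn_mult: "diffn n f \<Longrightarrow> diffn n g \<Longrightarrow> diffn n (\<lambda>x. f x * g x)"
proof (induction n arbitrary: f g)
  case (Suc n)
  then have "partial i (\<lambda>x. f x * g x) = (\<lambda>x. f x * partial i g x + partial i f x * g x)" for i
    by (intro ext partial_mult) auto
  moreover have "diffn n f" "diffn n g" using Suc.prems diffn_Suc_imp by blast+
  ultimately show ?case using Suc by (auto intro!: diffn_add)
qed auto

lemma diffn_compose:
  assumes "\<And>k t. (h k has_real_derivative h (Suc k) t) (at t)"
  shows "diffn n f \<Longrightarrow> diffn n (\<lambda>x. h k (f x))"
proof -
  have hd: "h k differentiable (at t)" for k t
    using assms real_differentiable_def by blast
  show "diffn n f \<Longrightarrow> diffn n (\<lambda>x. h k (f x))"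
proof (induction n arbitrary: k)
  case 0
  then show ?case
    by (auto intro!: differentiable_compose[of "h k" f] hd)
next
  case (Suc n)
  then have "partial i (\<lambda>x. h k (f x)) = (\<lambda>x. h (Suc k) (f x) * partial i f x)" for i
    by (intro ext partial_compose assms) auto
  moreover have "(\<lambda>x. h k (f x)) differentiable at x" for x
    using Suc.prems
    by (auto intro!: differentiable_compose[of "h k" f] hd)
  ultimately show ?case using Suc diffn_Suc_imp[OF Suc.prems] by (auto intro!: diffn_mult)
qed
qed

lemma smooth_const: "smooth (\<lambda>x. c)"
  and smooth_proj: "smooth (\<lambda>x. x $ j)"
  by (simp_all add: smooth_iff_diffn diffn_const diffn_proj)

lemma smooth_add: "smooth f \<Longrightarrow> smooth g \<Longrightarrow> smooth (\<lambda>x. f x + g x)"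
  and smooth_mult: "smooth f \<Longrightarrow> smooth g \<Longrightarrow> smooth (\<lambda>x. f x * g x)"
  by (simp_all add: smooth_iff_diffn diffn_add diffn_mult)

lemma smooth_sum: "finite A \<Longrightarrow> (\<And>i. i \<in> A \<Longrightarrow> smooth (f i)) \<Longrightarrow> smooth (\<lambda>x. \<Sum>i\<in>A. f i x)"
  by (induction A rule: finite_induct) (auto simp: smooth_const smooth_add)

lemma smooth_compose:
  assumes "\<And>k t. (h k has_real_derivative h (Suc k) t) (at t)" "smooth f"
  shows "smooth (\<lambda>x. h k (f x))"
  using assms diffn_compose by (simp add: smooth_iff_diffn) blast

lemma smooth_norm_sq: "smooth (\<lambda>x. (norm x)\<^sup>2)"
proof -
  have "(\<lambda>x::real^'a. (norm x)\<^sup>2) = (\<lambda>x. \<Sum>i\<in>UNIV. x $ i * x $ i)"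
    by (auto simp: norm_eq_sqrt_inner inner_vec_def sum_nonneg)
  then show ?thesis by (auto intro!: smooth_sum smooth_mult smooth_proj)
qed

lemma partial_norm_sq: "partial i (\<lambda>x. (norm x)\<^sup>2) x = 2 * x $ i"
proof -
  have "((\<lambda>x. x \<bullet> x) has_derivative (\<lambda>h. x \<bullet> h + h \<bullet> x)) (at x)"
    by (rule has_derivative_inner[OF has_derivative_ident has_derivative_ident])
  then have "((\<lambda>x. (norm x)\<^sup>2) has_derivative (\<lambda>h. x \<bullet> h + h \<bullet> x)) (at x)"
    by (simp add: power2_norm_eq_inner)
  from partial_eq[OF this, of i] show ?thesis
    by (simp add: inner_axis inner_commute)
qed

lemma smooth_poly:
  fixes Q :: "real poly"
  assumes "smooth f"
  shows "smooth (\<lambda>x. poly Q (f x))"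
proof -
  have "smooth (\<lambda>x. (\<lambda>k. poly ((pderiv ^^ k) Q)) 0 (f x))"
    by (rule smooth_compose[OF _ assms]) (simp add: poly_DERIV)
  then show ?thesis by simp
qed

lemma smooth_continuous: "smooth f \<Longrightarrow> continuous_on A f"
  by (meson continuous_at_imp_continuous_on differentiable_imp_continuous_within smooth_differentiable)

subsection \<open>A smooth step function\<close>

text \<open>The derivatives of the flat function \<open>exp (- 1 / t)\<close>, extended by zero to \<open>t \<le> 0\<close>, are
  of the form \<open>P (1 / t) exp (- 1 / t)\<close> with polynomials \<open>P\<close>.\<close>

primrec flat_poly :: "nat \<Rightarrow> real poly" where
  "flat_poly 0 = 1"
| "flat_poly (Suc k) = [:0, 0, 1:] * (flat_poly k - pderiv (flat_poly k))"

definition flat :: "nat \<Rightarrow> real \<Rightarrow> real" where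
  "flat k t = (if t \<le> 0 then 0 else poly (flat_poly k) (1 / t) * exp (- (1 / t)))"

lemma poly_times_exp_tendsto_0: "((\<lambda>u. poly P u * exp (- u)) \<longlongrightarrow> 0) at_top" for P :: "real poly"
proof -
  have "((\<lambda>u. \<Sum>i\<le>degree P. coeff P i * (u ^ i / exp u)) \<longlongrightarrow> (\<Sum>i\<le>degree P. coeff P i * 0)) at_top"
    by (intro tendsto_intros tendsto_power_div_exp_0)
  then show ?thesis
    by (simp add: poly_altdef sum_distrib_right exp_minus divide_inverse mult.assoc)
qed

lemma flat_deriv: "(flat k has_real_derivative flat (Suc k) t) (at t)"
proof -
  consider "t < 0" | "t > 0" | "t = 0" by linarith
  then show ?thesis
  proof cases
    case 1
    have "((\<lambda>_. 0) has_real_derivative 0) (at t)" by simp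
    moreover have "open {..<0::real}" "t \<in> {..<0}" using 1 by auto
    ultimately have "(flat k has_real_derivative 0) (at t)"
      by (rule has_field_derivative_transform_within_open) (auto simp: flat_def)
    then show ?thesis using 1 by (simp add: flat_def)
  next
    case 2
    have "((\<lambda>t. poly (flat_poly k) (1 / t) * exp (- (1 / t))) has_real_derivative flat (Suc k) t) (at t)"
      using 2 unfolding flat_def
      by (auto intro!: derivative_eq_intros DERIV_chain2[OF poly_DERIV] simp: field_simps power2_eq_square)
    moreover have "open {0::real<..}" "t \<in> {0<..}" using 2 by auto
    ultimately show ?thesis
      by (rule has_field_derivative_transform_within_open) (auto simp: flat_def)
  next
    case 3
    have "((\<lambda>u. poly (pCons 0 (flat_poly k)) (inverse u) * exp (- inverse u)) \<longlongrightarrow> 0) (at_right 0)"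
      by (rule filterlim_compose[OF poly_times_exp_tendsto_0 filterlim_inverse_at_top_right])
    then have "((\<lambda>u. (flat k u - flat k 0) / (u - 0)) \<longlongrightarrow> 0) (at_right 0)"
      by (rule Lim_transform_eventually)
         (auto simp: eventually_at_right_less flat_def field_simps intro!: eventually_at_rightI[of 0 1])
    moreover have "((\<lambda>u. (flat k u - flat k 0) / (u - 0)) \<longlongrightarrow> 0) (at_left 0)"
      by (rule Lim_transform_eventually[OF tendsto_const])
         (auto simp: flat_def intro!: eventually_at_leftI[of "-1" 0])
    ultimately show ?thesis
      using 3 by (simp add: has_field_derivative_iff filterlim_split_at flat_def)
  qed
qed

lemma flat_0_nonneg: "flat 0 t \<ge> 0" and flat_0_pos: "t > 0 \<Longrightarrow> flat 0 t > 0"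
  by (auto simp: flat_def)

lemma flat_0_1_neq_0: "flat 0 (flat 0 1) \<noteq> 0"
  using flat_0_pos[OF flat_0_pos[of 1]] by simp

lemma flat_0_mono: "s \<le> t \<Longrightarrow> flat 0 s \<le> flat 0 t"
  by (auto simp: flat_def field_simps)

text \<open>A smooth function that is \<open>1\<close> on \<open>(-\<infinity>, 0]\<close> and \<open>0\<close> on \<open>[1, \<infinity>)\<close>; the inner flat
  function is the one that makes it exactly constant on the left.\<close>

definition step :: "real \<Rightarrow> real" where
  "step y = flat 0 (flat 0 1 - flat 0 y) / flat 0 (flat 0 1)"

text \<open>The first two derivatives of the step function.\<close>

definition step' :: "real \<Rightarrow> real" where
  "step' y = - flat 1 (flat 0 1 - flat 0 y) * flat 1 y / flat 0 (flat 0 1)"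

definition step'' :: "real \<Rightarrow> real" where
  "step'' y = (flat 2 (flat 0 1 - flat 0 y) * (flat 1 y)\<^sup>2
     - flat 1 (flat 0 1 - flat 0 y) * flat 2 y) / flat 0 (flat 0 1)"

lemma flat_deriv_chain:
  "(f has_real_derivative D) (at x within A) \<Longrightarrow>
    ((\<lambda>x. flat k (f x)) has_real_derivative flat (Suc k) (f x) * D) (at x within A)"
  by (rule DERIV_chain2[OF flat_deriv])

lemma step_deriv: "(step has_real_derivative step' y) (at y)"
  unfolding step_def[abs_def] step'_def
  by (auto intro!: derivative_eq_intros flat_deriv_chain simp: flat_0_1_neq_0)

lemma step'_deriv: "(step' has_real_derivative step'' y) (at y)"
proof -
  let ?c = "flat 0 (flat 0 1)"
  have 1: "((\<lambda>y. flat 0 1 - flat 0 y) has_real_derivative - flat 1 y) (at y)"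
    using DERIV_diff[OF DERIV_const flat_deriv[of 0 y]] by simp
  have 2: "((\<lambda>y. flat 1 (flat 0 1 - flat 0 y)) has_real_derivative
      flat 2 (flat 0 1 - flat 0 y) * - flat 1 y) (at y)"
    using flat_deriv_chain[OF 1, of 1] by (simp add: numeral_2_eq_2)
  have 3: "(flat 1 has_real_derivative flat 2 y) (at y)"
    using flat_deriv[of 1 y] by (simp add: numeral_2_eq_2)
  have "- (flat 2 (flat 0 1 - flat 0 y) * - flat 1 y * flat 1 y
      + flat 2 y * flat 1 (flat 0 1 - flat 0 y)) / ?c = step'' y"
    unfolding step''_def power2_eq_square by (simp add: algebra_simps)
  with DERIV_cdivide[OF DERIV_minus[OF DERIV_mult[OF 2 3]], of ?c] show ?thesis
    unfolding step'_def[abs_def] by simp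
qed

lemma flat_continuous: "continuous_on A f \<Longrightarrow> continuous_on A (\<lambda>x. flat k (f x))"
  using continuous_on_compose2[of UNIV "flat k" A f] DERIV_continuous[OF flat_deriv]
  by (simp add: continuous_at_imp_continuous_on)

lemma step''_continuous: "continuous_on A step''"
  unfolding step''_def[abs_def] divide_inverse by (intro continuous_intros flat_continuous)

lemma step_left: "y \<le> 0 \<Longrightarrow> step y = 1" "y \<le> 0 \<Longrightarrow> step' y = 0" "y \<le> 0 \<Longrightarrow> step'' y = 0"
  using flat_0_1_neq_0 by (auto simp: step_def step'_def step''_def flat_def[of _ y])

lemma step_right: assumes "y \<ge> 1" shows "step y = 0" "step' y = 0" "step'' y = 0"
proof -
  have "flat 0 1 - flat 0 y \<le> 0" using flat_0_mono assms by simp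
  then show "step y = 0" "step' y = 0" "step'' y = 0"
    by (auto simp: step_def step'_def step''_def flat_def)
qed

lemma step_range: "0 \<le> step y" "step y \<le> 1"
  using flat_0_mono[of "flat 0 1 - flat 0 y" "flat 0 1"] flat_0_pos[OF flat_0_pos[of 1]]
  by (auto simp: step_def flat_0_nonneg intro!: divide_nonneg_nonneg)

lemma step_derivs_bounded:
  obtains B where "B > 0" "\<And>y. \<bar>step' y\<bar> \<le> B" "\<And>y. \<bar>step'' y\<bar> \<le> B"
proof -
  have "continuous_on {0..1} step'"
    by (meson DERIV_continuous continuous_at_imp_continuous_on step'_deriv)
  then have "bounded (step' ` {0..1})" "bounded (step'' ` {0..1})"
    using step''_continuous by (auto intro!: compact_imp_bounded compact_continuous_image)
  then obtain B1 B2 where B: "\<And>y. y \<in> {0..1} \<Longrightarrow> \<bar>step' y\<bar> \<le> B1" "\<And>y. y \<in> {0..1} \<Longrightarrow> \<bar>step'' y\<bar> \<le> B2"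
    unfolding bounded_iff by (metis imageI real_norm_def)
  have "\<bar>step' y\<bar> \<le> max 1 (max B1 B2) \<and> \<bar>step'' y\<bar> \<le> max 1 (max B1 B2)" for y
  proof (cases "y \<in> {0..1}")
    case True then show ?thesis using B[of y] by linarith
  next
    case False then have "y \<le> 0 \<or> y \<ge> 1" by auto
    then show ?thesis using step_left step_right by force
  qed
  then show ?thesis using that[of "max 1 (max B1 B2)"] by auto
qed

lemma smooth_step:
  assumes "smooth f" shows "smooth (\<lambda>x. step (f x))"
proof -
  have "smooth (\<lambda>x. flat 0 (f x))" by (rule smooth_compose[where h=flat, OF flat_deriv assms])
  then have "smooth (\<lambda>x. flat 0 1 + (-1) * flat 0 (f x))"
    by (intro smooth_add smooth_mult smooth_const)
  then have "smooth (\<lambda>x. flat 0 (flat 0 1 + (-1) * flat 0 (f x)))"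
    by (rule smooth_compose[where h=flat, OF flat_deriv])
  then have "smooth (\<lambda>x. inverse (flat 0 (flat 0 1)) * flat 0 (flat 0 1 + (-1) * flat 0 (f x)))"
    by (intro smooth_mult smooth_const)
  then show ?thesis by (simp add: step_def field_simps)
qed

subsection \<open>Test functions\<close>

lemma test_funI:
  assumes "smooth f" "\<And>x. norm x > R \<Longrightarrow> f x = 0" shows "test_fun f"
proof -
  have "bounded {x. f x \<noteq> 0}"
    using assms(2) by (auto simp: bounded_iff not_less[symmetric])
  then show ?thesis using assms(1) by (simp add: test_fun_def compact_closure)
qed

lemma test_fun_support:
  assumes "test_fun f" obtains R where "R > 0" "\<And>x. norm x \<ge> R \<Longrightarrow> f x = 0"
proof -
  obtain R where R: "\<And>x. f x \<noteq> 0 \<Longrightarrow> norm x \<le> R"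
    using assms by (auto simp: test_fun_def compact_closure bounded_iff)
  show ?thesis by (rule that[of "max 1 (R + 1)"]) (use R in force)+
qed

lemma partial_eq_0_outside:
  fixes f :: "real^'n::finite \<Rightarrow> real"
  assumes "\<And>x. norm x > R \<Longrightarrow> f x = 0" "norm x > R"
  shows "partial i f x = 0"
proof -
  have "open {x::real^'n. norm x > R}"
    by (intro open_Collect_less continuous_intros)
  moreover have "((\<lambda>_. 0) has_derivative (\<lambda>_. 0)) (at x)" by simp
  ultimately have "(f has_derivative (\<lambda>_. 0)) (at x)"
    using assms(2) has_derivative_transform_within_open[of "\<lambda>_. 0" "\<lambda>_. 0" x UNIV "{x. norm x > R}" f]
      assms(1) by (auto simp: assms(1))
  then show ?thesis using partial_eq by fastforce
qed

lemma test_fun_partial: assumes "test_fun f" shows "test_fun (partial i f)"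
proof -
  obtain R where "\<And>x. norm x \<ge> R \<Longrightarrow> f x = 0" using test_fun_support[OF assms] by blast
  then show ?thesis using assms
    by (intro test_funI[where R=R] smooth_partial partial_eq_0_outside) (auto simp: test_fun_def)
qed

lemma test_fun_mult:
  assumes "smooth f" "test_fun g" shows "test_fun (\<lambda>x. f x * g x)"
proof -
  obtain R where "\<And>x. norm x \<ge> R \<Longrightarrow> g x = 0" using test_fun_support[OF assms(2)] by blast
  then show ?thesis using assms
    by (intro test_funI[where R=R] smooth_mult) (auto simp: test_fun_def)
qed

section \<open>Convolution with test functions\<close>

lemma smooth_has_derivative:
  assumes "smooth f"
  shows "(f has_derivative (\<lambda>h. \<Sum>i\<in>UNIV. h $ i * partial i f x)) (at x)"
proof -
  have d: "(f has_derivative frechet_derivative f (at x)) (at x)"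
    using smooth_differentiable[OF assms] frechet_derivative_works by blast
  interpret linear "frechet_derivative f (at x)"
    using d has_derivative_linear by blast
  have "frechet_derivative f (at x) h = (\<Sum>i\<in>UNIV. h $ i * partial i f x)" for h
  proof -
    have "frechet_derivative f (at x) h = frechet_derivative f (at x) (\<Sum>i\<in>UNIV. h $ i *\<^sub>R axis i 1)"
      using basis_expansion[of h] by (simp only: scalar_mult_eq_scaleR)
    also have "\<dots> = (\<Sum>i\<in>UNIV. h $ i * partial i f x)"
      by (simp add: sum scale partial_def)
    finally show ?thesis .
  qed
  then have "frechet_derivative f (at x) = (\<lambda>h. \<Sum>i\<in>UNIV. h $ i * partial i f x)" by (rule ext)
  with d show ?thesis by simp
qed

lemma test_fun_bounded:
  assumes "test_fun f" obtains B where "B > 0" "\<And>x. \<bar>f x\<bar> \<le> B"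
proof -
  obtain R where R: "\<And>x. norm x \<ge> R \<Longrightarrow> f x = 0" using test_fun_support[OF assms] by blast
  have "continuous_on (cball 0 R) f" using assms smooth_continuous test_fun_def by blast
  then have "bounded (f ` cball 0 R)" by (intro compact_imp_bounded compact_continuous_image) auto
  then obtain B where B: "\<And>x. x \<in> cball 0 R \<Longrightarrow> \<bar>f x\<bar> \<le> B"
    unfolding bounded_iff by (metis imageI real_norm_def)
  have "\<bar>f x\<bar> \<le> max 1 B" for x
    using B[of x] R[of x] by (cases "norm x \<le> R") auto
  then show ?thesis using that[of "max 1 B"] by auto
qed

lemma test_fun_lipschitz:
  fixes f :: "real^'n::finite \<Rightarrow> real"
  assumes "test_fun f" obtains L where "L > 0" "\<And>x y. \<bar>f x - f y\<bar> \<le> L * norm (x - y)"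
proof -
  have "\<forall>i. \<exists>B. \<forall>x. \<bar>partial i f x\<bar> \<le> B"
    using test_fun_bounded[OF test_fun_partial[OF assms]] by metis
  then obtain B where B: "\<And>i x. \<bar>partial i f x\<bar> \<le> B i" by metis
  define L where "L = 1 + (\<Sum>i\<in>UNIV. \<bar>B i\<bar>)"
  have der: "(f has_derivative (\<lambda>h. \<Sum>i\<in>UNIV. h $ i * partial i f x)) (at x)" for x
    using assms smooth_has_derivative test_fun_def by blast
  have "onorm (\<lambda>h. \<Sum>i\<in>UNIV. h $ i * partial i f x) \<le> L" for x
  proof (rule onorm_le)
    fix h :: "real^'n"
    have "norm (\<Sum>i\<in>UNIV. h $ i * partial i f x) \<le> (\<Sum>i\<in>UNIV. norm h * \<bar>B i\<bar>)"
      by (rule sum_norm_le) (use B component_le_norm_cart in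
        \<open>auto simp: abs_mult intro!: mult_mono intro: order.trans[OF B abs_ge_self]\<close>)
    also have "\<dots> \<le> L * norm h" by (simp add: L_def sum_distrib_left[symmetric] algebra_simps)
    finally show "norm (\<Sum>i\<in>UNIV. h $ i * partial i f x) \<le> L * norm h" .
  qed
  then have "norm (f x - f y) \<le> L * norm (x - y)" for x y
    using differentiable_bound[of UNIV f "\<lambda>x h. \<Sum>i\<in>UNIV. h $ i * partial i f x" L x y] der
    by (auto simp: norm_minus_commute abs_minus_commute)
  moreover have "L > 0" unfolding L_def by (smt (verit) sum_nonneg abs_ge_zero)
  ultimately show ?thesis using that by auto
qed

lemma test_fun_taylor:
  fixes f :: "real^'n::finite \<Rightarrow> real"
  assumes "test_fun f"
  obtains C where "C > 0"
    "\<And>u h. \<bar>f (u + h) - f u - (\<Sum>i\<in>UNIV. h $ i * partial i f u)\<bar> \<le> C * (norm h)\<^sup>2"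
proof -
  have "\<forall>i. \<exists>L>0. \<forall>x y. \<bar>partial i f x - partial i f y\<bar> \<le> L * norm (x - y)"
    using test_fun_lipschitz[OF test_fun_partial[OF assms]] by metis
  then obtain L where L0: "\<And>i. L i > 0"
    and L: "\<And>i x y. \<bar>partial i f x - partial i f y\<bar> \<le> L i * norm (x - y)" by metis
  define C where "C = (\<Sum>i\<in>UNIV. L i)"
  let ?D = "\<lambda>x h. \<Sum>i\<in>UNIV. h $ i * partial i f x"
  have der: "(f has_derivative ?D x) (at x)" for x
    using assms smooth_has_derivative test_fun_def by blast
  have "\<bar>f (u + h) - f u - ?D u h\<bar> \<le> C * (norm h)\<^sup>2" for u h
  proof -
    have "norm (f (u + h) - f u - ?D u (u + h - u)) \<le> norm (u + h - u) * (C * norm h)"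
    proof (rule differentiable_bound_linearization[where S="cball u (norm h)"])
      fix x assume "x \<in> cball u (norm h)"
      then have x: "norm (x - u) \<le> norm h" by (simp add: dist_norm norm_minus_commute)
      show "onorm (?D x - ?D u) \<le> C * norm h"
      proof (rule onorm_le)
        fix y :: "real^'n"
        have "(?D x - ?D u) y = (\<Sum>i\<in>UNIV. y $ i * (partial i f x - partial i f u))"
          by (simp add: sum_subtractf right_diff_distrib)
        also have "norm \<dots> \<le> (\<Sum>i\<in>UNIV. norm y * (L i * norm h))"
        proof (rule sum_norm_le)
          fix i :: 'n
          have "\<bar>partial i f x - partial i f u\<bar> \<le> L i * norm h"
            using L[of i x u] x L0[of i] by (meson less_imp_le mult_left_mono order.trans)
          then show "norm (y $ i * (partial i f x - partial i f u)) \<le> norm y * (L i * norm h)"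
            by (simp add: abs_mult mult_mono component_le_norm_cart)
        qed
        also have "\<dots> = C * norm h * norm y"
          by (simp add: C_def sum_distrib_left sum_distrib_right mult_ac)
        finally show "norm ((?D x - ?D u) y) \<le> C * norm h * norm y" .
      qed
      show "(f has_derivative ?D x) (at x within cball u (norm h))"
        using der has_derivative_at_withinI by blast
    qed (auto simp: dist_norm mult_left_le_one_le)
    then show ?thesis by (simp add: power2_eq_square mult_ac)
  qed
  moreover have "C > 0" unfolding C_def by (rule sum_pos) (auto simp: L0)
  ultimately show ?thesis using that by blast
qed

text \<open>The convolution \<open>F * \<eta>\<close>; the derivatives fall on the second factor.\<close>

definition conv :: "(real^'n::finite \<Rightarrow> real) \<Rightarrow> (real^'n \<Rightarrow> real) \<Rightarrow> real^'n \<Rightarrow> real" where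
  "conv F \<eta> x = (\<integral>y. F y * \<eta> (x - y) \<partial>lebesgue)"

lemma locally_integrable_cball:
  "locally_integrable F \<Longrightarrow> integrable lebesgue (\<lambda>x. indicator (cball a R) x * F x)"
  using integrable_restrict_space[of "cball a R" lebesgue F]
  by (simp add: locally_integrable_def)

lemma locally_integrable_mult:
  assumes "locally_integrable F" "continuous_on UNIV g" "\<And>y. y \<notin> cball a R \<Longrightarrow> g y = 0"
  shows "integrable lebesgue (\<lambda>y. F y * g y)"
proof -
  have "bounded (g ` cball a R)"
    by (intro compact_imp_bounded compact_continuous_image)
       (use assms(2) continuous_on_subset in auto)
  then obtain B where B: "\<And>x. x \<in> cball a R \<Longrightarrow> \<bar>g x\<bar> \<le> B"
    unfolding bounded_iff by (metis imageI real_norm_def)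
  note i = locally_integrable_cball[OF assms(1), of a R]
  have g: "g \<in> borel_measurable lebesgue"
    using assms(2) by (intro measurable_completion) (auto intro: borel_measurable_continuous_onI)
  have eq: "(\<lambda>y. F y * g y) = (\<lambda>y. indicator (cball a R) y * F y * g y)"
    using assms(3) by (intro ext) (auto simp: indicator_def simp del: mem_cball)
  show ?thesis unfolding eq
  proof (rule Bochner_Integration.integrable_bound)
    show "integrable lebesgue (\<lambda>y. B * (indicator (cball a R) y * F y))" using i by simp
    show "(\<lambda>y. indicator (cball a R) y * F y * g y) \<in> borel_measurable lebesgue"
      using i g by (intro borel_measurable_times borel_measurable_integrable[OF i])
    show "AE y in lebesgue. norm (indicator (cball a R) y * F y * g y)
        \<le> norm (B * (indicator (cball a R) y * F y))"
    proof (rule AE_I2)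
      fix y
      show "norm (indicator (cball a R) y * F y * g y) \<le> norm (B * (indicator (cball a R) y * F y))"
      proof (cases "y \<in> cball a R")
        case True
        then have "\<bar>g y\<bar> \<le> \<bar>B\<bar>" using B[of y] by linarith
        then have "\<bar>F y\<bar> * \<bar>g y\<bar> \<le> \<bar>F y\<bar> * \<bar>B\<bar>" by (rule mult_left_mono) simp
        then show ?thesis using True by (simp add: abs_mult mult.commute)
      qed auto
    qed
  qed
qed

lemma test_fun_shift_integrable:
  assumes "locally_integrable F" "test_fun \<eta>"
  shows "integrable lebesgue (\<lambda>y. F y * \<eta> (x - y))"
proof -
  obtain R where R: "\<And>x. norm x \<ge> R \<Longrightarrow> \<eta> x = 0" using test_fun_support[OF assms(2)] by blast
  have "continuous_on UNIV (\<lambda>y. \<eta> (x - y))"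
    by (rule continuous_on_compose2[of UNIV \<eta>])
       (use assms(2) smooth_continuous test_fun_def in \<open>auto intro!: continuous_intros\<close>)
  then show ?thesis
    by (rule locally_integrable_mult[OF assms(1), where a=x and R=R])
       (use R in \<open>auto simp: dist_norm\<close>)
qed

lemma conv_has_derivative:
  fixes F :: "real^'n::finite \<Rightarrow> real"
  assumes F: "locally_integrable F" and \<eta>: "test_fun \<eta>"
  shows "(conv F \<eta> has_derivative (\<lambda>h. \<Sum>i\<in>UNIV. h $ i * conv F (partial i \<eta>) x)) (at x)"
proof -
  obtain R where R0: "R > 0" and R: "\<And>x. norm x \<ge> R \<Longrightarrow> \<eta> x = 0" using test_fun_support[OF \<eta>] by blast
  have Rp: "partial i \<eta> u = 0" if "norm u > R" for u i
    by (rule partial_eq_0_outside[OF _ that]) (use R in auto)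
  obtain C where C0: "C > 0" and
    C: "\<And>u h. \<bar>\<eta> (u + h) - \<eta> u - (\<Sum>i\<in>UNIV. h $ i * partial i \<eta> u)\<bar> \<le> C * (norm h)\<^sup>2"
    using test_fun_taylor[OF \<eta>] by blast
  define I where "I = (\<integral>y. \<bar>indicator (cball x (R + 1)) y * F y\<bar> \<partial>lebesgue)"
  have bound: "\<bar>conv F \<eta> z - conv F \<eta> x - (\<Sum>i\<in>UNIV. (z - x) $ i * conv F (partial i \<eta>) x)\<bar>
      \<le> C * I * (norm (z - x))\<^sup>2" if z: "dist z x < 1" for z
  proof -
    let ?h = "z - x"
    let ?r = "\<lambda>y. F y * \<eta> (z - y) - F y * \<eta> (x - y) - (\<Sum>i\<in>UNIV. ?h $ i * (F y * partial i \<eta> (x - y)))"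
    have i: "integrable lebesgue (\<lambda>y. F y * \<eta> (z - y))" "integrable lebesgue (\<lambda>y. F y * \<eta> (x - y))"
      "\<And>i. integrable lebesgue (\<lambda>y. F y * partial i \<eta> (x - y))"
      using test_fun_shift_integrable[OF F] \<eta> test_fun_partial by blast+
    have "conv F \<eta> z - conv F \<eta> x - (\<Sum>i\<in>UNIV. ?h $ i * conv F (partial i \<eta>) x) = (\<integral>y. ?r y \<partial>lebesgue)"
      unfolding conv_def by (simp add: i Bochner_Integration.integral_diff Bochner_Integration.integral_sum)
    also have "\<bar>\<dots>\<bar> \<le> (\<integral>y. C * (norm ?h)\<^sup>2 * \<bar>indicator (cball x (R + 1)) y * F y\<bar> \<partial>lebesgue)"
    proof (rule order.trans[OF integral_abs_bound], rule integral_mono)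
      show "integrable lebesgue (\<lambda>y. \<bar>?r y\<bar>)" using i by auto
      show "integrable lebesgue (\<lambda>y. C * (norm ?h)\<^sup>2 * \<bar>indicator (cball x (R + 1)) y * F y\<bar>)"
        using locally_integrable_cball[OF F] by auto
      fix y
      have eq: "?r y = F y * (\<eta> ((x - y) + ?h) - \<eta> (x - y) - (\<Sum>i\<in>UNIV. ?h $ i * partial i \<eta> (x - y)))"
        by (simp add: algebra_simps sum_distrib_left)
      show "\<bar>?r y\<bar> \<le> C * (norm ?h)\<^sup>2 * \<bar>indicator (cball x (R + 1)) y * F y\<bar>"
      proof (cases "y \<in> cball x (R + 1)")
        case True
        then show ?thesis unfolding eq abs_mult using mult_left_mono[OF C[of "x - y" ?h], of "\<bar>F y\<bar>"]
          by (simp add: mult_ac)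
      next
        case False
        then have "norm (x - y) > R + 1" by (simp add: dist_norm)
        moreover then have "norm (z - y) > R"
          using z norm_triangle_ineq4[of "z - y" "z - x"] by (auto simp: dist_norm)
        ultimately show ?thesis using R Rp C0 by simp
      qed
    qed
    also have "\<dots> = C * I * (norm ?h)\<^sup>2" by (simp add: I_def)
    finally show ?thesis .
  qed
  show ?thesis
  proof (rule has_derivativeI_sandwich[where e=1 and H="\<lambda>z. C * I * norm (z - x)"])
    show "bounded_linear (\<lambda>h::real^'n. \<Sum>i\<in>UNIV. h $ i * conv F (partial i \<eta>) x)"
      by (intro bounded_linear_sum bounded_linear_mult_const bounded_linear_vec_nth)
    show "((\<lambda>z. C * I * norm (z - x)) \<longlongrightarrow> 0) (at x)"
      by (rule tendsto_eq_intros refl | simp)+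
    fix y assume "y \<noteq> x" "dist y x < 1"
    then show "norm (conv F \<eta> y - conv F \<eta> x - (\<Sum>i\<in>UNIV. (y - x) $ i * conv F (partial i \<eta>) x)) / norm (y - x)
        \<le> C * I * norm (y - x)"
      using bound[of y] by (simp add: field_simps power2_eq_square)
  qed auto
qed

lemma partial_conv:
  assumes "locally_integrable F" "test_fun \<eta>"
  shows "partial i (conv F \<eta>) = conv F (partial i \<eta>)"
proof (rule ext)
  fix x
  have "partial i (conv F \<eta>) x = (\<Sum>j\<in>UNIV. axis i 1 $ j * conv F (partial j \<eta>) x)"
    by (rule partial_eq[OF conv_has_derivative[OF assms]])
  also have "\<dots> = (\<Sum>j\<in>UNIV. if j = i then conv F (partial j \<eta>) x else 0)"
    by (rule sum.cong) (auto simp: axis_def)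
  finally show "partial i (conv F \<eta>) x = conv F (partial i \<eta>) x" by simp
qed

lemma smooth_conv:
  assumes "locally_integrable F" "test_fun \<eta>" shows "smooth (conv F \<eta>)"
proof -
  have "diffn n (conv F \<eta>)" for n
    using assms(2)
  proof (induction n arbitrary: \<eta>)
    case 0
    then show ?case using conv_has_derivative[OF assms(1)] by (auto simp: differentiable_def)
  next
    case (Suc n)
    then show ?case using conv_has_derivative[OF assms(1)]
      by (auto simp: differentiable_def partial_conv[OF assms(1)] test_fun_partial)
  qed
  then show ?thesis by (simp add: smooth_iff_diffn)
qed

text \<open>Reflected translates of test functions are test functions. Testing with them moves a
  derivative from the second factor of a convolution to a weak derivative of the first.\<close>

lemma partial_reflect:
  fixes x :: "real^'n::finite" and \<eta> :: "real^'n::finite \<Rightarrow> real"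
  assumes "smooth \<eta>" shows "partial i (\<lambda>y. \<eta> (x - y)) y = - partial i \<eta> (x - y)"
proof -
  have "((\<lambda>y. x - y) has_derivative (\<lambda>h. - h)) (at y)" by (auto intro!: derivative_eq_intros)
  from has_derivative_compose[OF this smooth_has_derivative[OF assms]]
  have "partial i (\<lambda>y. \<eta> (x - y)) y = (\<Sum>j\<in>UNIV. (- axis i 1) $ j * partial j \<eta> (x - y))"
    by (rule partial_eq)
  also have "\<dots> = (\<Sum>j\<in>UNIV. if j = i then - partial j \<eta> (x - y) else 0)"
    by (rule sum.cong) (auto simp: axis_def)
  finally show ?thesis by simp
qed

lemma smooth_reflect:
  fixes x :: "real^'n::finite" and \<eta> :: "real^'n::finite \<Rightarrow> real"
  assumes "smooth \<eta>" shows "smooth (\<lambda>y. \<eta> (x - y))"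
proof -
  have "diffn n (\<lambda>y. c * \<eta> (x - y))" for n c
    using assms
  proof (induction n arbitrary: \<eta> c)
    case 0
    have "((\<lambda>y. x - y) has_derivative (\<lambda>h. - h)) (at y)" for y by (auto intro!: derivative_eq_intros)
    from has_derivative_compose[OF this smooth_has_derivative[OF 0]]
    show ?case unfolding diffn.simps differentiable_def using has_derivative_mult_right by blast
  next
    case (Suc n)
    have "((\<lambda>y. x - y) has_derivative (\<lambda>h. - h)) (at y)" for y by (auto intro!: derivative_eq_intros)
    from has_derivative_compose[OF this smooth_has_derivative[OF Suc.prems]]
    have d: "(\<lambda>y. \<eta> (x - y)) differentiable (at y)" for y by (auto simp: differentiable_def)
    have "partial i (\<lambda>y. c * \<eta> (x - y)) = (\<lambda>y. (- c) * partial i \<eta> (x - y))" for i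
      by (rule ext) (simp add: partial_mult d partial_reflect[OF Suc.prems] partial_const)
    then show ?case using Suc.IH[OF smooth_partial[OF Suc.prems], where c="- c"] d by simp
  qed
  from this[of _ 1] show ?thesis by (simp add: smooth_iff_diffn)
qed

lemma test_fun_reflect:
  fixes x :: "real^'n::finite" and \<eta> :: "real^'n::finite \<Rightarrow> real"
  assumes "test_fun \<eta>" shows "test_fun (\<lambda>y. \<eta> (x - y))"
proof -
  obtain R where R: "\<And>x. norm x \<ge> R \<Longrightarrow> \<eta> x = 0" using test_fun_support[OF assms] by blast
  show ?thesis
  proof (rule test_funI[where R="R + norm x"])
    show "smooth (\<lambda>y. \<eta> (x - y))" using assms smooth_reflect test_fun_def by blast
    fix y :: "real^'n" assume "R + norm x < norm y"
    then have "norm (x - y) \<ge> R" using norm_triangle_ineq2[of y x] by (simp add: norm_minus_commute)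
    then show "\<eta> (x - y) = 0" by (rule R)
  qed
qed

lemma conv_weak_partial:
  assumes "weak_partial i f g" "test_fun \<eta>"
  shows "conv f (partial i \<eta>) = conv g \<eta>"
proof (rule ext)
  fix x
  have "(\<integral>y. f y * partial i (\<lambda>y. \<eta> (x - y)) y \<partial>lebesgue) = - (\<integral>y. g y * \<eta> (x - y) \<partial>lebesgue)"
    using assms(1) test_fun_reflect[OF assms(2), of x] unfolding weak_partial_def by blast
  then show "conv f (partial i \<eta>) x = conv g \<eta> x"
    using assms(2) by (simp add: conv_def partial_reflect test_fun_def)
qed

subsection \<open>Radial mollifiers\<close>

text \<open>A smooth function of \<open>|z|\<^sup>2\<close>, positive exactly for \<open>|z| < e\<close> if \<open>e > 0\<close>.\<close>

definition bump :: "real \<Rightarrow> real^'n::finite \<Rightarrow> real" where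
  "bump e z = flat 0 (e\<^sup>2 - (norm z)\<^sup>2)"

lemma test_fun_bump: assumes "e > 0" shows "test_fun (bump e)"
proof (rule test_funI[where R=e])
  have "smooth (\<lambda>z. flat 0 (e\<^sup>2 + (-1) * (norm z)\<^sup>2))"
    by (intro smooth_compose[where h=flat, OF flat_deriv] smooth_add smooth_mult smooth_const smooth_norm_sq)
  then show "smooth (bump e)" by (simp add: bump_def[abs_def])
  show "bump e x = 0" if "e < norm x" for x
    using that assms power_mono[of e "norm x" 2] by (simp add: bump_def flat_def)
qed

lemma bump_eq_0: "e > 0 \<Longrightarrow> norm z \<ge> e \<Longrightarrow> bump e z = 0"
  using power_mono[of e "norm z" 2] by (simp add: bump_def flat_def)

lemma bump_nonneg: "bump e z \<ge> 0"
  by (simp add: bump_def flat_0_nonneg)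

lemma bump_integral_pos:
  assumes "e > 0" shows "(\<integral>z. bump e (z::real^'n::finite) \<partial>lebesgue) > 0"
proof -
  have li: "locally_integrable (\<lambda>_::real^'n. 1)"
    unfolding locally_integrable_def
    by (auto intro: integrable_const_ivl finite_measure.integrable_const finite_measure_lebesgue_on lmeasurable_compact)
  have "continuous_on UNIV (bump e :: real^'n \<Rightarrow> real)"
    using test_fun_bump[OF assms] smooth_continuous test_fun_def by blast
  from locally_integrable_mult[OF li this, of 0 e] have int: "integrable lebesgue (bump e :: real^'n \<Rightarrow> real)"
    by (simp add: bump_eq_0[OF assms])
  have "\<not> (AE z in lebesgue. bump e (z::real^'n) = 0)"
  proof
    assume "AE z in lebesgue. bump e (z::real^'n) = 0"
    then have "AE z in lebesgue. z \<notin> ball (0::real^'n) e"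
    proof eventually_elim
      case (elim z)
      then show ?case using assms power_strict_mono[of "norm z" e 2] flat_0_pos[of "e\<^sup>2 - (norm z)\<^sup>2"]
        by (auto simp: bump_def)
    qed
    then have "emeasure lebesgue (ball (0::real^'n) e) = 0"
      by (subst (asm) AE_iff_measurable[of "ball 0 e"]) auto
    then have "measure lebesgue (ball (0::real^'n) e) = 0" by (simp add: measure_def)
    then show False using content_ball_pos[OF assms, of "0::real^'n"] by simp
  qed
  then have "(\<integral>z. bump e (z::real^'n) \<partial>lebesgue) \<noteq> 0"
    by (subst integral_nonneg_eq_0_iff_AE[OF int]) (auto simp: bump_nonneg)
  moreover have "(\<integral>z. bump e (z::real^'n) \<partial>lebesgue) \<ge> 0"
    by (rule integral_nonneg_AE) (simp add: bump_nonneg)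
  ultimately show ?thesis by linarith
qed

text \<open>Nonnegative radial mollifiers of integral \<open>1\<close> supported in the ball of radius \<open>1 / (n + 1)\<close>;
  normalising a bump of the right radius makes scaling unnecessary.\<close>

definition mollifier :: "nat \<Rightarrow> real^'n::finite \<Rightarrow> real" where
  "mollifier n z = bump (inverse (real (Suc n))) z / (\<integral>z. bump (inverse (real (Suc n))) (z::real^'n) \<partial>lebesgue)"

lemma test_fun_mollifier: "test_fun (mollifier n :: real^'a::finite \<Rightarrow> real)"
proof -
  let ?c = "\<integral>z. bump (inverse (real (Suc n))) (z::real^'a) \<partial>lebesgue"
  have "test_fun (\<lambda>z::real^'a. inverse ?c * bump (inverse (real (Suc n))) z)"
    by (rule test_fun_mult[OF smooth_const test_fun_bump]) simp
  moreover have "mollifier n = (\<lambda>z::real^'a. inverse ?c * bump (inverse (real (Suc n))) z)"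
    by (rule ext) (simp only: mollifier_def divide_inverse_commute)
  ultimately show ?thesis by simp
qed

lemma mollifier_nonneg: "mollifier n z \<ge> 0"
  unfolding mollifier_def by (intro divide_nonneg_nonneg integral_nonneg_AE) (auto simp: bump_nonneg)

lemma mollifier_eq_0: "norm z \<ge> inverse (real (Suc n)) \<Longrightarrow> mollifier n z = 0"
  unfolding mollifier_def by (subst bump_eq_0) auto

lemma mollifier_integral: "(\<integral>z. mollifier n (z::real^'n::finite) \<partial>lebesgue) = 1"
proof -
  define c where "c = (\<integral>z. bump (inverse (real (Suc n))) (z::real^'n) \<partial>lebesgue)"
  have *: "c > 0" unfolding c_def
    by (rule bump_integral_pos) simp
  have "mollifier n = (\<lambda>z::real^'n. bump (inverse (real (Suc n))) z / c)"
    by (rule ext) (simp only: mollifier_def c_def)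
  then have "(\<integral>z. mollifier n (z::real^'n::finite) \<partial>lebesgue) = c / c"
    by (simp only: integral_divide_zero c_def)
  then show ?thesis using * by simp
qed

lemma partial_radial:
  assumes "(g has_real_derivative g') (at ((norm x)\<^sup>2))"
  shows "partial i (\<lambda>x. g ((norm x)\<^sup>2)) x = g' * (2 * x $ i)"
  using partial_compose[OF smooth_differentiable[OF smooth_norm_sq] assms, of i]
  by (simp add: partial_norm_sq)

lemma partial_partial_radial:
  fixes x :: "real^'n::finite"
  assumes 1: "\<And>s. (g has_real_derivative g' s) (at s)" and 2: "\<And>s. (g' has_real_derivative g'' s) (at s)"
  shows "partial j (partial i (\<lambda>x. g ((norm x)\<^sup>2))) x
    = 4 * x $ i * x $ j * g'' ((norm x)\<^sup>2) + (if i = j then 2 * g' ((norm x)\<^sup>2) else 0)"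
proof -
  have eq: "partial i (\<lambda>x. g ((norm x)\<^sup>2)) = (\<lambda>x. g' ((norm x)\<^sup>2) * (2 * x $ i))"
    by (rule ext) (rule partial_radial[OF 1])
  have "((\<lambda>x::real^'n. g' ((norm x)\<^sup>2)) has_derivative (\<lambda>h. g'' ((norm x)\<^sup>2) * (\<Sum>i\<in>UNIV. h $ i * partial i (\<lambda>x. (norm x)\<^sup>2) x))) (at x)"
    by (rule has_derivative_compose[OF smooth_has_derivative[OF smooth_norm_sq]
      2[unfolded has_field_derivative_def]])
  then have d1: "(\<lambda>x::real^'n. g' ((norm x)\<^sup>2)) differentiable (at x)" by (rule differentiableI)
  have d2: "(\<lambda>x::real^'n. x $ i) differentiable (at x)" "(\<lambda>x::real^'n. 2::real) differentiable (at x)"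
    by (rule smooth_differentiable[OF smooth_proj], rule smooth_differentiable[OF smooth_const])
  have d3: "(\<lambda>x::real^'n. 2 * x $ i) differentiable (at x)" by (rule differentiable_mult[OF d2(2,1)])
  have p1: "partial j (\<lambda>x. g' ((norm x)\<^sup>2)) x = g'' ((norm x)\<^sup>2) * (2 * x $ j)"
    by (rule partial_radial[OF 2])
  have p2: "partial j (\<lambda>x::real^'n. 2 * x $ i) x = 2 * (if j = i then 1 else 0)"
    by (simp only: partial_mult[OF d2(2,1)] partial_proj partial_const mult_zero_left add_0_right)
  have "partial j (\<lambda>x. g' ((norm x)\<^sup>2) * (2 * x $ i)) x
      = g' ((norm x)\<^sup>2) * (2 * (if j = i then 1 else 0)) + g'' ((norm x)\<^sup>2) * (2 * x $ j) * (2 * x $ i)"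
    by (simp only: partial_mult[OF d1 d3] p1 p2)
  then show ?thesis unfolding eq by (simp add: mult_ac)
qed

lemma mollifier_partial_commute:
  "partial j (partial i (mollifier n)) = partial i (partial j (mollifier n :: real^'a::finite \<Rightarrow> real))"
proof -
  define c where "c = (\<integral>z. bump (inverse (real (Suc n))) (z::real^'a) \<partial>lebesgue)"
  define g where "g = (\<lambda>k s. (-1)^k * flat k ((inverse (real (Suc n)))\<^sup>2 - s) / c)"
  have "c > 0" unfolding c_def by (rule bump_integral_pos) simp
  have d: "(g k has_real_derivative g (Suc k) s) (at s)" for k s
  proof -
    have "((\<lambda>s. (inverse (real (Suc n)))\<^sup>2 - s) has_real_derivative -1) (at s)"
      by (auto intro!: derivative_eq_intros)
    from DERIV_cdivide[OF DERIV_cmult[OF flat_deriv_chain[OF this, of k], of "(-1)^k"], of c]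
    show ?thesis by (simp add: g_def)
  qed
  have eq: "mollifier n = (\<lambda>z::real^'a. g 0 ((norm z)\<^sup>2))"
    by (rule ext) (simp add: mollifier_def bump_def g_def c_def)
  have "partial j (partial i (mollifier n)) x = partial i (partial j (mollifier n)) x" for x :: "real^'a"
    unfolding eq partial_partial_radial[OF d d] by (cases "i = j") (simp_all add: mult_ac)
  then show ?thesis by (rule ext)
qed

section \<open>Continuity of translations and convergence of mollifications\<close>

lemma lborel_integral_shift:
  fixes f :: "'a::euclidean_space \<Rightarrow> real"
  shows "(\<integral>x. f (x - z) \<partial>lborel) = (\<integral>x. f x \<partial>lborel)"
    and "integrable lborel (\<lambda>x. f (x - z)) \<longleftrightarrow> integrable lborel f"
proof -
  have "has_bochner_integral lborel (\<lambda>x. f (x - z)) I \<longleftrightarrow> has_bochner_integral lborel f I" for I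
  proof -
    have dir: "has_bochner_integral lborel (\<lambda>x. g (- z + x)) I"
      if "has_bochner_integral lborel g I" for g :: "'a \<Rightarrow> real" and z
    proof -
      have "has_bochner_integral (distr lborel borel ((+) (- z))) g I"
        using that by (simp add: lborel_distr_plus)
      moreover have "g \<in> borel_measurable borel"
        using borel_measurable_has_bochner_integral[OF that] by simp
      ultimately show ?thesis
        by (simp add: has_bochner_integral_iff integrable_distr_eq integral_distr)
    qed
    show ?thesis using dir[of f z] dir[of "\<lambda>x. f (x - z)" "- z"] by (auto simp: algebra_simps)
  qed
  then have "has_bochner_integral lborel (\<lambda>x. f (x - z)) = has_bochner_integral lborel f" by (rule ext)
  then show "(\<integral>x. f (x - z) \<partial>lborel) = (\<integral>x. f x \<partial>lborel)"
    and "integrable lborel (\<lambda>x. f (x - z)) \<longleftrightarrow> integrable lborel f"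
    by (simp_all add: lebesgue_integral_def integrable.simps)
qed

text \<open>Translation is continuous in the mean at a function that is approximated in the mean by
  functions with that property.\<close>

lemma shift_continuous_approx:
  fixes f :: "'a::euclidean_space \<Rightarrow> real"
  assumes f: "integrable lborel f"
    and approx: "\<And>e. e > 0 \<Longrightarrow> \<exists>g. integrable lborel g \<and> (\<integral>x. \<bar>f x - g x\<bar> \<partial>lborel) \<le> e \<and>
      (\<lambda>n. \<integral>x. \<bar>g (x - z n) - g x\<bar> \<partial>lborel) \<longlonglongrightarrow> 0"
  shows "(\<lambda>n. \<integral>x. \<bar>f (x - z n) - f x\<bar> \<partial>lborel) \<longlonglongrightarrow> 0"
proof (rule tendstoI)
  fix e :: real assume "e > 0"
  then obtain g where g: "integrable lborel g" "(\<integral>x. \<bar>f x - g x\<bar> \<partial>lborel) \<le> e / 3"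
    "(\<lambda>n. \<integral>x. \<bar>g (x - z n) - g x\<bar> \<partial>lborel) \<longlonglongrightarrow> 0"
    using approx[of "e / 3"] by auto
  have "\<forall>\<^sub>F n in sequentially. (\<integral>x. \<bar>g (x - z n) - g x\<bar> \<partial>lborel) < e / 3"
    using order_tendstoD(2)[OF g(3), of "e / 3"] \<open>e > 0\<close> by simp
  then show "\<forall>\<^sub>F n in sequentially. dist (\<integral>x. \<bar>f (x - z n) - f x\<bar> \<partial>lborel) 0 < e"
  proof eventually_elim
    case (elim n)
    have i: "integrable lborel (\<lambda>x. f (x - z n))" "integrable lborel (\<lambda>x. g (x - z n))"
      using f g(1) by (simp_all add: lborel_integral_shift)
    have "(\<integral>x. \<bar>f (x - z n) - f x\<bar> \<partial>lborel)
      \<le> (\<integral>x. \<bar>f (x - z n) - g (x - z n)\<bar> + \<bar>g (x - z n) - g x\<bar> + \<bar>f x - g x\<bar> \<partial>lborel)"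
      using f g(1) i by (intro integral_mono) auto
    also have "\<dots> = (\<integral>x. \<bar>f (x - z n) - g (x - z n)\<bar> \<partial>lborel) + (\<integral>x. \<bar>g (x - z n) - g x\<bar> \<partial>lborel)
        + (\<integral>x. \<bar>f x - g x\<bar> \<partial>lborel)"
      using f g(1) i by simp
    also have "(\<integral>x. \<bar>f (x - z n) - g (x - z n)\<bar> \<partial>lborel) = (\<integral>x. \<bar>f x - g x\<bar> \<partial>lborel)"
      by (rule lborel_integral_shift(1)[of "\<lambda>x. \<bar>f x - g x\<bar>"])
    finally have "(\<integral>x. \<bar>f (x - z n) - f x\<bar> \<partial>lborel) < e" using elim g(2) by linarith
    then show ?case by simp
  qed
qed

text \<open>For an open set, only the loss \<open>max 0 (1\<^sub>U(x) - 1\<^sub>U(x - z))\<close> has to be estimated, and it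
  tends to zero pointwise; the gain has the same integral, because translations preserve the
  measure.\<close>

lemma shift_continuous_open:
  fixes U :: "'a::euclidean_space set"
  assumes U: "open U" "emeasure lborel U < \<infinity>" and z: "z \<longlonglongrightarrow> 0"
  shows "(\<lambda>n. \<integral>x. \<bar>indicator U (x - z n) - indicator U x\<bar> \<partial>lborel) \<longlonglongrightarrow> (0::real)"
proof -
  let ?i = "indicator U :: 'a \<Rightarrow> real"
  have i: "integrable lborel ?i" using U by auto
  then have ish: "integrable lborel (\<lambda>x. ?i (x - z n))" for n by (subst lborel_integral_shift(2))
  have m[measurable]: "U \<in> sets borel" using U by auto
  have "(\<lambda>n. \<integral>x. max 0 (?i x - ?i (x - z n)) \<partial>lborel) \<longlonglongrightarrow> (\<integral>x. 0 \<partial>(lborel :: 'a measure))"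
  proof (rule integral_dominated_convergence[where w="?i"])
    show "AE x in lborel. (\<lambda>n. max 0 (?i x - ?i (x - z n))) \<longlonglongrightarrow> 0"
    proof (rule AE_I2)
      fix x
      show "(\<lambda>n. max 0 (?i x - ?i (x - z n))) \<longlonglongrightarrow> 0"
      proof (cases "x \<in> U")
        case True
        have "(\<lambda>n. x - z n) \<longlonglongrightarrow> x - 0" by (intro tendsto_intros z)
        then have "\<forall>\<^sub>F n in sequentially. x - z n \<in> U" using U(1) True by (simp add: topological_tendstoD)
        then have "\<forall>\<^sub>F n in sequentially. max 0 (?i x - ?i (x - z n)) = 0" by eventually_elim (simp add: True)
        then show ?thesis by (rule tendsto_eventually)
      next
        case False
        then have "(\<lambda>n. max 0 (?i x - ?i (x - z n))) = (\<lambda>n. 0)" by (auto simp: indicator_def)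
        then show ?thesis by simp
      qed
    qed
  qed (use i in \<open>auto simp: indicator_def max_def\<close>)
  then have lim: "(\<lambda>n. 2 * (\<integral>x. max 0 (?i x - ?i (x - z n)) \<partial>lborel)) \<longlonglongrightarrow> 0"
    using tendsto_mult_left[of _ 0 sequentially 2] by simp
  have "(\<integral>x. \<bar>?i (x - z n) - ?i x\<bar> \<partial>lborel) = 2 * (\<integral>x. max 0 (?i x - ?i (x - z n)) \<partial>lborel)" for n
  proof -
    have "\<bar>?i (x - z n) - ?i x\<bar> = 2 * max 0 (?i x - ?i (x - z n)) + (?i (x - z n) - ?i x)" for x
      by (simp add: max_def)
    then have "(\<integral>x. \<bar>?i (x - z n) - ?i x\<bar> \<partial>lborel)
      = (\<integral>x. 2 * max 0 (?i x - ?i (x - z n)) + (?i (x - z n) - ?i x) \<partial>lborel)" by simp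
    also have "\<dots> = 2 * (\<integral>x. max 0 (?i x - ?i (x - z n)) \<partial>lborel) + ((\<integral>x. ?i (x - z n) \<partial>lborel) - (\<integral>x. ?i x \<partial>lborel))"
      using i ish[of n] by (subst Bochner_Integration.integral_add) (auto intro: integrable_max)
    finally show ?thesis by (simp only: lborel_integral_shift(1) diff_self add_0_right)
  qed
  with lim show ?thesis by simp
qed

lemma shift_continuous_L1:
  fixes f :: "'a::euclidean_space \<Rightarrow> real"
  assumes "integrable lborel f" and z: "z \<longlonglongrightarrow> 0"
  shows "(\<lambda>n. \<integral>x. \<bar>f (x - z n) - f x\<bar> \<partial>lborel) \<longlonglongrightarrow> 0"
  using assms(1)
proof (induction rule: integrable_induct)
  case (base A c)
  have Ai: "integrable lborel (indicator A :: 'a \<Rightarrow> real)" using base by auto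
  have A: "(\<lambda>n. \<integral>x. \<bar>indicator A (x - z n) - indicator A x\<bar> \<partial>lborel) \<longlonglongrightarrow> (0::real)"
  proof (rule shift_continuous_approx[OF Ai])
    fix e :: real assume "e > 0"
    moreover have "A \<in> sets borel" using base by simp
    ultimately obtain U where U: "open U" "A \<subseteq> U" "emeasure lborel (U - A) < ennreal e"
      using outer_regular_lborel by metis
    have Um[measurable]: "U \<in> sets borel" "A \<in> sets borel" using U base by auto
    have "emeasure lborel U = emeasure lborel (A \<union> (U - A))" using U(2) by (simp add: Un_absorb1)
    also have "\<dots> = emeasure lborel A + emeasure lborel (U - A)" by (subst plus_emeasure) auto
    also have "\<dots> < \<infinity>"
      using base(2) order.strict_trans[OF U(3) ennreal_less_top] by simp
    finally have fin: "emeasure lborel U < \<infinity>" .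
    have "(\<integral>x. \<bar>indicator A x - indicator U x\<bar> \<partial>lborel) = (\<integral>x. indicator (U - A) x \<partial>lborel :: real)"
      by (rule Bochner_Integration.integral_cong) (use U(2) in \<open>auto simp: indicator_def\<close>)
    also have "\<dots> = measure lborel (U - A)" by simp
    also have "\<dots> \<le> e" using U(3) \<open>e > 0\<close> by (simp add: measure_def enn2real_leI order_less_imp_le)
    finally show "\<exists>g. integrable lborel g \<and> (\<integral>x. \<bar>indicator A x - g x\<bar> \<partial>lborel) \<le> e \<and>
      (\<lambda>n. \<integral>x. \<bar>g (x - z n) - g x\<bar> \<partial>lborel) \<longlonglongrightarrow> 0"
      using shift_continuous_open[OF U(1) fin z] fin by (intro exI[of _ "indicator U"]) auto
  qed
  have "(\<integral>x. \<bar>indicator A (x - z n) *\<^sub>R c - indicator A x *\<^sub>R c\<bar> \<partial>lborel)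
     = (\<integral>x. \<bar>indicator A (x - z n) - indicator A x\<bar> \<partial>lborel) * \<bar>c\<bar>" for n
  proof -
    have "\<bar>indicator A (x - z n) *\<^sub>R c - indicator A x *\<^sub>R c\<bar>
      = \<bar>indicator A (x - z n) - indicator A x\<bar> * \<bar>c\<bar>" for x
      by (simp add: left_diff_distrib[symmetric] abs_mult)
    then show ?thesis by (simp only: integral_mult_left_zero)
  qed
  then show ?case using tendsto_mult_left_zero[OF A] by (simp only:)
next
  case (add f g)
  have "(\<integral>x. \<bar>f (x - z n) + g (x - z n) - (f x + g x)\<bar> \<partial>lborel)
    \<le> (\<integral>x. \<bar>f (x - z n) - f x\<bar> \<partial>lborel) + (\<integral>x. \<bar>g (x - z n) - g x\<bar> \<partial>lborel)" for n
  proof -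
    have i: "integrable lborel (\<lambda>x. f (x - z n))" "integrable lborel (\<lambda>x. g (x - z n))"
      using add.hyps by (simp_all add: lborel_integral_shift)
    have "(\<integral>x. \<bar>f (x - z n) + g (x - z n) - (f x + g x)\<bar> \<partial>lborel)
      \<le> (\<integral>x. \<bar>f (x - z n) - f x\<bar> + \<bar>g (x - z n) - g x\<bar> \<partial>lborel)"
      using i add.hyps by (intro integral_mono) auto
    then show ?thesis using i add.hyps by simp
  qed
  then show ?case
    by (intro tendsto_sandwich[OF _ _ tendsto_const tendsto_add_zero[OF add.IH]]) auto
next
  case (lim f s)
  have m: "f \<in> borel_measurable lborel" using lim.hyps by auto
  have s: "(\<lambda>i. \<integral>x. \<bar>f x - s i x\<bar> \<partial>lborel) \<longlonglongrightarrow> (\<integral>x. 0 \<partial>(lborel :: 'a measure))"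
  proof (rule integral_dominated_convergence[where w="\<lambda>x. 3 * \<bar>f x\<bar>"])
    show "AE x in lborel. (\<lambda>i. \<bar>f x - s i x\<bar>) \<longlonglongrightarrow> 0"
    proof (rule AE_I2)
      fix x :: 'a
      have "(\<lambda>i. \<bar>f x - s i x\<bar>) \<longlonglongrightarrow> \<bar>f x - f x\<bar>" by (intro tendsto_intros lim.hyps) simp
      then show "(\<lambda>i. \<bar>f x - s i x\<bar>) \<longlonglongrightarrow> 0" by simp
    qed
    show "AE x in lborel. norm \<bar>f x - s i x\<bar> \<le> 3 * \<bar>f x\<bar>" for i
    proof (rule AE_I2)
      fix x :: 'a
      have "norm (s i x) \<le> 2 * norm (f x)" by (rule lim.hyps(3)) simp
      then show "norm \<bar>f x - s i x\<bar> \<le> 3 * \<bar>f x\<bar>" by (simp add: abs_le_iff) linarith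
    qed
  qed (use lim.hyps in auto)
  show ?case
  proof (rule shift_continuous_approx[OF lim.hyps(4)])
    fix e :: real assume "e > 0"
    then have "\<forall>\<^sub>F i in sequentially. (\<integral>x. \<bar>f x - s i x\<bar> \<partial>lborel) < e"
      using order_tendstoD(2)[OF s, of e] by simp
    then obtain i where "(\<integral>x. \<bar>f x - s i x\<bar> \<partial>lborel) < e" by (auto simp: eventually_sequentially)
    then show "\<exists>g. integrable lborel g \<and> (\<integral>x. \<bar>f x - g x\<bar> \<partial>lborel) \<le> e \<and>
      (\<lambda>n. \<integral>x. \<bar>g (x - z n) - g x\<bar> \<partial>lborel) \<longlonglongrightarrow> 0"
      using lim.hyps lim.IH by (intro exI[of _ "s i"]) auto
  qed
qed

text \<open>For nonnegative functions, \<open>(a - b)\<^sup>2 \<le> |a\<^sup>2 - b\<^sup>2|\<close> reduces the square mean to the mean.\<close>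

lemma shift_continuous_L2_nonneg:
  fixes f :: "'a::euclidean_space \<Rightarrow> real"
  assumes [measurable]: "f \<in> borel_measurable borel" and f: "integrable lborel (\<lambda>x. (f x)\<^sup>2)"
    and pos: "\<And>x. f x \<ge> 0" and z: "z \<longlonglongrightarrow> 0"
  shows "(\<lambda>n. \<integral>x. (f (x - z n) - f x)\<^sup>2 \<partial>lborel) \<longlonglongrightarrow> 0"
proof (rule tendsto_sandwich[OF _ _ tendsto_const shift_continuous_L1[OF f z]])
  have le: "(a - b)\<^sup>2 \<le> \<bar>a\<^sup>2 - b\<^sup>2\<bar>" if "a \<ge> 0" "b \<ge> 0" for a b :: real
  proof -
    have "\<bar>a - b\<bar> * \<bar>a - b\<bar> \<le> \<bar>a - b\<bar> * \<bar>a + b\<bar>" using that by (intro mult_left_mono) auto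
    also have "\<bar>a - b\<bar> * \<bar>a + b\<bar> = \<bar>a\<^sup>2 - b\<^sup>2\<bar>"
      unfolding abs_mult[symmetric] by (simp add: power2_eq_square algebra_simps)
    also have "\<bar>a - b\<bar> * \<bar>a - b\<bar> = (a - b)\<^sup>2" unfolding abs_mult[symmetric] by (simp add: power2_eq_square)
    finally show ?thesis .
  qed
  have "(\<integral>x. (f (x - z n) - f x)\<^sup>2 \<partial>lborel) \<le> (\<integral>x. \<bar>(f (x - z n))\<^sup>2 - (f x)\<^sup>2\<bar> \<partial>lborel)" for n
  proof (rule integral_mono')
    have "integrable lborel (\<lambda>x. (f (x - z n))\<^sup>2)"
      using lborel_integral_shift(2)[of "\<lambda>x. (f x)\<^sup>2"] f by simp
    then show "integrable lborel (\<lambda>x. \<bar>(f (x - z n))\<^sup>2 - (f x)\<^sup>2\<bar>)" using f by auto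
  next
    fix x show "(f (x - z n) - f x)\<^sup>2 \<le> \<bar>(f (x - z n))\<^sup>2 - (f x)\<^sup>2\<bar>" by (intro le pos)
  qed auto
  then show "\<forall>\<^sub>F n in sequentially. (\<integral>x. (f (x - z n) - f x)\<^sup>2 \<partial>lborel) \<le> (\<integral>x. \<bar>(f (x - z n))\<^sup>2 - (f x)\<^sup>2\<bar> \<partial>lborel)"
    by simp
qed auto

lemma integrable_sq_shift:
  fixes f :: "'a::euclidean_space \<Rightarrow> real"
  assumes [measurable]: "f \<in> borel_measurable borel" and f: "integrable lborel (\<lambda>x. (f x)\<^sup>2)"
  shows "integrable lborel (\<lambda>x. (f (x - z))\<^sup>2)" "integrable lborel (\<lambda>x. (f (x - z) - f x)\<^sup>2)"
proof -
  show s: "integrable lborel (\<lambda>x. (f (x - z))\<^sup>2)"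
    using lborel_integral_shift(2)[of "\<lambda>x. (f x)\<^sup>2"] f by simp
  have le: "(a - b)\<^sup>2 \<le> 2 * a\<^sup>2 + 2 * b\<^sup>2" for a b :: real
    using zero_le_power2[of "a + b"] by (simp add: power2_sum power2_diff)
  show "integrable lborel (\<lambda>x. (f (x - z) - f x)\<^sup>2)"
  proof (rule Bochner_Integration.integrable_bound[of _ "\<lambda>x. 2 * (f (x - z))\<^sup>2 + 2 * (f x)\<^sup>2"])
    have "norm ((f (x - z) - f x)\<^sup>2) \<le> norm (2 * (f (x - z))\<^sup>2 + 2 * (f x)\<^sup>2)" for x
      using le[of "f (x - z)" "f x"] by (simp only: real_norm_def abs_power2)
    then show "AE x in lborel. norm ((f (x - z) - f x)\<^sup>2) \<le> norm (2 * (f (x - z))\<^sup>2 + 2 * (f x)\<^sup>2)" by simp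
    show "integrable lborel (\<lambda>x. 2 * (f (x - z))\<^sup>2 + 2 * (f x)\<^sup>2)" using s f by simp
  qed simp
qed

lemma shift_continuous_L2:
  fixes f :: "'a::euclidean_space \<Rightarrow> real"
  assumes m[measurable]: "f \<in> borel_measurable borel" and f: "integrable lborel (\<lambda>x. (f x)\<^sup>2)"
    and z: "z \<longlonglongrightarrow> 0"
  shows "(\<lambda>n. \<integral>x. (f (x - z n) - f x)\<^sup>2 \<partial>lborel) \<longlonglongrightarrow> 0"
proof -
  let ?p = "\<lambda>x. max 0 (f x)" and ?m = "\<lambda>x. max 0 (- f x)"
  have i: "integrable lborel (\<lambda>x. (?p x)\<^sup>2)" "integrable lborel (\<lambda>x. (?m x)\<^sup>2)"
  proof -
    have "norm ((?p x)\<^sup>2) \<le> norm ((f x)\<^sup>2)" "norm ((?m x)\<^sup>2) \<le> norm ((f x)\<^sup>2)" for x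
      by (auto simp: max_def)
    then show "integrable lborel (\<lambda>x. (?p x)\<^sup>2)" "integrable lborel (\<lambda>x. (?m x)\<^sup>2)"
      by (auto intro!: Bochner_Integration.integrable_bound[OF f])
  qed
  have mm: "?p \<in> borel_measurable borel" "?m \<in> borel_measurable borel"
    by (intro borel_measurable_max borel_measurable_const borel_measurable_uminus m)+
  have lim: "(\<lambda>n. 2 * (\<integral>x. (?p (x - z n) - ?p x)\<^sup>2 \<partial>lborel) + 2 * (\<integral>x. (?m (x - z n) - ?m x)\<^sup>2 \<partial>lborel)) \<longlonglongrightarrow> 2 * 0 + 2 * 0"
    by (intro tendsto_intros shift_continuous_L2_nonneg mm i z) auto
  have le: "(a - b)\<^sup>2 \<le> 2 * a\<^sup>2 + 2 * b\<^sup>2" for a b :: real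
    using zero_le_power2[of "a + b"] by (simp add: power2_sum power2_diff)
  have "(\<integral>x. (f (x - z n) - f x)\<^sup>2 \<partial>lborel)
    \<le> 2 * (\<integral>x. (?p (x - z n) - ?p x)\<^sup>2 \<partial>lborel) + 2 * (\<integral>x. (?m (x - z n) - ?m x)\<^sup>2 \<partial>lborel)" for n
  proof -
    note j = integrable_sq_shift(2)[OF mm(1) i(1), of "z n"] integrable_sq_shift(2)[OF mm(2) i(2), of "z n"]
    have "(\<integral>x. (f (x - z n) - f x)\<^sup>2 \<partial>lborel)
      \<le> (\<integral>x. 2 * (?p (x - z n) - ?p x)\<^sup>2 + 2 * (?m (x - z n) - ?m x)\<^sup>2 \<partial>lborel)"
    proof (rule integral_mono)
      fix x
      have "f (x - z n) - f x = (?p (x - z n) - ?p x) - (?m (x - z n) - ?m x)" by (simp add: max_def)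
      then show "(f (x - z n) - f x)\<^sup>2 \<le> 2 * (?p (x - z n) - ?p x)\<^sup>2 + 2 * (?m (x - z n) - ?m x)\<^sup>2"
        by (simp only: le)
    qed (use integrable_sq_shift(2)[OF m f] j in auto)
    then show ?thesis using j by simp
  qed
  then show ?thesis using lim unfolding mult_zero_right add_0_right
    by (intro tendsto_sandwich[OF _ _ tendsto_const lim[unfolded mult_zero_right add_0_right]]) simp_all
qed

text \<open>The correlation of two square integrable functions is continuous at the origin.\<close>

lemma correlation_continuous:
  fixes F G :: "'a::euclidean_space \<Rightarrow> real"
  assumes m[measurable]: "F \<in> borel_measurable borel" "G \<in> borel_measurable borel"
    and F: "integrable lborel (\<lambda>x. (F x)\<^sup>2)" and G: "integrable lborel (\<lambda>x. (G x)\<^sup>2)"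
    and z: "z \<longlonglongrightarrow> 0"
  shows "(\<lambda>n. \<integral>x. F x * G (x - z n) \<partial>lborel) \<longlonglongrightarrow> (\<integral>x. F x * G x \<partial>lborel)"
    and "integrable lborel (\<lambda>x. F x * G (x - y))"
    and "(\<integral>x. \<bar>F x * G (x - y)\<bar> \<partial>lborel) \<le> (\<integral>x. (F x)\<^sup>2 \<partial>lborel) + (\<integral>x. (G x)\<^sup>2 \<partial>lborel)"
proof -
  have le: "\<bar>a * b\<bar> \<le> a\<^sup>2 + b\<^sup>2" for a b :: real
  proof -
    have "2 * (\<bar>a\<bar> * \<bar>b\<bar>) \<le> a\<^sup>2 + b\<^sup>2"
      using zero_le_power2[of "\<bar>a\<bar> - \<bar>b\<bar>"] by (simp add: power2_diff mult.assoc)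
    moreover have "0 \<le> \<bar>a\<bar> * \<bar>b\<bar>" by simp
    ultimately show ?thesis unfolding abs_mult by linarith
  qed
  have i: "integrable lborel (\<lambda>x. F x * G (x - y))" for y
    by (rule Bochner_Integration.integrable_bound[of _ "\<lambda>x. (F x)\<^sup>2 + (G (x - y))\<^sup>2"])
       (use F integrable_sq_shift(1)[OF m(2) G] le in auto)
  then show "integrable lborel (\<lambda>x. F x * G (x - y))" .
  have "(\<integral>x. \<bar>F x * G (x - y)\<bar> \<partial>lborel) \<le> (\<integral>x. (F x)\<^sup>2 + (G (x - y))\<^sup>2 \<partial>lborel)"
    by (rule integral_mono) (use i F integrable_sq_shift(1)[OF m(2) G] le in auto)
  also have "\<dots> = (\<integral>x. (F x)\<^sup>2 \<partial>lborel) + (\<integral>x. (G x)\<^sup>2 \<partial>lborel)"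
    using F integrable_sq_shift(1)[OF m(2) G] lborel_integral_shift(1)[of "\<lambda>x. (G x)\<^sup>2" y] by simp
  finally show "(\<integral>x. \<bar>F x * G (x - y)\<bar> \<partial>lborel) \<le> (\<integral>x. (F x)\<^sup>2 \<partial>lborel) + (\<integral>x. (G x)\<^sup>2 \<partial>lborel)" .
  let ?D = "\<lambda>n. \<integral>x. (G (x - z n) - G x)\<^sup>2 \<partial>lborel"
  have est: "\<bar>(\<integral>x. F x * G (x - z n) \<partial>lborel) - (\<integral>x. F x * G x \<partial>lborel)\<bar>
    \<le> d * (\<integral>x. (F x)\<^sup>2 \<partial>lborel) + inverse d * ?D n" if d: "d > 0" for d n
  proof -
    have le': "\<bar>a * b\<bar> \<le> d * a\<^sup>2 + inverse d * b\<^sup>2" for a b :: real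
    proof -
      have "\<bar>(sqrt d * a) * (b / sqrt d)\<bar> \<le> (sqrt d * a)\<^sup>2 + (b / sqrt d)\<^sup>2" by (rule le)
      moreover have "(sqrt d * a) * (b / sqrt d) = a * b" using d by simp
      moreover have "(sqrt d * a)\<^sup>2 + (b / sqrt d)\<^sup>2 = d * a\<^sup>2 + inverse d * b\<^sup>2"
        using d by (simp add: power_mult_distrib power_divide divide_inverse mult.commute power_inverse)
      ultimately show ?thesis by simp
    qed
    have i0: "integrable lborel (\<lambda>x. F x * G x)" using i[of 0] by simp
    have "(\<integral>x. F x * G (x - z n) \<partial>lborel) - (\<integral>x. F x * G x \<partial>lborel)
      = (\<integral>x. F x * (G (x - z n) - G x) \<partial>lborel)"
      using i[of "z n"] i0 by (simp add: right_diff_distrib)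
    also have "\<bar>\<dots>\<bar> \<le> (\<integral>x. d * (F x)\<^sup>2 + inverse d * (G (x - z n) - G x)\<^sup>2 \<partial>lborel)"
    proof (rule order.trans[OF integral_abs_bound], rule integral_mono[OF _ _ le'])
      show "integrable lborel (\<lambda>x. \<bar>F x * (G (x - z n) - G x)\<bar>)"
        using i[of "z n"] i0 by (auto simp: right_diff_distrib)
    qed (use F integrable_sq_shift(2)[OF m(2) G] in auto)
    also have "\<dots> = d * (\<integral>x. (F x)\<^sup>2 \<partial>lborel) + inverse d * ?D n"
      using F integrable_sq_shift(2)[OF m(2) G] by simp
    finally show ?thesis .
  qed
  show "(\<lambda>n. \<integral>x. F x * G (x - z n) \<partial>lborel) \<longlonglongrightarrow> (\<integral>x. F x * G x \<partial>lborel)"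
  proof (rule tendstoI)
    fix e :: real assume e: "e > 0"
    define I where "I = (\<integral>x. (F x)\<^sup>2 \<partial>lborel)"
    have I: "I \<ge> 0" unfolding I_def by simp
    define d where "d = e / (2 * (I + 1))"
    have d: "d > 0" "d * I \<le> e / 2" using e I by (auto simp: d_def field_simps)
    have "(\<lambda>n. inverse d * ?D n) \<longlonglongrightarrow> inverse d * 0"
      by (intro tendsto_intros shift_continuous_L2 m G z)
    then have "\<forall>\<^sub>F n in sequentially. inverse d * ?D n < e / 2"
      using order_tendstoD(2)[of _ _ sequentially "e / 2"] e by simp
    then show "\<forall>\<^sub>F n in sequentially. dist (\<integral>x. F x * G (x - z n) \<partial>lborel) (\<integral>x. F x * G x \<partial>lborel) < e"
    proof eventually_elim
      case (elim n)
      then show ?case using est[OF d(1), of n] d(2) by (simp add: dist_real_def I_def)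
    qed
  qed
qed

lemma lborel_integral_reflect:
  fixes f :: "'a::euclidean_space \<Rightarrow> real"
  assumes [measurable]: "f \<in> borel_measurable borel"
  shows "(\<integral>y. f (x - y) \<partial>lborel) = (\<integral>y. f y \<partial>lborel)"
proof -
  have eq: "(lborel :: 'a measure) = distr lborel borel (\<lambda>y. x - y)"
    using lborel_affine[of "-1" x] by (simp add: density_1)
  have "(\<integral>y. f y \<partial>lborel) = (\<integral>y. f y \<partial>distr lborel borel (\<lambda>y. x - y))"
    using eq by simp
  also have "\<dots> = (\<integral>y. f (x - y) \<partial>lborel)"
    by (rule integral_distr) simp_all
  finally show ?thesis by simp
qed

lemma mollifier_borel: "mollifier n \<in> borel_measurable borel"
  using smooth_continuous test_fun_mollifier
  by (auto intro: borel_measurable_continuous_onI simp: test_fun_def)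

lemma mollifier_integrable: "integrable lborel (mollifier n :: real^'a::finite \<Rightarrow> real)"
proof (rule ccontr)
  assume "\<not> integrable lborel (mollifier n :: real^'a \<Rightarrow> real)"
  then have "(\<integral>z. mollifier n (z::real^'a) \<partial>lborel) = 0" by (rule not_integrable_integral_eq)
  then show False using mollifier_integral[where 'n='a, of n]
    by (simp add: integral_completion mollifier_borel)
qed

text \<open>Mollifications of a square integrable function converge weakly: by Fubini's theorem the
  integral is the mean of the correlation of \<open>F\<close> and \<open>G\<close> over small translations.\<close>

lemma conv_tendsto:
  fixes F G :: "real^'n::finite \<Rightarrow> real"
  assumes F: "F \<in> borel_measurable lebesgue" "integrable lebesgue (\<lambda>x. (F x)\<^sup>2)"
    and G: "G \<in> borel_measurable lebesgue" "integrable lebesgue (\<lambda>x. (G x)\<^sup>2)"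
  shows "(\<lambda>n. \<integral>x. F x * conv G (mollifier n) x \<partial>lebesgue) \<longlonglongrightarrow> (\<integral>x. F x * G x \<partial>lebesgue)"
proof -
  obtain F' where F'[measurable]: "F' \<in> borel_measurable borel" and FF: "AE x in lborel. F x = F' x"
    using completion_ex_borel_measurable_real[OF F(1)] by auto
  obtain G' where G'[measurable]: "G' \<in> borel_measurable borel" and GG: "AE x in lborel. G x = G' x"
    using completion_ex_borel_measurable_real[OF G(1)] by auto
  have FFl: "AE x in lebesgue. F x = F' x" and GGl: "AE x in lebesgue. G x = G' x"
    using FF GG by (simp_all add: AE_completion)
  have F'l: "F' \<in> borel_measurable lebesgue" and G'l: "G' \<in> borel_measurable lebesgue"
    using F' G' by (simp_all add: measurable_completion)
  have "integrable lebesgue (\<lambda>x. (F' x)\<^sup>2)"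
    by (rule integrable_cong_AE_imp[OF F(2)]) (use F'l FFl in auto)
  then have F2: "integrable lborel (\<lambda>x. (F' x)\<^sup>2)"
    by (subst (asm) integrable_completion) auto
  have "integrable lebesgue (\<lambda>x. (G' x)\<^sup>2)"
    by (rule integrable_cong_AE_imp[OF G(2)]) (use G'l GGl in auto)
  then have G2: "integrable lborel (\<lambda>x. (G' x)\<^sup>2)"
    by (subst (asm) integrable_completion) auto
  define A where "A z = (\<integral>x. F' x * G' (x - z) \<partial>lborel)" for z
  note corr = correlation_continuous(1)[OF F' G' F2 G2]
    correlation_continuous(2,3)[OF F' G' F2 G2 tendsto_const]
  have "continuous (at 0) A"
    unfolding continuous_at_sequentially A_def comp_def using corr(1) by simp
  then have A_cont: "\<exists>d>0. \<forall>z. norm z < d \<longrightarrow> \<bar>A z - A 0\<bar> < e" if "e > 0" for e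
    using that unfolding continuous_at_eps_delta by (simp add: dist_real_def)
  let ?K = "\<lambda>n. mollifier n :: real^'n \<Rightarrow> real"
  have Km[measurable]: "?K n \<in> borel_measurable borel" for n by (rule mollifier_borel)
  have conv_eq: "conv G (?K n) x = (\<integral>z. G' (x - z) * ?K n z \<partial>lborel)" for n x
  proof -
    have "conv G (?K n) x = (\<integral>y. G' y * ?K n (x - y) \<partial>lebesgue)"
      unfolding conv_def
    proof (rule integral_cong_AE)
      have [measurable]: "(\<lambda>y. ?K n (x - y)) \<in> borel_measurable lebesgue"
        by (intro measurable_completion) simp
      show "(\<lambda>y. G y * ?K n (x - y)) \<in> borel_measurable lebesgue"
        "(\<lambda>y. G' y * ?K n (x - y)) \<in> borel_measurable lebesgue"
        using G(1) G'l by simp_all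
    qed (use GGl in auto)
    also have "\<dots> = (\<integral>y. G' y * ?K n (x - y) \<partial>lborel)" by (rule integral_completion) simp
    also have "\<dots> = (\<integral>y. G' (x - y) * ?K n (x - (x - y)) \<partial>lborel)"
      using lborel_integral_reflect[of "\<lambda>y. G' y * ?K n (x - y)" x] by simp
    finally show ?thesis by simp
  qed
  have main: "(\<integral>x. F x * conv G (?K n) x \<partial>lebesgue) = (\<integral>z. ?K n z * A z \<partial>lborel)
      \<and> integrable lborel (\<lambda>z. ?K n z * A z)" for n
  proof -
    let ?f = "\<lambda>z x. F' x * G' (x - z) * ?K n z"
    have pair: "integrable (lborel \<Otimes>\<^sub>M lborel) (case_prod ?f)"
    proof (rule lborel_pair.Fubini_integrable)
      show "case_prod ?f \<in> borel_measurable (lborel \<Otimes>\<^sub>M lborel)" by measurable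
      show "AE z in lborel. integrable lborel (\<lambda>x. case_prod ?f (z, x))"
        by (rule AE_I2) (simp add: corr(2))
      have eq: "(\<integral>x. norm (case_prod ?f (z, x)) \<partial>lborel) = (\<integral>x. \<bar>F' x * G' (x - z)\<bar> \<partial>lborel) * ?K n z" for z
        by (simp add: abs_mult mollifier_nonneg)
      show "integrable lborel (\<lambda>z. \<integral>x. norm (case_prod ?f (z, x)) \<partial>lborel)"
        unfolding eq
      proof (rule Bochner_Integration.integrable_bound)
        show "integrable lborel (\<lambda>z. ((\<integral>x. (F' x)\<^sup>2 \<partial>lborel) + (\<integral>x. (G' x)\<^sup>2 \<partial>lborel)) * ?K n z)"
          by (intro integrable_mult_right mollifier_integrable)
        show "(\<lambda>z. (\<integral>x. \<bar>F' x * G' (x - z)\<bar> \<partial>lborel) * ?K n z) \<in> borel_measurable lborel" by measurable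
        have "norm ((\<integral>x. \<bar>F' x * G' (x - z)\<bar> \<partial>lborel) * ?K n z)
          \<le> norm (((\<integral>x. (F' x)\<^sup>2 \<partial>lborel) + (\<integral>x. (G' x)\<^sup>2 \<partial>lborel)) * ?K n z)" for z
          unfolding norm_mult
          by (rule mult_right_mono) (use corr(3)[of z] in auto)
        then show "AE z in lborel. norm ((\<integral>x. \<bar>F' x * G' (x - z)\<bar> \<partial>lborel) * ?K n z)
          \<le> norm (((\<integral>x. (F' x)\<^sup>2 \<partial>lborel) + (\<integral>x. (G' x)\<^sup>2 \<partial>lborel)) * ?K n z)" by simp
      qed
    qed
    have "(\<integral>x. F x * conv G (?K n) x \<partial>lebesgue)
        = (\<integral>x. F' x * (\<integral>z. G' (x - z) * ?K n z \<partial>lborel) \<partial>lebesgue)"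
    proof (rule integral_cong_AE)
      have [measurable]: "(\<lambda>x. \<integral>z. G' (x - z) * ?K n z \<partial>lborel) \<in> borel_measurable lebesgue"
        by (intro measurable_completion) measurable
      show "(\<lambda>x. F x * conv G (?K n) x) \<in> borel_measurable lebesgue"
        "(\<lambda>x. F' x * (\<integral>z. G' (x - z) * ?K n z \<partial>lborel)) \<in> borel_measurable lebesgue"
        unfolding conv_eq using F(1) F'l by simp_all
    qed (use FFl in \<open>auto simp: conv_eq\<close>)
    also have "\<dots> = (\<integral>x. F' x * (\<integral>z. G' (x - z) * ?K n z \<partial>lborel) \<partial>lborel)"
      by (rule integral_completion) measurable
    also have "\<dots> = (\<integral>x. (\<integral>z. ?f z x \<partial>lborel) \<partial>lborel)"
      by (simp only: mult.assoc integral_mult_right_zero)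
    also have "\<dots> = (\<integral>z. (\<integral>x. ?f z x \<partial>lborel) \<partial>lborel)"
      by (rule lborel_pair.Fubini_integral[OF pair])
    also have "\<dots> = (\<integral>z. ?K n z * A z \<partial>lborel)"
      by (simp only: integral_mult_left_zero A_def mult.commute[of "?K n _" "integral\<^sup>L _ _"])
    finally show ?thesis
      using lborel_pair.integrable_fst[OF pair] by (simp add: A_def mult.commute)
  qed
  have "(\<lambda>n. \<integral>z. ?K n z * A z \<partial>lborel) \<longlonglongrightarrow> A 0"
  proof (rule tendstoI)
    fix e :: real assume "e > 0"
    then obtain d where d: "d > 0" "\<And>z. norm z < d \<Longrightarrow> \<bar>A z - A 0\<bar> < e / 2"
      using A_cont[of "e / 2"] by auto
    have "\<forall>\<^sub>F n in sequentially. inverse (real (Suc n)) < d"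
      using order_tendstoD(2)[OF LIMSEQ_inverse_real_of_nat d(1)] .
    then show "\<forall>\<^sub>F n in sequentially. dist (\<integral>z. ?K n z * A z \<partial>lborel) (A 0) < e"
    proof eventually_elim
      case (elim n)
      have I1: "(\<integral>z. ?K n z \<partial>lborel) = 1"
        using mollifier_integral[where 'n='n, of n] integral_completion[of "?K n" lborel] Km[of n] by simp
      have i: "integrable lborel (\<lambda>z. ?K n z * A z - ?K n z * A 0)"
        using main[of n] mollifier_integrable by (intro Bochner_Integration.integrable_diff) auto
      have "(\<integral>z. ?K n z * A z \<partial>lborel) - A 0 = (\<integral>z. ?K n z * A z - ?K n z * A 0 \<partial>lborel)"
        using main[of n] mollifier_integrable I1 by (subst Bochner_Integration.integral_diff) auto
      also have "\<bar>\<dots>\<bar> \<le> (\<integral>z. ?K n z * (e / 2) \<partial>lborel)"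
      proof (rule order.trans[OF integral_abs_bound], rule integral_mono)
        fix z :: "real^'n"
        have "\<bar>?K n z * (A z - A 0)\<bar> \<le> ?K n z * (e / 2)"
        proof (cases "norm z < d")
          case True
          have "?K n z * \<bar>A z - A 0\<bar> \<le> ?K n z * (e / 2)"
            using less_imp_le[OF d(2)[OF True]] mollifier_nonneg by (rule mult_left_mono)
          then show ?thesis using mollifier_nonneg[of n z] by (simp only: abs_mult abs_of_nonneg)
        next
          case False
          then show ?thesis using mollifier_eq_0[of n z] elim by simp
        qed
        then show "\<bar>?K n z * A z - ?K n z * A 0\<bar> \<le> ?K n z * (e / 2)" by (simp only: right_diff_distrib)
      qed (use i in \<open>auto intro!: integrable_divide integrable_mult_left mollifier_integrable\<close>)
      also have "\<dots> < e" using I1 \<open>e > 0\<close> by simp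
      finally show ?case by (simp add: dist_real_def)
    qed
  qed
  moreover have "A 0 = (\<integral>x. F x * G x \<partial>lebesgue)"
  proof -
    have "(\<integral>x. F x * G x \<partial>lebesgue) = (\<integral>x. F' x * G' x \<partial>lebesgue)"
    proof (rule integral_cong_AE)
      show "AE x in lebesgue. F x * G x = F' x * G' x" using FFl GGl by eventually_elim simp
    qed (use F G F'l G'l in auto)
    then show ?thesis by (simp add: A_def integral_completion)
  qed
  ultimately show ?thesis using main by simp
qed

section \<open>Weak derivatives of locally square integrable functions\<close>

text \<open>Locally square integrable functions.\<close>

definition L2loc :: "(real^'n::finite \<Rightarrow> real) \<Rightarrow> bool" where
  "L2loc f \<longleftrightarrow> f \<in> borel_measurable lebesgue \<and>
     (\<forall>R. integrable lebesgue (\<lambda>x. indicator (cball 0 R) x * (f x)\<^sup>2))"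

lemma smooth_measurable: "smooth f \<Longrightarrow> f \<in> borel_measurable lebesgue"
  by (intro measurable_completion)
     (auto intro: borel_measurable_continuous_onI smooth_continuous)

lemma L2loc_mult_test:
  assumes f: "L2loc f" and g: "L2loc g" and \<phi>: "test_fun \<phi>"
  shows "integrable lebesgue (\<lambda>x. f x * g x * \<phi> x)"
proof -
  obtain R where R: "\<And>x. norm x \<ge> R \<Longrightarrow> \<phi> x = 0" using test_fun_support[OF \<phi>] by blast
  obtain B where B: "B > 0" "\<And>x. \<bar>\<phi> x\<bar> \<le> B" using test_fun_bounded[OF \<phi>] by blast
  have \<phi>m: "\<phi> \<in> borel_measurable lebesgue" using \<phi> smooth_measurable test_fun_def by blast
  show ?thesis
  proof (rule Bochner_Integration.integrable_bound)
    show "integrable lebesgue (\<lambda>x. B * (indicator (cball 0 R) x * (f x)\<^sup>2) + B * (indicator (cball 0 R) x * (g x)\<^sup>2))"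
      using f g by (simp add: L2loc_def)
    show "(\<lambda>x. f x * g x * \<phi> x) \<in> borel_measurable lebesgue"
      using f g \<phi>m by (auto simp: L2loc_def intro!: borel_measurable_times)
    have "norm (f x * g x * \<phi> x)
      \<le> norm (B * (indicator (cball 0 R) x * (f x)\<^sup>2) + B * (indicator (cball 0 R) x * (g x)\<^sup>2))" for x
    proof (cases "norm x \<le> R")
      case True
      have "2 * (\<bar>f x\<bar> * \<bar>g x\<bar>) \<le> (f x)\<^sup>2 + (g x)\<^sup>2"
        using zero_le_power2[of "\<bar>f x\<bar> - \<bar>g x\<bar>"] by (simp add: power2_diff mult.assoc)
      moreover have "0 \<le> \<bar>f x\<bar> * \<bar>g x\<bar>" by simp
      ultimately have "\<bar>f x * g x\<bar> \<le> (f x)\<^sup>2 + (g x)\<^sup>2" unfolding abs_mult by linarith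
      then have "\<bar>f x * g x\<bar> * \<bar>\<phi> x\<bar> \<le> ((f x)\<^sup>2 + (g x)\<^sup>2) * B"
        using B by (intro mult_mono) auto
      also have "((f x)\<^sup>2 + (g x)\<^sup>2) * B = B * (indicator (cball 0 R) x * (f x)\<^sup>2) + B * (indicator (cball 0 R) x * (g x)\<^sup>2)"
        using True by (simp add: algebra_simps)
      finally show ?thesis unfolding abs_mult[symmetric] real_norm_def by linarith
    qed (use R B in auto)
    then show "AE x in lebesgue. norm (f x * g x * \<phi> x)
      \<le> norm (B * (indicator (cball 0 R) x * (f x)\<^sup>2) + B * (indicator (cball 0 R) x * (g x)\<^sup>2))" by simp
  qed
qed

lemma L2loc_test:
  assumes f: "L2loc f" and \<phi>: "test_fun \<phi>"
  obtains R where "(\<lambda>x. f x * \<phi> x) \<in> borel_measurable lebesgue"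
    "integrable lebesgue (\<lambda>x. (f x * \<phi> x)\<^sup>2)" "\<And>x. norm x > R \<Longrightarrow> f x * \<phi> x = 0"
proof -
  have \<phi>m: "\<phi> \<in> borel_measurable lebesgue" using \<phi> smooth_measurable test_fun_def by blast
  obtain R where R: "\<And>x. norm x \<ge> R \<Longrightarrow> \<phi> x = 0" using test_fun_support[OF \<phi>] by blast
  have "test_fun (\<lambda>x. \<phi> x * \<phi> x)" using \<phi> test_fun_mult test_fun_def by blast
  from L2loc_mult_test[OF f f this] have "integrable lebesgue (\<lambda>x. (f x * \<phi> x)\<^sup>2)"
    by (simp add: power2_eq_square mult_ac)
  moreover have "(\<lambda>x. f x * \<phi> x) \<in> borel_measurable lebesgue"
    using f \<phi>m by (auto simp: L2loc_def intro!: borel_measurable_times)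
  ultimately show ?thesis using that[of R] R by simp
qed

text \<open>If \<open>F\<close> has bounded support, only the values of \<open>G\<close> near that support matter.\<close>

lemma conv_tendsto_loc:
  fixes F G :: "real^'n::finite \<Rightarrow> real"
  assumes F: "F \<in> borel_measurable lebesgue" "integrable lebesgue (\<lambda>x. (F x)\<^sup>2)"
    and R: "\<And>x. norm x > R \<Longrightarrow> F x = 0" and G: "L2loc G"
  shows "(\<lambda>n. \<integral>x. F x * conv G (mollifier n) x \<partial>lebesgue) \<longlonglongrightarrow> (\<integral>x. F x * G x \<partial>lebesgue)"
proof -
  let ?G = "\<lambda>x. indicator (cball 0 (R + 1)) x * G x"
  have "F x * conv G (mollifier n) x = F x * conv ?G (mollifier n) x" for x n
  proof (cases "norm x > R")
    case False
    have "G y * mollifier n (x - y) = ?G y * mollifier n (x - y)" for y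
    proof (cases "norm y \<le> R + 1")
      case False
      then have "norm (x - y) \<ge> 1"
        using \<open>\<not> norm x > R\<close> norm_triangle_ineq2[of y x] by (simp add: norm_minus_commute)
      moreover have "inverse (real (Suc n)) \<le> 1" by (simp add: field_simps)
      ultimately show ?thesis using mollifier_eq_0[of n "x - y"] by simp
    qed simp
    then show ?thesis unfolding conv_def by (simp only:)
  qed (simp add: R)
  moreover have "F x * G x = F x * ?G x" for x
    by (cases "norm x > R") (auto simp: R indicator_def)
  moreover have "(\<lambda>n. \<integral>x. F x * conv ?G (mollifier n) x \<partial>lebesgue) \<longlonglongrightarrow> (\<integral>x. F x * ?G x \<partial>lebesgue)"
  proof (rule conv_tendsto[OF F])
    show "?G \<in> borel_measurable lebesgue"
      using G by (auto simp: L2loc_def intro!: borel_measurable_times borel_measurable_indicator)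
    have "(\<lambda>x. (?G x)\<^sup>2) = (\<lambda>x. indicator (cball 0 (R + 1)) x * (G x)\<^sup>2)"
      by (auto simp: indicator_def)
    then show "integrable lebesgue (\<lambda>x. (?G x)\<^sup>2)" using G by (simp add: L2loc_def)
  qed
  ultimately show ?thesis by (simp only:)
qed

text \<open>The product rule: test the weak derivative of \<open>g\<close> with a mollification of \<open>f\<close>, localised
  by \<open>\<phi>\<close>.\<close>

lemma weak_product_rule:
  fixes f g :: "real^'n::finite \<Rightarrow> real"
  assumes wf: "weak_partial j f f'" and wg: "weak_partial j g g'"
    and L2: "L2loc f" "L2loc f'" "L2loc g" "L2loc g'" and \<phi>: "test_fun \<phi>"
  shows "(\<integral>x. f' x * g x * \<phi> x \<partial>lebesgue) + (\<integral>x. f x * g x * partial j \<phi> x \<partial>lebesgue)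
    = - (\<integral>x. f x * g' x * \<phi> x \<partial>lebesgue)"
proof -
  let ?c = "\<lambda>n. conv f (mollifier n)" and ?c' = "\<lambda>n. conv f' (mollifier n)"
  have lf: "locally_integrable f" "locally_integrable f'" "locally_integrable g" "locally_integrable g'"
    using wf wg by (auto simp: weak_partial_def)
  have sm: "smooth (?c n)" "smooth (?c' n)" for n
    by (intro smooth_conv lf test_fun_mollifier)+
  have pc: "partial j (?c n) = ?c' n" for n
    by (simp only: partial_conv[OF lf(1) test_fun_mollifier] conv_weak_partial[OF wf test_fun_mollifier])
  obtain R where R: "\<And>x. norm x \<ge> R \<Longrightarrow> \<phi> x = 0" using test_fun_support[OF \<phi>] by blast
  have sphi: "smooth \<phi>" using \<phi> test_fun_def by blast
  have int: "integrable lebesgue (\<lambda>x. u x * \<psi> x * h x)"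
    if u: "locally_integrable u" and h: "smooth h" and \<psi>: "test_fun \<psi>" for u h \<psi> :: "real^'n \<Rightarrow> real"
  proof -
    have t: "test_fun (\<lambda>x. h x * \<psi> x)" by (rule test_fun_mult[OF h \<psi>])
    obtain R where "\<And>x. norm x \<ge> R \<Longrightarrow> h x * \<psi> x = 0" using test_fun_support[OF t] by blast
    then have "integrable lebesgue (\<lambda>x. u x * (h x * \<psi> x))"
      using t smooth_continuous
      by (intro locally_integrable_mult[OF u, of _ 0 R]) (auto simp: test_fun_def)
    then show ?thesis by (simp add: mult_ac)
  qed
  have id: "(\<integral>x. (g x * \<phi> x) * ?c' n x \<partial>lebesgue) + (\<integral>x. (g x * partial j \<phi> x) * ?c n x \<partial>lebesgue)
      = - (\<integral>x. (g' x * \<phi> x) * ?c n x \<partial>lebesgue)" for n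
  proof -
    have p: "partial j (\<lambda>x. ?c n x * \<phi> x) x = ?c n x * partial j \<phi> x + ?c' n x * \<phi> x" for x
      by (simp only: partial_mult[OF smooth_differentiable[OF sm(1)] smooth_differentiable[OF sphi]] pc)
    have "(\<integral>x. g x * partial j (\<lambda>x. ?c n x * \<phi> x) x \<partial>lebesgue) = - (\<integral>x. g' x * (?c n x * \<phi> x) \<partial>lebesgue)"
      by (rule wg[unfolded weak_partial_def, THEN conjunct2, THEN conjunct2, rule_format,
          OF test_fun_mult[OF sm(1)[of n] \<phi>]])
    moreover have "g x * partial j (\<lambda>x. ?c n x * \<phi> x) x = (g x * \<phi> x) * ?c' n x + (g x * partial j \<phi> x) * ?c n x" for x
      unfolding p by (simp add: algebra_simps)
    moreover have "g' x * (?c n x * \<phi> x) = (g' x * \<phi> x) * ?c n x" for x by simp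
    ultimately show ?thesis
      using int[OF lf(3) sm(2)[of n] \<phi>] int[OF lf(3) sm(1)[of n] test_fun_partial[OF \<phi>, of j]] by simp
  qed
  have lim: "(\<lambda>n. \<integral>x. (u x * \<psi> x) * conv h (mollifier n) x \<partial>lebesgue) \<longlonglongrightarrow> (\<integral>x. (u x * \<psi> x) * h x \<partial>lebesgue)"
    if l: "L2loc u" "test_fun \<psi>" "L2loc h" for u \<psi> h :: "real^'n \<Rightarrow> real"
  proof -
    obtain R where "(\<lambda>x. u x * \<psi> x) \<in> borel_measurable lebesgue"
      "integrable lebesgue (\<lambda>x. (u x * \<psi> x)\<^sup>2)" "\<And>x. norm x > R \<Longrightarrow> u x * \<psi> x = 0"
      by (rule L2loc_test[OF l(1,2)]) blast
    then show ?thesis by (rule conv_tendsto_loc[OF _ _ _ l(3)])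
  qed
  have "(\<lambda>n. - (\<integral>x. (g' x * \<phi> x) * ?c n x \<partial>lebesgue)) \<longlonglongrightarrow>
      (\<integral>x. (g x * \<phi> x) * f' x \<partial>lebesgue) + (\<integral>x. (g x * partial j \<phi> x) * f x \<partial>lebesgue)"
    unfolding id[symmetric] by (intro tendsto_add lim L2 \<phi> test_fun_partial)
  moreover have "(\<lambda>n. - (\<integral>x. (g' x * \<phi> x) * ?c n x \<partial>lebesgue)) \<longlonglongrightarrow> - (\<integral>x. (g' x * \<phi> x) * f x \<partial>lebesgue)"
    by (intro tendsto_minus lim L2 \<phi>)
  ultimately have "(\<integral>x. (g x * \<phi> x) * f' x \<partial>lebesgue) + (\<integral>x. (g x * partial j \<phi> x) * f x \<partial>lebesgue)
      = - (\<integral>x. (g' x * \<phi> x) * f x \<partial>lebesgue)" by (rule LIMSEQ_unique)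
  then show ?thesis by (simp add: mult_ac)
qed

lemma integrable_imp_locally_integrable:
  assumes "integrable lebesgue f" shows "locally_integrable f"
  unfolding locally_integrable_def
proof (intro allI impI)
  fix K :: "'a set" assume "compact K"
  then have "K \<in> sets lebesgue" by (simp add: borel_compact)
  then show "integrable (lebesgue_on K) f"
    using integrable_mult_indicator[OF _ assms] by (simp add: integrable_restrict_space)
qed

text \<open>Mixed weak derivatives commute. It is enough to test them with mollifications, and the
  derivatives of the radial mollifier commute by inspection.\<close>

lemma weak_partial_commute:
  fixes u :: "real^'n::finite \<Rightarrow> real"
  assumes w: "weak_partial i u ui" "weak_partial j u uj" "weak_partial j ui uij" "weak_partial i uj uji"
    and L2: "L2loc uij" "L2loc uji"
    and G: "G \<in> borel_measurable lebesgue" "integrable lebesgue (\<lambda>x. (G x)\<^sup>2)" "integrable lebesgue G"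
      "\<And>x. norm x > R \<Longrightarrow> G x = 0"
  shows "(\<integral>x. uij x * G x \<partial>lebesgue) = (\<integral>x. uji x * G x \<partial>lebesgue)"
proof -
  let ?\<psi> = "\<lambda>n. conv G (mollifier n)"
  have lG: "locally_integrable G" using G(3) by (rule integrable_imp_locally_integrable)
  have supp: "?\<psi> n x = 0" if "norm x > R + 1" for n x
  proof -
    have "G y * mollifier n (x - y) = 0" for y
    proof (cases "norm y > R")
      case False
      then have "norm (x - y) \<ge> 1" using that norm_triangle_ineq2[of x y] by simp
      moreover have "inverse (real (Suc n)) \<le> 1" by (simp add: field_simps)
      ultimately show ?thesis using mollifier_eq_0[of n "x - y"] by simp
    qed (simp add: G(4))
    then show ?thesis unfolding conv_def by (simp only: integral_zero)
  qed
  have test: "test_fun (?\<psi> n)" for n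
    by (rule test_funI[OF smooth_conv[OF lG test_fun_mollifier] supp])
  have pp: "partial k (partial l (?\<psi> n)) = conv G (partial k (partial l (mollifier n)))" for k l n
    by (simp only: partial_conv[OF lG test_fun_mollifier] partial_conv[OF lG test_fun_partial[OF test_fun_mollifier]])
  have id: "(\<integral>x. uij x * ?\<psi> n x \<partial>lebesgue) = (\<integral>x. uji x * ?\<psi> n x \<partial>lebesgue)" for n
  proof -
    have "(\<integral>x. uij x * ?\<psi> n x \<partial>lebesgue) = - (\<integral>x. ui x * partial j (?\<psi> n) x \<partial>lebesgue)"
      using w(3) test[of n] unfolding weak_partial_def by fastforce
    also have "\<dots> = (\<integral>x. u x * partial i (partial j (?\<psi> n)) x \<partial>lebesgue)"
      using w(1) test_fun_partial[OF test[of n], of j] unfolding weak_partial_def by fastforce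
    also have "\<dots> = (\<integral>x. u x * partial j (partial i (?\<psi> n)) x \<partial>lebesgue)"
      by (simp only: pp mollifier_partial_commute[of i j])
    also have "\<dots> = - (\<integral>x. uj x * partial i (?\<psi> n) x \<partial>lebesgue)"
      using w(2) test_fun_partial[OF test[of n], of i] unfolding weak_partial_def by fastforce
    also have "\<dots> = (\<integral>x. uji x * ?\<psi> n x \<partial>lebesgue)"
      using w(4) test[of n] unfolding weak_partial_def by fastforce
    finally show ?thesis .
  qed
  have lim: "(\<lambda>n. \<integral>x. h x * ?\<psi> n x \<partial>lebesgue) \<longlonglongrightarrow> (\<integral>x. h x * G x \<partial>lebesgue)" if h: "L2loc h" for h
  proof -
    let ?h = "\<lambda>x. indicator (cball 0 (R + 1)) x * h x"
    have "h x * ?\<psi> n x = ?h x * ?\<psi> n x" for x n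
      by (cases "norm x > R + 1") (auto simp: supp)
    moreover have "h x * G x = ?h x * G x" for x
      by (cases "norm x > R") (auto simp: G(4))
    moreover have "(\<lambda>n. \<integral>x. ?h x * ?\<psi> n x \<partial>lebesgue) \<longlonglongrightarrow> (\<integral>x. ?h x * G x \<partial>lebesgue)"
    proof (rule conv_tendsto[OF _ _ G(1,2)])
      show "?h \<in> borel_measurable lebesgue"
        using h by (auto simp: L2loc_def intro!: borel_measurable_times borel_measurable_indicator)
      have "(\<lambda>x. (?h x)\<^sup>2) = (\<lambda>x. indicator (cball 0 (R + 1)) x * (h x)\<^sup>2)"
        by (auto simp: indicator_def)
      then show "integrable lebesgue (\<lambda>x. (?h x)\<^sup>2)" using h by (simp add: L2loc_def)
    qed
    ultimately show ?thesis by (simp only:)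
  qed
  show ?thesis
    using LIMSEQ_unique[OF lim[OF L2(1)]] lim[OF L2(2)] unfolding id by blast
qed

text \<open>The Poisson term: \<open>\<Delta>u \<nabla>u = div (\<nabla>u \<otimes> \<nabla>u) - \<nabla>|\<nabla>u|\<^sup>2 / 2\<close>, tested with a vector field.\<close>

lemma poisson_slice:
  fixes u :: "real^'n::finite \<Rightarrow> real" and D :: "'n \<Rightarrow> real^'n \<Rightarrow> real"
  assumes w1: "\<And>i. weak_partial i u (D i)" and w2: "\<And>i j. weak_partial j (D i) (H i j)"
    and L1: "\<And>i. L2loc (D i)" and L2: "\<And>i j. L2loc (H i j)"
    and \<phi>: "test_field \<phi>"
  shows "(\<integral>x. (\<Sum>j\<in>UNIV. H j j x) * ((\<chi> i. D i x) \<bullet> \<phi> x) \<partial>lebesgue)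
    = (\<integral>x. (norm (\<chi> i. D i x))\<^sup>2 / 2 * divergence \<phi> x - tensor_contract (\<chi> i. D i x) \<phi> x \<partial>lebesgue)"
proof -
  let ?p = "\<lambda>i x. \<phi> x $ i"
  have t: "test_fun (?p i)" for i using \<phi> by (simp add: test_field_def)
  note tp = test_fun_partial[OF t]
  have "(\<integral>x. D i x * H j j x * ?p i x \<partial>lebesgue)
    = (\<integral>x. D j x * D j x * partial i (?p i) x \<partial>lebesgue) / 2
      - (\<integral>x. D j x * D i x * partial j (?p i) x \<partial>lebesgue)" for i j
  proof -
    obtain R where G: "(\<lambda>x. D j x * ?p i x) \<in> borel_measurable lebesgue"
      "integrable lebesgue (\<lambda>x. (D j x * ?p i x)\<^sup>2)" "\<And>x. norm x > R \<Longrightarrow> D j x * ?p i x = 0"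
      by (rule L2loc_test[OF L1[of j] t[of i]]) blast
    obtain R' where R': "\<And>x. norm x \<ge> R' \<Longrightarrow> ?p i x = 0" using test_fun_support[OF t] by blast
    have "locally_integrable (D j)" using w1 by (simp add: weak_partial_def)
    then have "integrable lebesgue (\<lambda>x. D j x * ?p i x)"
      using t[of i] smooth_continuous R'
      by (intro locally_integrable_mult[of _ _ 0 R']) (auto simp: test_fun_def)
    from weak_partial_commute[OF w1 w1 w2 w2 L2 L2 G(1,2) this G(3), where i=i and j=j]
    have c: "(\<integral>x. D j x * H i j x * ?p i x \<partial>lebesgue) = (\<integral>x. D j x * H j i x * ?p i x \<partial>lebesgue)"
      by (simp add: mult_ac)
    have 1: "(\<integral>x. H j j x * D i x * ?p i x \<partial>lebesgue) + (\<integral>x. D j x * D i x * partial j (?p i) x \<partial>lebesgue)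
      = - (\<integral>x. D j x * H i j x * ?p i x \<partial>lebesgue)"
      by (rule weak_product_rule[OF w2 w2 L1 L2 L1 L2 t])
    have 2: "(\<integral>x. H j i x * D j x * ?p i x \<partial>lebesgue) + (\<integral>x. D j x * D j x * partial i (?p i) x \<partial>lebesgue)
      = - (\<integral>x. D j x * H j i x * ?p i x \<partial>lebesgue)"
      by (rule weak_product_rule[OF w2 w2 L1 L2 L1 L2 t])
    show ?thesis using 1 2 c by (simp add: mult_ac)
  qed
  note key = this
  have i1: "integrable lebesgue (\<lambda>x. D i x * H j j x * ?p i x)"
    and i2: "integrable lebesgue (\<lambda>x. D j x * D j x * partial i (?p i) x)"
    and i3: "integrable lebesgue (\<lambda>x. D j x * D i x * partial j (?p i) x)" for i j
    by (intro L2loc_mult_test L1 L2 t tp)+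
  have "(\<integral>x. (\<Sum>j\<in>UNIV. H j j x) * ((\<chi> i. D i x) \<bullet> \<phi> x) \<partial>lebesgue)
    = (\<integral>x. (\<Sum>i\<in>UNIV. \<Sum>j\<in>UNIV. D i x * H j j x * ?p i x) \<partial>lebesgue)"
    by (rule Bochner_Integration.integral_cong)
       (auto simp: inner_vec_def sum_distrib_left sum_distrib_right mult_ac)
  also have "\<dots> = (\<Sum>i\<in>UNIV. \<Sum>j\<in>UNIV. \<integral>x. D i x * H j j x * ?p i x \<partial>lebesgue)"
    by (simp only: Bochner_Integration.integral_sum Bochner_Integration.integrable_sum i1)
  also have "\<dots> = (\<Sum>i\<in>UNIV. \<Sum>j\<in>UNIV. \<integral>x. D j x * D j x * partial i (?p i) x / 2 - D j x * D i x * partial j (?p i) x \<partial>lebesgue)"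
    unfolding key by (simp add: i2 i3)
  also have "\<dots> = (\<integral>x. (\<Sum>i\<in>UNIV. \<Sum>j\<in>UNIV. D j x * D j x * partial i (?p i) x / 2 - D j x * D i x * partial j (?p i) x) \<partial>lebesgue)"
    by (subst Bochner_Integration.integral_sum, (intro Bochner_Integration.integrable_sum
        Bochner_Integration.integrable_diff integrable_divide i2 i3)[1],
        subst Bochner_Integration.integral_sum, (intro Bochner_Integration.integrable_diff integrable_divide i2 i3)[1], rule refl)
  also have "\<dots> = (\<integral>x. (norm (\<chi> i. D i x))\<^sup>2 / 2 * divergence \<phi> x - tensor_contract (\<chi> i. D i x) \<phi> x \<partial>lebesgue)"
  proof (rule Bochner_Integration.integral_cong[OF refl])
    fix x
    have "(\<Sum>i\<in>UNIV. \<Sum>j\<in>UNIV. D j x * D j x * partial i (?p i) x / 2)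
      = (norm (\<chi> i. D i x))\<^sup>2 / 2 * divergence \<phi> x"
      by (simp add: divergence_def power2_norm_eq_inner inner_vec_def sum_distrib_left sum_distrib_right
          sum_divide_distrib)
    moreover have "(\<Sum>i\<in>UNIV. \<Sum>j\<in>UNIV. D j x * D i x * partial j (?p i) x) = tensor_contract (\<chi> i. D i x) \<phi> x"
      unfolding tensor_contract_def by (subst sum.swap) simp
    ultimately show "(\<Sum>i\<in>UNIV. \<Sum>j\<in>UNIV. D j x * D j x * partial i (?p i) x / 2 - D j x * D i x * partial j (?p i) x)
      = (norm (\<chi> i. D i x))\<^sup>2 / 2 * divergence \<phi> x - tensor_contract (\<chi> i. D i x) \<phi> x"
      by (simp only: sum_subtractf)
  qed
  finally show ?thesis .
qed

section \<open>The Poisson term on space-time\<close>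

lemma AE_lebesgue_slice:
  fixes P :: "'a::euclidean_space \<times> real \<Rightarrow> bool"
  assumes "AE z in lebesgue. P z"
  shows "AE t in lebesgue. AE x in lebesgue. P (x, t)"
proof -
  have "AE z in lborel. P z" using assms by (simp add: AE_completion_iff)
  then obtain N where N: "N \<in> sets borel" "emeasure lborel N = 0" "{z. \<not> P z} \<subseteq> N"
    unfolding eventually_ae_filter by (auto simp: null_sets_def)
  have Ns: "N \<in> sets (lborel \<Otimes>\<^sub>M (lborel :: real measure))" using N(1) by (simp only: lborel_prod sets_lborel)
  then have m: "{z \<in> space (lborel \<Otimes>\<^sub>M (lborel :: real measure)). (fst z, snd z) \<notin> N} \<in> sets (lborel \<Otimes>\<^sub>M lborel)"
  proof -
    have "{z \<in> space (lborel \<Otimes>\<^sub>M (lborel :: real measure)). (fst z, snd z) \<notin> N}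
      = space (lborel \<Otimes>\<^sub>M (lborel :: real measure)) - N" by auto
    then show ?thesis using Ns by (simp only: sets.compl_sets)
  qed
  have "AE z in lborel. z \<notin> N" using N by (intro AE_not_in) (simp add: null_sets_def)
  then have "AE z in lborel \<Otimes>\<^sub>M (lborel :: real measure). z \<notin> N" by (simp only: lborel_prod)
  then have "AE x in lborel. AE t in (lborel :: real measure). (x, t) \<notin> N" by (rule lborel_pair.AE_pair)
  then have "AE t in (lborel :: real measure). AE x in lborel. (x, t) \<notin> N"
    by (subst lborel_pair.AE_commute[of "\<lambda>x t. (x, t) \<notin> N", OF m, symmetric])
  then have "AE t in (lborel :: real measure). AE x in lborel. P (x, t)"
    by eventually_elim (use N(3) in \<open>auto elim!: eventually_mono\<close>)
  then show ?thesis by (simp add: AE_completion_iff)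
qed

lemma AE_lebesgue_lift:
  fixes P :: "'a::euclidean_space \<Rightarrow> bool"
  assumes "AE x in lebesgue. P x"
  shows "AE z in (lebesgue :: ('a \<times> real) measure). P (fst z)"
proof -
  have "AE x in lborel. P x" using assms by (simp add: AE_completion_iff)
  then obtain N where N: "N \<in> sets borel" "emeasure lborel N = 0" "{x. \<not> P x} \<subseteq> N"
    unfolding eventually_ae_filter by (auto simp: null_sets_def)
  have "N \<times> (UNIV :: real set) \<in> null_sets (lborel \<Otimes>\<^sub>M lborel)"
    using N by (intro null_setsI) (auto simp: lborel.emeasure_pair_measure_Times)
  then have "N \<times> (UNIV :: real set) \<in> null_sets lborel" by (simp only: lborel_prod)
  then have "AE z in (lborel :: ('a \<times> real) measure). z \<notin> N \<times> UNIV" by (rule AE_not_in)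
  then have "AE z in (lborel :: ('a \<times> real) measure). P (fst z)"
    by eventually_elim (use N(3) in auto)
  then show ?thesis by (rule AE_completion)
qed

text \<open>Fubini's theorem for the completed measure, in the form needed below; the slices are
  compared with those of a Borel representative.\<close>

lemma integral_slices_zero:
  fixes f :: "'a::euclidean_space \<times> real \<Rightarrow> real"
  assumes f: "integrable lebesgue f" and zero: "AE t in lebesgue. (\<integral>x. f (x, t) \<partial>lebesgue) = 0"
    and m: "AE t in lebesgue. (\<lambda>x. f (x, t)) \<in> borel_measurable lebesgue"
  shows "(\<integral>z. f z \<partial>lebesgue) = 0"
proof -
  obtain g where g: "g \<in> borel_measurable borel" and fg: "AE z in lborel. f z = g z"
    using completion_ex_borel_measurable_real[OF borel_measurable_integrable[OF f]] by auto
  have gl: "g \<in> borel_measurable lebesgue" using g by (simp add: measurable_completion)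
  have fgl: "AE z in lebesgue. f z = g z" using fg by (rule AE_completion)
  have "integrable lebesgue g" by (rule integrable_cong_AE_imp[OF f gl]) (use fgl in auto)
  then have gi: "integrable lborel g" using g by (simp add: integrable_completion)
  have gp: "integrable (lborel \<Otimes>\<^sub>M lborel) g" using gi by (simp only: lborel_prod)
  have "(\<integral>z. f z \<partial>lebesgue) = (\<integral>z. g z \<partial>lebesgue)"
    by (rule integral_cong_AE) (use f gl fgl in auto)
  also have "\<dots> = (\<integral>z. g z \<partial>lborel)" using g by (simp add: integral_completion)
  also have "\<dots> = (\<integral>z. g z \<partial>(lborel \<Otimes>\<^sub>M lborel))" by (simp only: lborel_prod)
  also have "\<dots> = (\<integral>t. (\<integral>x. g (x, t) \<partial>lborel) \<partial>lborel)"
    using lborel_pair.integral_snd[of "\<lambda>x t. g (x, t)"] gp by simp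
  also have "\<dots> = (\<integral>t. 0 \<partial>(lborel :: real measure))"
  proof (rule integral_cong_AE)
    have "AE t in lebesgue. (\<integral>x. g (x, t) \<partial>lborel) = 0"
      using AE_lebesgue_slice[OF fgl] zero m
    proof eventually_elim
      case (elim t)
      have gt: "(\<lambda>x. g (x, t)) \<in> borel_measurable borel"
        using g by (rule measurable_compose[rotated]) simp
      have "(\<integral>x. g (x, t) \<partial>lborel) = (\<integral>x. g (x, t) \<partial>lebesgue)"
        using gt by (simp add: integral_completion)
      also have "\<dots> = (\<integral>x. f (x, t) \<partial>lebesgue)"
        by (rule integral_cong_AE) (use elim gt in \<open>auto simp: measurable_completion\<close>)
      finally show ?case using elim by simp
    qed
    then show "AE t in lborel. (\<integral>x. g (x, t) \<partial>lborel) = 0" by (simp add: AE_completion_iff)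
    have g'[measurable]: "g \<in> borel_measurable (lborel \<Otimes>\<^sub>M lborel)" using gp by simp
    show "(\<lambda>t. \<integral>x. g (x, t) \<partial>lborel) \<in> borel_measurable lborel" by measurable
  qed simp
  finally show ?thesis by simp
qed

lemma locally_integrable_measurable:
  assumes "locally_integrable f" shows "f \<in> borel_measurable lebesgue"
proof (rule borel_measurable_LIMSEQ_real)
  show "(\<lambda>x. indicator (cball 0 (real n)) x * f x) \<in> borel_measurable lebesgue" for n
    using locally_integrable_cball[OF assms] by (rule borel_measurable_integrable)
  fix x :: 'a
  obtain m where "norm x \<le> real m" using real_arch_simple by blast
  then have "\<forall>\<^sub>F n in sequentially. indicator (cball 0 (real n)) x * f x = f x"
    by (auto simp: eventually_sequentially indicator_def intro!: exI[of _ m])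
  then show "(\<lambda>n. indicator (cball 0 (real n)) x * f x) \<longlonglongrightarrow> f x" by (rule tendsto_eventually)
qed

lemma Lqloc_L2loc_slice:
  fixes u :: "real^'n::finite \<Rightarrow> real \<Rightarrow> real"
  assumes "Lqloc_L2loc 2 u"
  shows "AE t in lebesgue. t > 0 \<longrightarrow> (\<forall>R. integrable lebesgue (\<lambda>x. indicator (cball 0 R) x * (u x t)\<^sup>2))"
proof -
  have 1: "AE t in lebesgue. t \<in> {inverse (real (Suc k))..real k} \<longrightarrow>
      integrable lebesgue (\<lambda>x. indicator (cball 0 (real m)) x * (u x t)\<^sup>2)" for m k :: nat
  proof -
    have "compact (cball (0::real^'n) (real m)) \<and> compact {inverse (real (Suc k))..real k}
      \<and> {inverse (real (Suc k))..real k} \<subseteq> {0<..}"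
    proof -
      have "0 < inverse (real (Suc k))" by simp
      then have "{inverse (real (Suc k))..real k} \<subseteq> {0<..}" by (meson atLeastAtMost_iff greaterThan_iff less_le_trans subsetI)
      then show ?thesis by simp
    qed
    then have "AE t in lebesgue_on {inverse (real (Suc k))..real k}.
        integrable (lebesgue_on (cball (0::real^'n) (real m))) (\<lambda>x. (u x t)\<^sup>2)"
      using assms unfolding Lqloc_L2loc_def by blast
    then show ?thesis by (simp add: AE_restrict_space_iff integrable_restrict_space)
  qed
  have "AE t in lebesgue. \<forall>m k::nat. t \<in> {inverse (real (Suc k))..real k} \<longrightarrow>
      integrable lebesgue (\<lambda>x. indicator (cball 0 (real m)) x * (u x t)\<^sup>2)"
    unfolding AE_all_countable using 1 by blast
  then show ?thesis
  proof eventually_elim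
    case (elim t)
    show ?case
    proof (intro impI allI)
      fix R :: real assume "t > 0"
      obtain k1 :: nat where k1: "inverse (real (Suc k1)) < t" using reals_Archimedean[OF \<open>t > 0\<close>] by blast
      obtain k2 :: nat where k2: "t \<le> real k2" using real_arch_simple by blast
      obtain m :: nat where m: "R \<le> real m" using real_arch_simple by blast
      have "inverse (real (Suc (max k1 k2))) \<le> inverse (real (Suc k1))"
        by (rule le_imp_inverse_le) auto
      then have "inverse (real (Suc (max k1 k2))) \<le> t" using k1 by linarith
      moreover have "t \<le> real (max k1 k2)" using k2 by linarith
      ultimately have "t \<in> {inverse (real (Suc (max k1 k2)))..real (max k1 k2)}" by simp
      then have "integrable lebesgue (\<lambda>x. indicator (cball 0 (real m)) x * (u x t)\<^sup>2)" using elim by blast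
      then have "integrable lebesgue (\<lambda>x. indicator (cball 0 R) x *\<^sub>R (indicator (cball 0 (real m)) x * (u x t)\<^sup>2))"
        by (intro integrable_mult_indicator) auto
      moreover have "indicator (cball 0 R) x *\<^sub>R (indicator (cball 0 (real m)) x * (u x t)\<^sup>2)
        = indicator (cball 0 R) x * (u x t)\<^sup>2" for x :: "real^'n"
        using m by (auto simp: indicator_def)
      ultimately show "integrable lebesgue (\<lambda>x. indicator (cball 0 R) x * (u x t)\<^sup>2)" by (simp only:)
    qed
  qed
qed

lemma wpartial_weak:
  assumes "\<exists>g. spatial_weak_partial i u g"
  shows "spatial_weak_partial i u (wpartial i u)"
  unfolding wpartial_def using assms by (rule someI_ex)

text \<open>At almost every time, the chosen weak derivatives of \<open>\<Phi>\<close> up to order two are weak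
  derivatives of the slice and locally square integrable.\<close>

lemma W22_slice:
  fixes \<Phi> :: "real^'n::finite \<Rightarrow> real \<Rightarrow> real"
  assumes "L2loc_W22loc \<Phi>"
  shows "AE t in lebesgue. t > 0 \<longrightarrow>
    (\<forall>i. weak_partial i (\<lambda>x. \<Phi> x t) (\<lambda>x. wpartial i \<Phi> x t) \<and> L2loc (\<lambda>x. wpartial i \<Phi> x t) \<and>
      (\<forall>j. weak_partial j (\<lambda>x. wpartial i \<Phi> x t) (\<lambda>x. wpartial j (wpartial i \<Phi>) x t)
        \<and> L2loc (\<lambda>x. wpartial j (wpartial i \<Phi>) x t)))"
proof -
  have w: "AE t in lebesgue. t > 0 \<longrightarrow> weak_partial i (\<lambda>x. u x t) (\<lambda>x. wpartial i u x t) \<and> L2loc (\<lambda>x. wpartial i u x t)"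
    if ex: "\<exists>g. spatial_weak_partial i u g" and L: "Lqloc_L2loc 2 (wpartial i u)" for i u
  proof -
    have "AE t in lebesgue_on {0..}. weak_partial i (\<lambda>x. u x t) (\<lambda>x. wpartial i u x t)"
      using wpartial_weak[OF ex] by (simp add: spatial_weak_partial_def)
    then have "AE t in lebesgue. t \<in> {0..} \<longrightarrow> weak_partial i (\<lambda>x. u x t) (\<lambda>x. wpartial i u x t)"
      by (subst (asm) AE_restrict_space_iff) auto
    then show ?thesis using Lqloc_L2loc_slice[OF L]
    proof eventually_elim
      case (elim t)
      show ?case
      proof
        assume t: "t > 0"
        then have w: "weak_partial i (\<lambda>x. u x t) (\<lambda>x. wpartial i u x t)" using elim by simp
        then have "(\<lambda>x. wpartial i u x t) \<in> borel_measurable lebesgue"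
          by (intro locally_integrable_measurable) (simp add: weak_partial_def)
        then show "weak_partial i (\<lambda>x. u x t) (\<lambda>x. wpartial i u x t) \<and> L2loc (\<lambda>x. wpartial i u x t)"
          using w elim t by (simp add: L2loc_def)
      qed
    qed
  qed
  have 1: "AE t in lebesgue. \<forall>i. t > 0 \<longrightarrow> weak_partial i (\<lambda>x. \<Phi> x t) (\<lambda>x. wpartial i \<Phi> x t)
      \<and> L2loc (\<lambda>x. wpartial i \<Phi> x t)"
  proof (subst AE_all_countable, intro allI w)
    fix i show "\<exists>g. spatial_weak_partial i \<Phi> g" "Lqloc_L2loc 2 (wpartial i \<Phi>)"
      using assms unfolding L2loc_W22loc_def by blast+
  qed
  have 2: "AE t in lebesgue. \<forall>i j. t > 0 \<longrightarrow> weak_partial j (\<lambda>x. wpartial i \<Phi> x t) (\<lambda>x. wpartial j (wpartial i \<Phi>) x t)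
      \<and> L2loc (\<lambda>x. wpartial j (wpartial i \<Phi>) x t)"
  proof (subst AE_all_countable, rule allI, subst AE_all_countable, intro allI w)
    fix i j show "\<exists>g. spatial_weak_partial j (wpartial i \<Phi>) g" "Lqloc_L2loc 2 (wpartial j (wpartial i \<Phi>))"
      using assms unfolding L2loc_W22loc_def by blast+
  qed
  show ?thesis using 1 2 by eventually_elim blast
qed

lemma poisson_spacetime:
  fixes \<Phi> :: "real^'n::finite \<Rightarrow> real \<Rightarrow> real"
  assumes W: "L2loc_W22loc \<Phi>" and \<phi>: "test_field \<phi>"
    and lap: "AE (x, t) in spacetime. wlaplacian \<Phi> x t = \<rho> x t"
    and i1: "integrable spacetime (\<lambda>(x, t). \<rho> x t * (wgrad \<Phi> x t \<bullet> \<phi> x) * \<xi> t)"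
    and i2: "integrable spacetime (\<lambda>(x, t). ((norm (wgrad \<Phi> x t))\<^sup>2 / 2 * divergence \<phi> x
        - tensor_contract (wgrad \<Phi> x t) \<phi> x) * \<xi> t)"
  shows "(\<integral>(x, t). \<rho> x t * (wgrad \<Phi> x t \<bullet> \<phi> x) * \<xi> t \<partial>spacetime)
    = (\<integral>(x, t). ((norm (wgrad \<Phi> x t))\<^sup>2 / 2 * divergence \<phi> x
        - tensor_contract (wgrad \<Phi> x t) \<phi> x) * \<xi> t \<partial>spacetime)"
proof -
  let ?A = "\<lambda>x t. \<rho> x t * (wgrad \<Phi> x t \<bullet> \<phi> x)"
  let ?A' = "\<lambda>x t. wlaplacian \<Phi> x t * (wgrad \<Phi> x t \<bullet> \<phi> x)"
  let ?B = "\<lambda>x t. (norm (wgrad \<Phi> x t))\<^sup>2 / 2 * divergence \<phi> x - tensor_contract (wgrad \<Phi> x t) \<phi> x"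
  let ?S = "UNIV \<times> {0..} :: ((real^'n) \<times> real) set"
  let ?f = "\<lambda>(x, t). indicator {0..} t * ((?A x t - ?B x t) * \<xi> t)"
  have S: "?S \<in> sets lebesgue" by (simp add: borel_closed closed_Times)
  have ind: "indicator ?S z = indicator {0..} (snd z)" for z
    by (cases z) (auto simp: indicator_def)
  have i: "integrable spacetime (\<lambda>(x, t). (?A x t - ?B x t) * \<xi> t)"
    using Bochner_Integration.integrable_diff[OF i1 i2] by (simp add: case_prod_unfold algebra_simps)
  then have fi: "integrable lebesgue ?f"
    using S by (simp add: integrable_restrict_space ind case_prod_unfold)
  have "AE z in lebesgue. z \<in> ?S \<longrightarrow> wlaplacian \<Phi> (fst z) (snd z) = \<rho> (fst z) (snd z)"
    using lap S by (simp add: AE_restrict_space_iff case_prod_unfold)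
  from AE_lebesgue_slice[OF this]
  have lap': "AE t in lebesgue. t \<ge> 0 \<longrightarrow> (AE x in lebesgue. wlaplacian \<Phi> x t = \<rho> x t)"
    by (simp add: mem_Times_iff)
  have t0: "AE t in lebesgue. t \<noteq> (0::real)"
    by (rule AE_completion) (rule AE_lborel_singleton)
  have slices: "AE t in lebesgue. (\<lambda>x. ?f (x, t)) \<in> borel_measurable lebesgue \<and> (\<integral>x. ?f (x, t) \<partial>lebesgue) = 0"
    using lap' t0 W22_slice[OF W]
  proof eventually_elim
    case (elim t)
    show ?case
    proof (cases "t > 0")
      case False
      then have "(\<lambda>x. ?f (x, t)) = (\<lambda>x. 0)" using elim by (auto simp: indicator_def)
      then show ?thesis by simp
    next
      case True
      let ?D = "\<lambda>i x. wpartial i \<Phi> x t" and ?H = "\<lambda>i j x. wpartial j (wpartial i \<Phi>) x t"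
      have w: "\<And>i. weak_partial i (\<lambda>x. \<Phi> x t) (?D i)" "\<And>i j. weak_partial j (?D i) (?H i j)"
        "\<And>i. L2loc (?D i)" "\<And>i j. L2loc (?H i j)" using elim(3) True by blast+
      have g: "wgrad \<Phi> x t = (\<chi> i. ?D i x)" for x by (simp add: wgrad_def)
      have l: "wlaplacian \<Phi> x t = (\<Sum>j\<in>UNIV. ?H j j x)" for x by (simp add: wlaplacian_def)
      have eq: "(\<integral>x. ?A' x t \<partial>lebesgue) = (\<integral>x. ?B x t \<partial>lebesgue)"
        unfolding g l by (rule poisson_slice[OF w \<phi>])
      have tp: "test_fun (\<lambda>x. \<phi> x $ i)" for i using \<phi> by (simp add: test_field_def)
      have iA: "integrable lebesgue (\<lambda>x. ?A' x t)"
      proof -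
        have "?A' x t = (\<Sum>j\<in>UNIV. \<Sum>i\<in>UNIV. ?H j j x * ?D i x * \<phi> x $ i)" for x
          unfolding g l by (simp add: inner_vec_def sum_product mult_ac)
        moreover have "integrable lebesgue (\<lambda>x. \<Sum>j\<in>UNIV. \<Sum>i\<in>UNIV. ?H j j x * ?D i x * \<phi> x $ i)"
          by (intro Bochner_Integration.integrable_sum L2loc_mult_test w tp)
        ultimately show ?thesis by (simp only:)
      qed
      have iB: "integrable lebesgue (\<lambda>x. ?B x t)"
      proof -
        have "?B x t = (\<Sum>i\<in>UNIV. \<Sum>j\<in>UNIV. ?D j x * ?D j x * partial i (\<lambda>y. \<phi> y $ i) x / 2)
            - (\<Sum>i\<in>UNIV. \<Sum>j\<in>UNIV. ?D i x * ?D j x * partial i (\<lambda>y. \<phi> y $ j) x)" for x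
          unfolding g by (simp add: divergence_def tensor_contract_def power2_norm_eq_inner inner_vec_def
            sum_product sum_divide_distrib mult_ac)
        moreover have "integrable lebesgue (\<lambda>x. (\<Sum>i\<in>UNIV. \<Sum>j\<in>UNIV. ?D j x * ?D j x * partial i (\<lambda>y. \<phi> y $ i) x / 2)
            - (\<Sum>i\<in>UNIV. \<Sum>j\<in>UNIV. ?D i x * ?D j x * partial i (\<lambda>y. \<phi> y $ j) x))"
          by (intro Bochner_Integration.integrable_diff Bochner_Integration.integrable_sum
              integrable_divide L2loc_mult_test w test_fun_partial tp)
        ultimately show ?thesis by (simp only:)
      qed
      have AA: "AE x in lebesgue. ?A x t = ?A' x t" using elim(1) True by auto
      have fA: "AE x in lebesgue. (?A' x t - ?B x t) * \<xi> t = ?f (x, t)"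
        using AA
      proof eventually_elim
        case (elim x)
        then show ?case using True by (auto simp only: split indicator_simps greaterThan_iff atLeast_iff less_imp_le mult_1)
      qed
      have i': "integrable lebesgue (\<lambda>x. (?A' x t - ?B x t) * \<xi> t)" using iA iB by simp
      have m: "(\<lambda>x. ?f (x, t)) \<in> borel_measurable lebesgue"
        using borel_measurable_integrable[OF i'] fA by (rule borel_measurable_AE)
      have "(\<integral>x. ?f (x, t) \<partial>lebesgue) = (\<integral>x. (?A' x t - ?B x t) * \<xi> t \<partial>lebesgue)"
        by (rule integral_cong_AE[OF m borel_measurable_integrable[OF i']])
           (rule eventually_mono[OF fA], rule sym)
      also have "\<dots> = 0" using iA iB eq by simp
      finally show ?thesis using m by simp
    qed
  qed
  have "(\<integral>z. ?f z \<partial>lebesgue) = 0"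
    by (rule integral_slices_zero[OF fi]) (use slices in \<open>auto elim: eventually_mono\<close>)
  then have "(\<integral>(x, t). (?A x t - ?B x t) * \<xi> t \<partial>spacetime) = 0"
    using S by (simp add: integral_restrict_space ind case_prod_unfold)
  moreover have "(\<integral>(x, t). (?A x t - ?B x t) * \<xi> t \<partial>spacetime)
    = (\<integral>(x, t). ?A x t * \<xi> t \<partial>spacetime) - (\<integral>(x, t). ?B x t * \<xi> t \<partial>spacetime)"
    using Bochner_Integration.integral_diff[OF i1 i2] by (simp add: case_prod_unfold left_diff_distrib)
  ultimately show ?thesis by simp
qed

section \<open>Weights\<close>

lemma indicator_interval_integrable: "integrable lebesgue (indicator {0..r} :: real \<Rightarrow> real)"
  by (rule integrable_real_indicator) (simp_all add: emeasure_lborel_Icc_eq)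

lemma weight_set_integrable:
  assumes "admissible_weight w" shows "set_integrable lebesgue {0..r} w"
proof (rule set_integrable_subset)
  show "set_integrable lebesgue {0..max 1 r} w" using assms by (simp add: admissible_weight_def)
qed auto

lemma weight_pos: "admissible_weight w \<Longrightarrow> r > 0 \<Longrightarrow> w r > 0"
  by (simp add: admissible_weight_def)

lemma weight_antimono: "admissible_weight w \<Longrightarrow> 0 < r \<Longrightarrow> r \<le> s \<Longrightarrow> w s \<le> w r"
  by (auto simp: admissible_weight_def monotone_on_def)

lemma int1_mono:
  assumes w: "admissible_weight w" and "r \<le> s" shows "int1 w r \<le> int1 w s"
  unfolding int1_def set_lebesgue_integral_def
proof (rule integral_mono_AE)
  have "AE x in lebesgue. x \<noteq> (0::real)" by (rule AE_completion) (rule AE_lborel_singleton)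
  then show "AE x in lebesgue. indicator {0..r} x *\<^sub>R w x \<le> indicator {0..s} x *\<^sub>R w x"
  proof eventually_elim
    case (elim x)
    then show ?case using weight_pos[OF w, of x] \<open>r \<le> s\<close> by (auto simp: indicator_def)
  qed
qed (use weight_set_integrable[OF w] in \<open>simp_all add: set_integrable_def\<close>)

lemma int1_nonpos: "r \<le> 0 \<Longrightarrow> int1 w r = 0"
proof -
  assume "r \<le> 0"
  have "AE x in lebesgue. x \<noteq> (0::real)" by (rule AE_completion) (rule AE_lborel_singleton)
  then have "AE x in lebesgue. indicator {0..r} x *\<^sub>R w x = 0"
    by eventually_elim (use \<open>r \<le> 0\<close> in \<open>auto simp: indicator_def\<close>)
  then show ?thesis unfolding int1_def set_lebesgue_integral_def by (rule integral_eq_zero_AE)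
qed

lemma int1_nonneg: "admissible_weight w \<Longrightarrow> int1 w r \<ge> 0"
  using int1_mono[of w "min 0 r" r] int1_nonpos[of "min 0 r" w] by simp

lemma int1_ge:
  assumes w: "admissible_weight w" and "r > 0" shows "r * w r \<le> int1 w r"
proof -
  have "r * w r = (LINT x|lebesgue. indicator {0..r} x *\<^sub>R w r)"
    using \<open>r > 0\<close> by simp
  also have "\<dots> \<le> (LINT x|lebesgue. indicator {0..r} x *\<^sub>R w x)"
  proof (rule integral_mono_AE)
    have "AE x in lebesgue. x \<noteq> (0::real)" by (rule AE_completion) (rule AE_lborel_singleton)
    then show "AE x in lebesgue. indicator {0..r} x *\<^sub>R w r \<le> indicator {0..r} x *\<^sub>R w x"
    proof eventually_elim
      case (elim x)
      then show ?case using weight_antimono[OF w, of x r] by (auto simp: indicator_def)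
    qed
    show "integrable lebesgue (\<lambda>x. indicator {0..r} x *\<^sub>R w r)"
      by (simp add: indicator_interval_integrable)
  qed (use weight_set_integrable[OF w] in \<open>simp_all add: set_integrable_def\<close>)
  finally show ?thesis by (simp add: int1_def set_lebesgue_integral_def)
qed

lemma int1_borel: "admissible_weight w \<Longrightarrow> int1 w \<in> borel_measurable borel"
  by (rule borel_measurable_mono) (simp add: mono_def int1_mono)

lemma int1_set_integrable:
  assumes w: "admissible_weight w" shows "set_integrable lebesgue {0..r} (int1 w)"
  unfolding set_integrable_def
proof (rule Bochner_Integration.integrable_bound)
  show "integrable lebesgue (\<lambda>x. indicator {0..r} x * int1 w r)"
    by (simp add: indicator_interval_integrable)
  show "(\<lambda>x. indicator {0..r} x *\<^sub>R int1 w x) \<in> borel_measurable lebesgue"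
    using int1_borel[OF w] by (intro borel_measurable_scaleR borel_measurable_indicator measurable_completion) simp_all
  show "AE x in lebesgue. norm (indicator {0..r} x *\<^sub>R int1 w x) \<le> norm (indicator {0..r} x * int1 w r)"
    using int1_mono[OF w] int1_nonneg[OF w] by (intro AE_I2) (auto simp: indicator_def)
qed

lemma int2_mono:
  assumes w: "admissible_weight w" and "r \<le> s" shows "int2 w r \<le> int2 w s"
  unfolding int2_def set_lebesgue_integral_def
proof (rule integral_mono)
  show "indicator {0..r} x *\<^sub>R int1 w x \<le> indicator {0..s} x *\<^sub>R int1 w x" for x
    using int1_nonneg[OF w, of x] \<open>r \<le> s\<close> by (auto simp: indicator_def)
qed (use int1_set_integrable[OF w] in \<open>simp_all add: set_integrable_def\<close>)

lemma int2_nonneg: "admissible_weight w \<Longrightarrow> int2 w r \<ge> 0"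
  unfolding int2_def set_lebesgue_integral_def
  by (rule integral_nonneg_AE) (simp add: int1_nonneg)

lemma int2_le:
  assumes w: "admissible_weight w" and "r \<ge> 0" shows "int2 w r \<le> r * int1 w r"
proof -
  have "int2 w r \<le> (LINT x|lebesgue. indicator {0..r} x *\<^sub>R int1 w r)"
    unfolding int2_def set_lebesgue_integral_def
  proof (rule integral_mono)
    show "indicator {0..r} x *\<^sub>R int1 w x \<le> indicator {0..r} x *\<^sub>R int1 w r" for x
      using int1_mono[OF w, of x r] by (auto simp: indicator_def)
    show "integrable lebesgue (\<lambda>x. indicator {0..r} x *\<^sub>R int1 w r)"
      by (simp add: indicator_interval_integrable)
  qed (use int1_set_integrable[OF w] in \<open>simp add: set_integrable_def\<close>)
  also have "\<dots> = r * int1 w r" using \<open>r \<ge> 0\<close> by simp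
  finally show ?thesis .
qed

lemma int2_borel: "admissible_weight w \<Longrightarrow> int2 w \<in> borel_measurable borel"
  by (rule borel_measurable_mono) (simp add: mono_def int2_mono)

text \<open>The weight, set to zero where it is unconstrained; this version is Borel measurable.\<close>

definition wt :: "(real \<Rightarrow> real) \<Rightarrow> real \<Rightarrow> real" where
  "wt w r = (if r > 0 then w r else 0)"

lemma wt_borel:
  assumes "admissible_weight w" shows "wt w \<in> borel_measurable borel"
proof -
  have "mono_on {0<..} (\<lambda>r. - w r)" using weight_antimono[OF assms] by (auto simp: monotone_on_def)
  from borel_measurable_mono_on_fnc[OF this]
  have "(\<lambda>r. - w r) \<in> borel_measurable (restrict_space borel {0<..})" .
  then have "(\<lambda>r. - (- w r)) \<in> borel_measurable (restrict_space borel {0<..})"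
    by (rule borel_measurable_uminus)
  then have "(\<lambda>r. indicator {0<..} r *\<^sub>R w r) \<in> borel_measurable borel"
    by (simp add: borel_measurable_restrict_space_iff)
  moreover have "wt w = (\<lambda>r. indicator {0<..} r *\<^sub>R w r)" by (auto simp: wt_def indicator_def)
  ultimately show ?thesis by simp
qed

text \<open>The weight of the energy in the integrability hypothesis.\<close>

definition Bw :: "(real \<Rightarrow> real) \<Rightarrow> real^'n::finite \<Rightarrow> real" where
  "Bw w x = wt w (norm x) + int1 w (norm x) / norm x + int2 w (norm x) / (norm x)\<^sup>2"

lemma Bw_borel: assumes "admissible_weight w" shows "Bw w \<in> borel_measurable borel"
proof -
  note [measurable] = wt_borel[OF assms] int1_borel[OF assms] int2_borel[OF assms]
  show ?thesis unfolding Bw_def[abs_def] by measurable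
qed

lemma Bw_ge:
  assumes w: "admissible_weight w"
  shows "wt w (norm x) \<le> Bw w x" "int1 w (norm x) / norm x \<le> Bw w x"
    "int1 w (norm x) / norm x + int2 w (norm x) / (norm x)\<^sup>2 \<le> Bw w x" "0 \<le> Bw w x"
proof -
  have "0 \<le> wt w (norm x)" using weight_pos[OF w, of "norm x"] by (auto simp: wt_def less_imp_le)
  moreover have "0 \<le> int1 w (norm x) / norm x" using int1_nonneg[OF w] by simp
  moreover have "0 \<le> int2 w (norm x) / (norm x)\<^sup>2" using int2_nonneg[OF w] by simp
  ultimately show "wt w (norm x) \<le> Bw w x" "int1 w (norm x) / norm x \<le> Bw w x"
    "int1 w (norm x) / norm x + int2 w (norm x) / (norm x)\<^sup>2 \<le> Bw w x" "0 \<le> Bw w x"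
    unfolding Bw_def by linarith+
qed

text \<open>On a bounded set the weight is bounded below, so the weights dominate constants there.\<close>

lemma weight_lower_bound:
  assumes w: "admissible_weight w" and R: "R > 0" and x: "x \<noteq> 0" "(norm x)\<^sup>2 \<le> R"
  shows "w (sqrt R) \<le> Bw w x" "w (sqrt R) * norm x \<le> int1 w (norm x)"
proof -
  have nx: "norm x > 0" "norm x \<le> sqrt R" using x R by (auto simp: real_le_rsqrt)
  then have le: "w (sqrt R) \<le> w (norm x)" using weight_antimono[OF w] by blast
  then show "w (sqrt R) \<le> Bw w x" using Bw_ge(1)[OF w, of x] nx by (simp add: wt_def)
  have "w (sqrt R) * norm x \<le> norm x * w (norm x)" using le nx by (simp add: mult.commute)
  then show "w (sqrt R) * norm x \<le> int1 w (norm x)" using int1_ge[OF w nx(1)] by linarith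
qed

section \<open>The identity for radial test functions\<close>

text \<open>A weak solution; only the measurability and sign of its components are derived here.\<close>

locale solution =
  fixes k :: real and p :: "real \<Rightarrow> real" and \<rho>\<^sub>0 :: "real^'n::finite \<Rightarrow> real" and v\<^sub>0 :: "real^'n \<Rightarrow> real^'n"
    and \<rho> :: "real^'n \<Rightarrow> real \<Rightarrow> real" and v :: "real^'n \<Rightarrow> real \<Rightarrow> real^'n" and \<Phi> :: "real^'n \<Rightarrow> real \<Rightarrow> real"
  assumes k: "k \<ge> 0" and init: "initial_data \<rho>\<^sub>0 v\<^sub>0" and sol: "global_weak_solution k p \<rho>\<^sub>0 v\<^sub>0 \<rho> v \<Phi>"
begin

abbreviation g :: "real^'n \<Rightarrow> real \<Rightarrow> real^'n" where "g \<equiv> wgrad \<Phi>"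

text \<open>The integrand of the integrability hypothesis, without its weight.\<close>

definition energy :: "real^'n \<Rightarrow> real \<Rightarrow> real" where
  "energy x t = \<rho> x t * (norm (v x t))\<^sup>2 + p (\<rho> x t) + k * (norm (g x t))\<^sup>2"

text \<open>A radial potential whose Hessian is \<open>a I + b (x \<otimes> x) / |x|\<^sup>2\<close> has Laplacian \<open>N a + b\<close>;
  this is the total flux paired with that Hessian.\<close>

definition dens :: "(real^'n \<Rightarrow> real) \<Rightarrow> (real^'n \<Rightarrow> real) \<Rightarrow> real^'n \<Rightarrow> real \<Rightarrow> real" where
  "dens a b x t = \<rho> x t * (a x * (norm (v x t))\<^sup>2 + b x * ((v x t \<bullet> x)\<^sup>2 / (norm x)\<^sup>2))
    + p (\<rho> x t) * (real CARD('n) * a x + b x)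
    + k * ((norm (g x t))\<^sup>2 / 2 * (real CARD('n) * a x + b x)
        - (a x * (norm (g x t))\<^sup>2 + b x * ((x \<bullet> g x t)\<^sup>2 / (norm x)\<^sup>2)))"

lemma sol_parts:
  "L1loc_Linfloc \<rho>" "\<And>i. Lqloc_L2loc 1 (\<lambda>x t. v x t $ i)" "L2loc_W22loc \<Phi>"
  "weak_continuity \<rho>\<^sub>0 \<rho> v" "weak_momentum k p \<rho>\<^sub>0 v\<^sub>0 \<rho> v \<Phi>"
  "AE (x, t) in spacetime. wlaplacian \<Phi> x t = \<rho> x t"
  "AE (x, t) in spacetime. \<rho> x t \<ge> 0 \<and> p (\<rho> x t) \<ge> 0"
  using sol unfolding global_weak_solution_def by (auto elim: eventually_mono)

lemma rho_measurable: "(\<lambda>z. \<rho> (fst z) (snd z)) \<in> borel_measurable spacetime"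
  using sol_parts(1) by (simp add: L1loc_Linfloc_def case_prod_unfold)

lemma vec_measurable:
  fixes f :: "'b \<Rightarrow> real^'m::finite"
  assumes "\<And>i. (\<lambda>z. f z $ i) \<in> borel_measurable M" shows "f \<in> borel_measurable M"
  by (subst borel_measurable_euclidean_space) (use assms in \<open>auto simp: Basis_vec_def inner_axis\<close>)

lemma v_measurable: "(\<lambda>z. v (fst z) (snd z)) \<in> borel_measurable spacetime"
  using sol_parts(2) by (intro vec_measurable) (simp add: Lqloc_L2loc_def case_prod_unfold)

lemma g_measurable: "(\<lambda>z. g (fst z) (snd z)) \<in> borel_measurable spacetime"
proof (rule vec_measurable)
  fix i
  have "\<exists>h. spatial_weak_partial i \<Phi> h" using sol_parts(3) unfolding L2loc_W22loc_def by blast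
  from wpartial_weak[OF this] show "(\<lambda>z. g (fst z) (snd z) $ i) \<in> borel_measurable spacetime"
    by (simp add: wgrad_def spatial_weak_partial_def case_prod_unfold)
qed

lemma space_measurable: "(\<lambda>z::(real^'n) \<times> real. fst z) \<in> borel_measurable spacetime"
  by (intro measurable_restrict_space1 measurable_completion)
     (auto intro!: borel_measurable_continuous_onI continuous_intros)

lemma space_fun_measurable:
  assumes "f \<in> borel_measurable borel" shows "(\<lambda>z::(real^'n) \<times> real. f (fst z)) \<in> borel_measurable spacetime"
proof -
  have "(\<lambda>z::(real^'n) \<times> real. f (fst z)) \<in> borel_measurable borel"
    by (rule measurable_compose[OF _ assms])
       (auto intro!: borel_measurable_continuous_onI continuous_intros)
  then show ?thesis by (intro measurable_restrict_space1 measurable_completion) simp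
qed

lemma time_fun_measurable:
  assumes "f \<in> borel_measurable borel" shows "(\<lambda>z::(real^'n) \<times> real. f (snd z)) \<in> borel_measurable spacetime"
proof -
  have "(\<lambda>z::(real^'n) \<times> real. f (snd z)) \<in> borel_measurable borel"
    by (rule measurable_compose[OF _ assms])
       (auto intro!: borel_measurable_continuous_onI continuous_intros)
  then show ?thesis by (intro measurable_restrict_space1 measurable_completion) simp
qed

end

text \<open>A solution together with a weight for which the energy and the initial momentum are
  integrable.\<close>

locale flow = solution k p \<rho>\<^sub>0 v\<^sub>0 \<rho> v \<Phi>
  for k :: real and p :: "real \<Rightarrow> real" and \<rho>\<^sub>0 :: "real^'n::finite \<Rightarrow> real" and v\<^sub>0 :: "real^'n \<Rightarrow> real^'n"
    and \<rho> :: "real^'n \<Rightarrow> real \<Rightarrow> real" and v :: "real^'n \<Rightarrow> real \<Rightarrow> real^'n" and \<Phi> :: "real^'n \<Rightarrow> real \<Rightarrow> real" +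
  fixes w :: "real \<Rightarrow> real"
  assumes w: "admissible_weight w" and B: "condition_B k p w \<rho> v \<Phi>"
    and mom: "(\<integral>\<^sup>+ x. ennreal (\<rho>\<^sub>0 x * norm (v\<^sub>0 x) * int1 w (norm x)) \<partial>lebesgue) < \<infinity>"

lemma spacetime_set: "(UNIV \<times> {0..} :: ((real^'n::finite) \<times> real) set) \<in> sets lebesgue"
  "(UNIV \<times> {0..T} :: ((real^'n::finite) \<times> real) set) \<in> sets lebesgue"
  by (simp_all add: borel_closed closed_Times)

lemma AE_spacetime_space:
  assumes "AE x in lebesgue. P (x :: real^'n::finite)"
  shows "AE z in spacetime. P (fst z)"
  using AE_lebesgue_lift[OF assms] by (subst AE_restrict_space_iff) (auto simp: spacetime_set)

lemma AE_nonzero: "AE x in lebesgue. x \<noteq> (0 :: real^'n::finite)"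
  by (rule AE_completion) (rule AE_lborel_singleton)

subsection \<open>Radial functions\<close>

text \<open>Radial potentials \<open>G(|x|\<^sup>2)\<close>, with the coefficients of their gradient and Hessian.\<close>

locale radial =
  fixes G G' G'' :: "real \<Rightarrow> real" and R :: real and \<psi> :: "real^'n::finite \<Rightarrow> real"
  assumes G1: "\<And>s. (G has_real_derivative G' s) (at s)" and G2: "\<And>s. (G' has_real_derivative G'' s) (at s)"
    and cont: "continuous_on UNIV G''" and sm: "smooth \<psi>" and psi: "\<psi> = (\<lambda>x. G ((norm x)\<^sup>2))"
    and R: "R > 0" and zero: "\<And>s. s \<ge> R \<Longrightarrow> G s = 0" "\<And>s. s \<ge> R \<Longrightarrow> G' s = 0" "\<And>s. s \<ge> R \<Longrightarrow> G'' s = 0"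
begin

text \<open>The gradient of \<open>\<psi>\<close> is \<open>a x\<close>, and its Hessian is \<open>a I + b (x \<otimes> x) / |x|\<^sup>2\<close>.\<close>

definition a :: "real^'n \<Rightarrow> real" where "a x = 2 * G' ((norm x)\<^sup>2)"
definition b :: "real^'n \<Rightarrow> real" where "b x = 4 * (norm x)\<^sup>2 * G'' ((norm x)\<^sup>2)"

lemma test: "test_fun \<psi>"
proof (rule test_funI[OF sm])
  fix x :: "real^'n" assume "norm x > sqrt R"
  then have "(norm x)\<^sup>2 \<ge> R"
    using power_mono[of "sqrt R" "norm x" 2] R by simp
  then show "\<psi> x = 0" by (simp add: psi zero)
qed

lemma grad_eq: "grad \<psi> x = a x *\<^sub>R x"
  by (simp add: vec_eq_iff grad_def psi partial_radial[OF G1] a_def)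

lemma field: "test_field (grad \<psi>)"
  unfolding test_field_def grad_def using test_fun_partial[OF test] by (simp add: eta_contract_eq)

lemma pp: "partial j (\<lambda>y. grad \<psi> y $ i) x
    = 4 * x $ i * x $ j * G'' ((norm x)\<^sup>2) + (if i = j then 2 * G' ((norm x)\<^sup>2) else 0)"
  using partial_partial_radial[OF G1 G2, of j i x] by (simp add: grad_def psi eta_contract_eq)

lemma div_eq: "divergence (grad \<psi>) x = real CARD('n) * a x + b x"
proof -
  have "divergence (grad \<psi>) x = (\<Sum>i\<in>UNIV. 4 * x $ i * x $ i * G'' ((norm x)\<^sup>2) + 2 * G' ((norm x)\<^sup>2))"
    unfolding divergence_def by (simp add: pp)
  also have "\<dots> = 4 * (\<Sum>i\<in>UNIV. x $ i * x $ i) * G'' ((norm x)\<^sup>2) + real CARD('n) * (2 * G' ((norm x)\<^sup>2))"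
    by (simp add: sum.distrib sum_distrib_left sum_distrib_right mult_ac)
  also have "(\<Sum>i\<in>UNIV. x $ i * x $ i) = (norm x)\<^sup>2"
    by (simp add: power2_norm_eq_inner inner_vec_def)
  finally show ?thesis by (simp add: a_def b_def)
qed

lemma tensor_eq: "tensor_contract y (grad \<psi>) x = a x * (norm y)\<^sup>2 + b x * ((y \<bullet> x)\<^sup>2 / (norm x)\<^sup>2)"
proof -
  have split: "(\<Sum>i\<in>UNIV. \<Sum>j\<in>UNIV. A i * A j * c) = (\<Sum>i\<in>UNIV. A i) * (\<Sum>j\<in>UNIV. A j) * c"
    for A :: "'n \<Rightarrow> real" and c by (unfold sum_product, unfold sum_distrib_right, rule refl)
  have diag: "(\<Sum>i\<in>UNIV. \<Sum>j\<in>UNIV. if j = i then y $ i * y $ j * a x else 0) = (\<Sum>i\<in>UNIV. y $ i * y $ i) * a x"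
    by (simp only: sum.delta finite_UNIV UNIV_I if_True sum_distrib_right finite)
  have "tensor_contract y (grad \<psi>) x
    = (\<Sum>i\<in>UNIV. \<Sum>j\<in>UNIV. (y $ i * x $ i) * (y $ j * x $ j) * (4 * G'' ((norm x)\<^sup>2))
        + (if j = i then y $ i * y $ j * a x else 0))"
    unfolding tensor_contract_def pp a_def by (intro sum.cong refl) (auto simp: algebra_simps)
  also have "\<dots> = (\<Sum>i\<in>UNIV. y $ i * x $ i) * (\<Sum>j\<in>UNIV. y $ j * x $ j) * (4 * G'' ((norm x)\<^sup>2))
      + (\<Sum>i\<in>UNIV. y $ i * y $ i) * a x"
    by (simp only: sum.distrib split diag)
  also have "\<dots> = (y \<bullet> x)\<^sup>2 * (4 * G'' ((norm x)\<^sup>2)) + (norm y)\<^sup>2 * a x"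
    by (simp add: power2_eq_square power2_norm_eq_inner[unfolded power2_eq_square] inner_vec_def)
  also have "(y \<bullet> x)\<^sup>2 * (4 * G'' ((norm x)\<^sup>2)) = b x * ((y \<bullet> x)\<^sup>2 / (norm x)\<^sup>2)"
    by (cases "x = 0") (simp_all add: b_def)
  finally show ?thesis by (simp add: mult.commute)
qed

lemma G_cont: "continuous_on UNIV G" "continuous_on UNIV G'"
  by (auto intro!: continuous_at_imp_continuous_on intro: DERIV_isCont[OF G1] DERIV_isCont[OF G2])

lemma ab_borel: "a \<in> borel_measurable borel" "b \<in> borel_measurable borel"
proof -
  have "continuous_on UNIV a" "continuous_on UNIV b"
    unfolding a_def[abs_def] b_def[abs_def]
    by (auto intro!: continuous_intros continuous_on_compose2[OF G_cont(2)] continuous_on_compose2[OF cont])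
  then show "a \<in> borel_measurable borel" "b \<in> borel_measurable borel"
    by (auto intro: borel_measurable_continuous_onI)
qed

lemma ab_bounded: obtains M where "M > 0" "\<And>x. \<bar>a x\<bar> \<le> M" "\<And>x. \<bar>b x\<bar> \<le> M"
proof -
  have "compact ((\<lambda>s. 2 * G' s) ` {0..R})" "compact ((\<lambda>s. 4 * s * G'' s) ` {0..R})"
    by (auto intro!: compact_continuous_image continuous_intros continuous_on_subset[OF cont]
        continuous_on_subset[OF G_cont(2)])
  then have "bounded ((\<lambda>s. 2 * G' s) ` {0..R})" "bounded ((\<lambda>s. 4 * s * G'' s) ` {0..R})"
    by (simp_all add: compact_imp_bounded)
  then obtain M1 M2 where "\<forall>y\<in>(\<lambda>s. 2 * G' s) ` {0..R}. norm y \<le> M1" "\<forall>y\<in>(\<lambda>s. 4 * s * G'' s) ` {0..R}. norm y \<le> M2"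
    unfolding bounded_iff by blast
  then have M: "\<And>s. 0 \<le> s \<Longrightarrow> s \<le> R \<Longrightarrow> \<bar>2 * G' s\<bar> \<le> M1" "\<And>s. 0 \<le> s \<Longrightarrow> s \<le> R \<Longrightarrow> \<bar>4 * s * G'' s\<bar> \<le> M2"
    by (simp_all add: ball_simps)
  have "\<bar>a x\<bar> \<le> max 1 (max M1 M2) \<and> \<bar>b x\<bar> \<le> max 1 (max M1 M2)" for x
  proof (cases "(norm x)\<^sup>2 \<le> R")
    case True
    have "\<bar>a x\<bar> \<le> M1" "\<bar>b x\<bar> \<le> M2" unfolding a_def b_def using M True by simp_all
    then show ?thesis by linarith
  next
    case False
    then show ?thesis using zero(2,3)[of "(norm x)\<^sup>2"] by (simp add: a_def b_def)
  qed
  then show ?thesis using that[of "max 1 (max M1 M2)"] by auto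
qed

lemma ab_zero: "(norm x)\<^sup>2 \<ge> R \<Longrightarrow> a x = 0 \<and> b x = 0"
  by (simp add: a_def b_def zero)

end

subsection \<open>Cut-off in time and space\<close>

text \<open>The step function stretched to fall from \<open>1\<close> to \<open>0\<close> on \<open>[\<tau>, 2\<tau>]\<close>, with its derivatives. It
  cuts off time as well as the squared radius.\<close>

definition tstep :: "real \<Rightarrow> real \<Rightarrow> real" where "tstep \<tau> t = step (t / \<tau> - 1)"
definition tstep' :: "real \<Rightarrow> real \<Rightarrow> real" where "tstep' \<tau> t = step' (t / \<tau> - 1) / \<tau>"
definition tstep'' :: "real \<Rightarrow> real \<Rightarrow> real" where "tstep'' \<tau> t = step'' (t / \<tau> - 1) / \<tau>\<^sup>2"

lemma tstep_deriv:
  assumes "\<tau> > 0"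
  shows "(tstep \<tau> has_real_derivative tstep' \<tau> t) (at t)" "(tstep' \<tau> has_real_derivative tstep'' \<tau> t) (at t)"
proof -
  have l: "((\<lambda>t. t / \<tau> - 1) has_real_derivative 1 / \<tau>) (at t)"
    using assms by (auto intro!: derivative_eq_intros)
  show "(tstep \<tau> has_real_derivative tstep' \<tau> t) (at t)"
    using DERIV_chain2[OF step_deriv l] by (simp add: tstep_def[abs_def] tstep'_def)
  show "(tstep' \<tau> has_real_derivative tstep'' \<tau> t) (at t)"
    using DERIV_cdivide[OF DERIV_chain2[OF step'_deriv l], of \<tau>]
    by (simp add: tstep'_def[abs_def] tstep''_def power2_eq_square)
qed

lemma tstep''_continuous: "continuous_on A (tstep'' \<tau>)"
  unfolding tstep''_def[abs_def] divide_inverse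
  by (intro continuous_intros continuous_on_compose2[OF step''_continuous[of UNIV]]) auto

lemma tstep_continuous: assumes "\<tau> > 0" shows "continuous_on A (tstep \<tau>)" "continuous_on A (tstep' \<tau>)"
  using tstep_deriv[OF assms] by (auto intro!: continuous_at_imp_continuous_on intro: DERIV_isCont)

lemma tstep_left: assumes "\<tau> > 0" "t \<le> \<tau>" shows "tstep \<tau> t = 1" "tstep' \<tau> t = 0" "tstep'' \<tau> t = 0"
proof -
  have "t / \<tau> - 1 \<le> 0" using assms by simp
  from step_left[OF this] show "tstep \<tau> t = 1" "tstep' \<tau> t = 0" "tstep'' \<tau> t = 0"
    by (simp_all only: tstep_def tstep'_def tstep''_def div_0)
qed

lemma tstep_right: assumes "\<tau> > 0" "t \<ge> 2 * \<tau>" shows "tstep \<tau> t = 0" "tstep' \<tau> t = 0" "tstep'' \<tau> t = 0"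
proof -
  have "t / \<tau> - 1 \<ge> 1" using assms by (simp add: pos_le_divide_eq)
  from step_right[OF this] show "tstep \<tau> t = 0" "tstep' \<tau> t = 0" "tstep'' \<tau> t = 0"
    by (simp_all only: tstep_def tstep'_def tstep''_def div_0)
qed

lemma tstep_range: "0 \<le> tstep \<tau> t" "tstep \<tau> t \<le> 1"
  by (simp_all add: tstep_def step_range)

lemma tstep_test_time:
  assumes "\<tau> > 0" shows "test_time (tstep \<tau>) (tstep' \<tau>)" "test_time (tstep' \<tau>) (tstep'' \<tau>)"
  unfolding test_time_def
proof (safe intro!: exI[of _ "2 * \<tau>"])
  fix t :: real
  show "(tstep \<tau> has_real_derivative tstep' \<tau> t) (at t within {0..})"
    "(tstep' \<tau> has_real_derivative tstep'' \<tau> t) (at t within {0..})"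
    using tstep_deriv[OF assms, of t] by (simp_all add: has_field_derivative_at_within)
  show "continuous_on {0..} (tstep' \<tau>)" "continuous_on {0..} (tstep'' \<tau>)"
    by (rule tstep_continuous(2)[OF assms], rule tstep''_continuous)
  assume "2 * \<tau> < t"
  then show "tstep \<tau> t = 0" "tstep' \<tau> t = 0" by (simp_all add: tstep_right[OF assms])
qed

text \<open>The function \<open>H\<close> cut off on \<open>[m, 2m]\<close>, with its first two derivatives.\<close>

definition cut0 :: "(real \<Rightarrow> real) \<Rightarrow> real \<Rightarrow> real \<Rightarrow> real" where
  "cut0 H m s = H s * tstep m s"
definition cut1 :: "(real \<Rightarrow> real) \<Rightarrow> (real \<Rightarrow> real) \<Rightarrow> real \<Rightarrow> real \<Rightarrow> real" where
  "cut1 H H' m s = H' s * tstep m s + H s * tstep' m s"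
definition cut2 :: "(real \<Rightarrow> real) \<Rightarrow> (real \<Rightarrow> real) \<Rightarrow> (real \<Rightarrow> real) \<Rightarrow> real \<Rightarrow> real \<Rightarrow> real" where
  "cut2 H H' H'' m s = H'' s * tstep m s + 2 * (H' s * tstep' m s) + H s * tstep'' m s"

lemma cut_deriv:
  assumes "m > 0" "(H has_real_derivative H' s) (at s)" "(H' has_real_derivative H'' s) (at s)"
  shows "(cut0 H m has_real_derivative cut1 H H' m s) (at s)"
    "(cut1 H H' m has_real_derivative cut2 H H' H'' m s) (at s)"
proof -
  note t = tstep_deriv[OF assms(1), of s]
  have c: "cut0 H m = (\<lambda>s. H s * tstep m s)" "cut1 H H' m = (\<lambda>s. H' s * tstep m s + H s * tstep' m s)"
    by (simp_all only: cut0_def[abs_def] cut1_def[abs_def])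
  have e: "cut1 H H' m s = H' s * tstep m s + tstep' m s * H s"
    "cut2 H H' H'' m s = H'' s * tstep m s + tstep' m s * H' s + (H' s * tstep' m s + tstep'' m s * H s)"
    by (simp_all add: cut1_def cut2_def algebra_simps)
  show "(cut0 H m has_real_derivative cut1 H H' m s) (at s)"
    unfolding e c(1) by (rule DERIV_mult[OF assms(2) t(1)])
  show "(cut1 H H' m has_real_derivative cut2 H H' H'' m s) (at s)"
    unfolding e(2) c(2)
    by (rule DERIV_add[OF DERIV_mult[OF assms(3) t(1)] DERIV_mult[OF assms(2) t(2)]])
qed

lemma cut_right:
  assumes "m > 0" "s \<ge> 2 * m" shows "cut0 H m s = 0" "cut1 H H' m s = 0" "cut2 H H' H'' m s = 0"
  using tstep_right[OF assms] by (simp_all add: cut0_def cut1_def cut2_def)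

lemma smooth_tstep: "smooth f \<Longrightarrow> smooth (\<lambda>x. tstep m (f x))"
proof -
  assume f: "smooth f"
  have "smooth (\<lambda>x. step (inverse m * f x + (-1)))"
    by (intro smooth_step smooth_add smooth_mult smooth_const f)
  then show ?thesis by (simp add: tstep_def divide_inverse mult.commute)
qed

lemma radial_poly:
  assumes m: "m > 0"
  shows "radial (cut0 (poly Q) m) (cut1 (poly Q) (poly (pderiv Q)) m)
    (cut2 (poly Q) (poly (pderiv Q)) (poly (pderiv (pderiv Q))) m) (2 * m)
    (\<lambda>x::real^'n::finite. cut0 (poly Q) m ((norm x)\<^sup>2))"
proof
  show "continuous_on UNIV (cut2 (poly Q) (poly (pderiv Q)) (poly (pderiv (pderiv Q))) m)"
    unfolding cut2_def[abs_def] by (intro continuous_intros tstep_continuous tstep''_continuous m)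
  show "smooth (\<lambda>x::real^'n. cut0 (poly Q) m ((norm x)\<^sup>2))"
    unfolding cut0_def by (intro smooth_mult smooth_poly smooth_tstep smooth_norm_sq)
qed (use m in \<open>auto simp: cut_right intro: cut_deriv[OF m poly_DERIV poly_DERIV]\<close>)

context solution begin

lemmas weak_momentum_test =
  sol_parts(5)[unfolded weak_momentum_def case_prod_unfold, rule_format, OF conjI]
lemmas weak_continuity_test =
  sol_parts(4)[unfolded weak_continuity_def case_prod_unfold, rule_format, OF conjI]

text \<open>The pressure law is not assumed measurable; measurability of \<open>p \<circ> \<rho>\<close> comes from the
  integrals in the momentum equation, tested with fields of divergence \<open>2 N\<close> on large balls.\<close>

lemma p_measurable: "(\<lambda>z. p (\<rho> (fst z) (snd z))) \<in> borel_measurable spacetime"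
proof -
  let ?Q = "[:0, 1::real:]"
  define \<psi> where "\<psi> n = (\<lambda>x::real^'n. cut0 (poly ?Q) (real (Suc n)) ((norm x)\<^sup>2))" for n
  let ?f = "\<lambda>n z. p (\<rho> (fst z) (snd z)) * divergence (grad (\<psi> n)) (fst z) * tstep (real (Suc n)) (snd z)"
  have m: "?f n \<in> borel_measurable spacetime" for n
  proof -
    interpret radial "cut0 (poly ?Q) (real (Suc n))" "cut1 (poly ?Q) (poly (pderiv ?Q)) (real (Suc n))"
      "cut2 (poly ?Q) (poly (pderiv ?Q)) (poly (pderiv (pderiv ?Q))) (real (Suc n))" "2 * real (Suc n)" "\<psi> n"
      unfolding \<psi>_def by (rule radial_poly) simp
    have "test_time (tstep (real (Suc n))) (tstep' (real (Suc n)))" by (rule tstep_test_time) simp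
    then have "integrable spacetime (?f n)"
      using weak_momentum_test[OF field] by blast
    then show ?thesis by (rule borel_measurable_integrable)
  qed
  have "(\<lambda>n. ?f n z) \<longlonglongrightarrow> p (\<rho> (fst z) (snd z)) * (real CARD('n) * 2) * 1" for z
  proof (rule tendsto_eventually)
    obtain n0 where n0: "max ((norm (fst z))\<^sup>2) (snd z) \<le> real n0" using real_arch_simple by blast
    show "\<forall>\<^sub>F n in sequentially. ?f n z = p (\<rho> (fst z) (snd z)) * (real CARD('n) * 2) * 1"
      unfolding eventually_sequentially
    proof (intro exI[of _ n0] allI impI)
      fix n assume "n0 \<le> n"
      then have le: "(norm (fst z))\<^sup>2 \<le> real (Suc n)" "snd z \<le> real (Suc n)" using n0 by auto
      interpret radial "cut0 (poly ?Q) (real (Suc n))" "cut1 (poly ?Q) (poly (pderiv ?Q)) (real (Suc n))"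
        "cut2 (poly ?Q) (poly (pderiv ?Q)) (poly (pderiv (pderiv ?Q))) (real (Suc n))" "2 * real (Suc n)" "\<psi> n"
        unfolding \<psi>_def by (rule radial_poly) simp
      have t: "tstep (real (Suc n)) ((norm (fst z))\<^sup>2) = 1" "tstep' (real (Suc n)) ((norm (fst z))\<^sup>2) = 0"
        "tstep'' (real (Suc n)) ((norm (fst z))\<^sup>2) = 0" "tstep (real (Suc n)) (snd z) = 1"
        using tstep_left[OF _ le(1)] tstep_left(1)[OF _ le(2)] by simp_all
      have "divergence (grad (\<psi> n)) (fst z) = real CARD('n) * 2"
        unfolding div_eq a_def b_def cut1_def cut2_def t by (simp add: pderiv_pCons)
      then show "?f n z = p (\<rho> (fst z) (snd z)) * (real CARD('n) * 2) * 1" using t(4) by simp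
    qed
  qed
  then have "(\<lambda>z. p (\<rho> (fst z) (snd z)) * (real CARD('n) * 2) * 1) \<in> borel_measurable spacetime"
    using m by (rule borel_measurable_LIMSEQ_real)
  then have "(\<lambda>z. p (\<rho> (fst z) (snd z)) * (real CARD('n) * 2) * 1 / (real CARD('n) * 2)) \<in> borel_measurable spacetime"
    by (intro borel_measurable_divide) simp_all
  then show ?thesis by simp
qed

lemma energy_measurable: "(\<lambda>z. energy (fst z) (snd z)) \<in> borel_measurable spacetime"
proof -
  note [measurable] = rho_measurable v_measurable g_measurable p_measurable
  show ?thesis unfolding energy_def by measurable
qed

lemma dens_measurable:
  assumes "a \<in> borel_measurable borel" "b \<in> borel_measurable borel"
  shows "(\<lambda>z. dens a b (fst z) (snd z)) \<in> borel_measurable spacetime"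
proof -
  note [measurable] = rho_measurable v_measurable g_measurable p_measurable space_measurable
    space_fun_measurable[OF assms(1)] space_fun_measurable[OF assms(2)]
  show ?thesis unfolding dens_def by measurable
qed

lemma nonneg_AE: "AE z in spacetime. \<rho> (fst z) (snd z) \<ge> 0 \<and> p (\<rho> (fst z) (snd z)) \<ge> 0"
  using sol_parts(7) by (simp add: case_prod_unfold)

lemma energy_nonneg: "AE z in spacetime. energy (fst z) (snd z) \<ge> 0"
  using nonneg_AE by eventually_elim (simp add: energy_def k)

end

context flow begin

lemma energy_integrable:
  assumes "T > 0"
  shows "integrable spacetime (\<lambda>z. energy (fst z) (snd z) * Bw w (fst z) * indicator {..T} (snd z))"
proof (rule integrableI_nonneg)
  have "(\<lambda>z::(real^'n) \<times> real. indicator {..T} (snd z) :: real) \<in> borel_measurable spacetime"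
    by (rule time_fun_measurable) simp
  then show "(\<lambda>z. energy (fst z) (snd z) * Bw w (fst z) * indicator {..T} (snd z)) \<in> borel_measurable spacetime"
    by (intro borel_measurable_times energy_measurable space_fun_measurable[OF Bw_borel[OF w]])
  show "AE z in spacetime. 0 \<le> energy (fst z) (snd z) * Bw w (fst z) * indicator {..T} (snd z)"
    using energy_nonneg by eventually_elim (simp add: Bw_ge[OF w])
  let ?F = "\<lambda>z. ennreal (energy (fst z) (snd z) *
    (w (norm (fst z)) + int1 w (norm (fst z)) / norm (fst z) + int2 w (norm (fst z)) / (norm (fst z))\<^sup>2))"
  have fin: "(\<integral>\<^sup>+ z. ?F z \<partial>lebesgue_on (UNIV \<times> {0..T})) < \<infinity>"
    using B \<open>T > 0\<close> unfolding condition_B_def energy_def case_prod_unfold by blast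
  have "(\<integral>\<^sup>+ z. ennreal (energy (fst z) (snd z) * Bw w (fst z) * indicator {..T} (snd z)) \<partial>spacetime)
    = (\<integral>\<^sup>+ z. ?F z * indicator {..T} (snd z) \<partial>spacetime)"
  proof (rule nn_integral_cong_AE)
    show "AE z in spacetime. ennreal (energy (fst z) (snd z) * Bw w (fst z) * indicator {..T} (snd z))
        = ?F z * indicator {..T} (snd z)"
      using AE_spacetime_space[OF AE_nonzero]
      by eventually_elim (auto simp: Bw_def wt_def indicator_def)
  qed
  also have "\<dots> = (\<integral>\<^sup>+ z. ?F z * indicator {..T} (snd z) * indicator (UNIV \<times> {0..}) z \<partial>lebesgue)"
    by (rule nn_integral_restrict_space) (simp add: spacetime_set)
  also have "\<dots> = (\<integral>\<^sup>+ z. ?F z * indicator (UNIV \<times> {0..T}) z \<partial>lebesgue)"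
    by (rule nn_integral_cong) (auto simp: indicator_def)
  also have "\<dots> = (\<integral>\<^sup>+ z. ?F z \<partial>lebesgue_on (UNIV \<times> {0..T}))"
    by (rule nn_integral_restrict_space[symmetric]) (simp add: spacetime_set)
  finally show "(\<integral>\<^sup>+ z. ennreal (energy (fst z) (snd z) * Bw w (fst z) * indicator {..T} (snd z)) \<partial>spacetime) < \<infinity>"
    using fin by simp
qed

end

lemma quad_bound:
  fixes x y :: "real^'n::finite" and a b :: real
  shows "\<bar>a * (norm y)\<^sup>2 + b * ((y \<bullet> x)\<^sup>2 / (norm x)\<^sup>2)\<bar> \<le> (\<bar>a\<bar> + \<bar>b\<bar>) * (norm y)\<^sup>2"
proof -
  have "(y \<bullet> x)\<^sup>2 / (norm x)\<^sup>2 \<le> (norm y)\<^sup>2"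
  proof (cases "x = 0")
    case False
    have "\<bar>y \<bullet> x\<bar>\<^sup>2 \<le> (norm y * norm x)\<^sup>2"
      by (rule power_mono[OF Cauchy_Schwarz_ineq2]) simp
    then show ?thesis using False by (simp add: field_simps power_mult_distrib)
  qed simp
  then have "\<bar>(y \<bullet> x)\<^sup>2 / (norm x)\<^sup>2\<bar> \<le> (norm y)\<^sup>2" by simp
  then have "\<bar>b * ((y \<bullet> x)\<^sup>2 / (norm x)\<^sup>2)\<bar> \<le> \<bar>b\<bar> * (norm y)\<^sup>2"
    unfolding abs_mult[of b] by (rule mult_left_mono) simp
  moreover have "\<bar>a * (norm y)\<^sup>2\<bar> = \<bar>a\<bar> * (norm y)\<^sup>2" by (simp add: abs_mult)
  ultimately show ?thesis unfolding distrib_right by linarith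
qed

context flow begin

lemma grad_part_bound:
  "\<bar>(norm (g x t))\<^sup>2 / 2 * (real CARD('n) * a + b) - (a * (norm (g x t))\<^sup>2 + b * ((x \<bullet> g x t)\<^sup>2 / (norm x)\<^sup>2))\<bar>
    \<le> (real CARD('n) + 2) * (\<bar>a\<bar> + \<bar>b\<bar>) * (norm (g x t))\<^sup>2"
proof -
  let ?g = "(norm (g x t))\<^sup>2"
  have n: "real CARD('n) \<ge> 1" by (simp add: Suc_le_eq)
  have "\<bar>real CARD('n) * a + b\<bar> \<le> real CARD('n) * \<bar>a\<bar> + \<bar>b\<bar>"
    using abs_triangle_ineq[of "real CARD('n) * a" b] by (simp add: abs_mult)
  also have "\<dots> \<le> real CARD('n) * (\<bar>a\<bar> + \<bar>b\<bar>)"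
    using mult_right_mono[OF n, of "\<bar>b\<bar>"] by (simp add: distrib_left)
  finally have 1: "\<bar>real CARD('n) * a + b\<bar> \<le> real CARD('n) * (\<bar>a\<bar> + \<bar>b\<bar>)" .
  have "\<bar>?g / 2 * (real CARD('n) * a + b)\<bar> = ?g / 2 * \<bar>real CARD('n) * a + b\<bar>" by (simp add: abs_mult)
  also have "\<dots> \<le> ?g * (real CARD('n) * (\<bar>a\<bar> + \<bar>b\<bar>))" using 1 by (intro mult_mono) auto
  finally have "\<bar>?g / 2 * (real CARD('n) * a + b)\<bar> \<le> real CARD('n) * (\<bar>a\<bar> + \<bar>b\<bar>) * ?g" by (simp add: mult_ac)
  moreover have "\<bar>a * ?g + b * ((x \<bullet> g x t)\<^sup>2 / (norm x)\<^sup>2)\<bar> \<le> (\<bar>a\<bar> + \<bar>b\<bar>) * ?g"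
    using quad_bound[of a "g x t" b x] by (simp add: inner_commute)
  moreover have "(\<bar>a\<bar> + \<bar>b\<bar>) * ?g \<ge> 0" by simp
  moreover have "(real CARD('n) + 2) * (\<bar>a\<bar> + \<bar>b\<bar>) * ?g
      = real CARD('n) * (\<bar>a\<bar> + \<bar>b\<bar>) * ?g + 2 * ((\<bar>a\<bar> + \<bar>b\<bar>) * ?g)" by (simp only: distrib_right mult.assoc)
  ultimately show ?thesis
    using abs_triangle_ineq4[of "?g / 2 * (real CARD('n) * a + b)" "a * ?g + b * ((x \<bullet> g x t)\<^sup>2 / (norm x)\<^sup>2)"]
    by linarith
qed

lemma dens_bound:
  assumes "\<rho> x t \<ge> 0" "p (\<rho> x t) \<ge> 0"
  shows "\<bar>dens a b x t\<bar> \<le> (real CARD('n) + 2) * (\<bar>a x\<bar> + \<bar>b x\<bar>) * energy x t"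
proof -
  let ?c = "(real CARD('n) + 2) * (\<bar>a x\<bar> + \<bar>b x\<bar>)"
  have n: "real CARD('n) \<ge> 1" by (simp add: Suc_le_eq)
  have c0: "\<bar>a x\<bar> + \<bar>b x\<bar> \<le> ?c"
    using mult_right_mono[of 1 "real CARD('n) + 2" "\<bar>a x\<bar> + \<bar>b x\<bar>"] by simp
  have "\<bar>\<rho> x t * (a x * (norm (v x t))\<^sup>2 + b x * ((v x t \<bullet> x)\<^sup>2 / (norm x)\<^sup>2))\<bar>
      \<le> \<rho> x t * ((\<bar>a x\<bar> + \<bar>b x\<bar>) * (norm (v x t))\<^sup>2)"
    unfolding abs_mult[of "\<rho> x t"] abs_of_nonneg[OF assms(1)]
    using quad_bound assms(1) by (rule mult_left_mono)
  also have "\<dots> \<le> \<rho> x t * (?c * (norm (v x t))\<^sup>2)"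
    using c0 assms by (intro mult_left_mono mult_right_mono) auto
  finally have 1: "\<bar>\<rho> x t * (a x * (norm (v x t))\<^sup>2 + b x * ((v x t \<bullet> x)\<^sup>2 / (norm x)\<^sup>2))\<bar>
      \<le> ?c * (\<rho> x t * (norm (v x t))\<^sup>2)" by (simp only: mult_ac)
  have "\<bar>real CARD('n) * a x + b x\<bar> \<le> real CARD('n) * \<bar>a x\<bar> + \<bar>b x\<bar>"
    using abs_triangle_ineq[of "real CARD('n) * a x" "b x"] by (simp add: abs_mult)
  also have "\<dots> \<le> ?c" using mult_right_mono[OF n, of "\<bar>b x\<bar>"] by (simp add: distrib_left distrib_right)
  finally have "p (\<rho> x t) * \<bar>real CARD('n) * a x + b x\<bar> \<le> p (\<rho> x t) * ?c" using assms by (rule_tac mult_left_mono)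
  then have 2: "\<bar>p (\<rho> x t) * (real CARD('n) * a x + b x)\<bar> \<le> ?c * p (\<rho> x t)"
    using assms by (simp add: abs_mult mult.commute)
  have 3: "\<bar>k * ((norm (g x t))\<^sup>2 / 2 * (real CARD('n) * a x + b x)
        - (a x * (norm (g x t))\<^sup>2 + b x * ((x \<bullet> g x t)\<^sup>2 / (norm x)\<^sup>2)))\<bar> \<le> ?c * (k * (norm (g x t))\<^sup>2)"
    unfolding abs_mult[of k] using mult_left_mono[OF grad_part_bound k] k by (simp add: mult_ac)
  have e: "?c * energy x t = ?c * (\<rho> x t * (norm (v x t))\<^sup>2) + ?c * p (\<rho> x t) + ?c * (k * (norm (g x t))\<^sup>2)"
    by (simp only: energy_def distrib_left[of ?c])
  show ?thesis unfolding dens_def e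
    by (rule order.trans[OF abs_triangle_ineq add_mono[OF order.trans[OF abs_triangle_ineq add_mono[OF 1 2]] 3]])
qed

lemma energy_dominated:
  assumes f: "f \<in> borel_measurable spacetime" and \<tau>: "\<tau> > 0"
    and le: "AE z in spacetime. \<bar>f z\<bar> \<le> c * (energy (fst z) (snd z) * Bw w (fst z) * indicator {..\<tau>} (snd z))"
  shows "integrable spacetime f"
proof (rule Bochner_Integration.integrable_bound[OF integrable_mult_right[OF energy_integrable[OF \<tau>]] f])
  show "AE z in spacetime. norm (f z) \<le> norm (c * (energy (fst z) (snd z) * Bw w (fst z) * indicator {..\<tau>} (snd z)))"
    using le by eventually_elim simp
qed

text \<open>The flux is dominated by the weighted energy as soon as the Hessian coefficients are
  dominated by the weight.\<close>

lemma dens_tstep_bound: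
  assumes \<tau>: "\<tau> > 0" and ab: "AE x in lebesgue. \<bar>a x\<bar> + \<bar>b x\<bar> \<le> c * Bw w x"
  shows "AE z in spacetime. \<bar>dens a b (fst z) (snd z) * tstep \<tau> (snd z)\<bar>
    \<le> (real CARD('n) + 2) * c * (energy (fst z) (snd z) * Bw w (fst z) * indicator {..2 * \<tau>} (snd z))"
  using nonneg_AE energy_nonneg AE_spacetime_space[OF ab]
proof eventually_elim
  case (elim z)
  let ?e = "energy (fst z) (snd z)"
  have "\<bar>dens a b (fst z) (snd z)\<bar> \<le> (real CARD('n) + 2) * (\<bar>a (fst z)\<bar> + \<bar>b (fst z)\<bar>) * ?e"
    using elim by (intro dens_bound) auto
  also have "\<dots> \<le> (real CARD('n) + 2) * (c * Bw w (fst z)) * ?e"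
    using elim by (intro mult_right_mono mult_left_mono) auto
  finally have d: "\<bar>dens a b (fst z) (snd z)\<bar> \<le> (real CARD('n) + 2) * c * (?e * Bw w (fst z))"
    by (simp only: mult_ac)
  show ?case
  proof (cases "snd z \<le> 2 * \<tau>")
    case True
    have "\<bar>dens a b (fst z) (snd z)\<bar> * tstep \<tau> (snd z) \<le> \<bar>dens a b (fst z) (snd z)\<bar> * 1"
      by (intro mult_left_mono tstep_range) simp
    then show ?thesis using d True by (simp add: abs_mult tstep_range)
  qed (simp add: tstep_right[OF \<tau>])
qed

lemma dens_integrable:
  assumes \<tau>: "\<tau> > 0" and m: "a \<in> borel_measurable borel" "b \<in> borel_measurable borel"
    and ab: "AE x in lebesgue. \<bar>a x\<bar> + \<bar>b x\<bar> \<le> c * Bw w x"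
  shows "integrable spacetime (\<lambda>z. dens a b (fst z) (snd z) * tstep \<tau> (snd z))"
proof (rule energy_dominated[OF _ _ dens_tstep_bound[OF \<tau> ab]])
  have "(\<lambda>z::(real^'n) \<times> real. tstep \<tau> (snd z)) \<in> borel_measurable spacetime"
    by (intro time_fun_measurable borel_measurable_continuous_onI tstep_continuous \<tau>)
  then show "(\<lambda>z. dens a b (fst z) (snd z) * tstep \<tau> (snd z)) \<in> borel_measurable spacetime"
    by (intro borel_measurable_times dens_measurable m)
qed (use \<tau> in simp)

lemma bounded_support_Bw:
  fixes a b :: "real^'n \<Rightarrow> real"
  assumes R: "R > 0" and M: "\<And>x. \<bar>a x\<bar> \<le> M" "\<And>x. \<bar>b x\<bar> \<le> M"
    and z: "\<And>x. (norm x)\<^sup>2 \<ge> R \<Longrightarrow> a x = 0 \<and> b x = 0"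
  shows "AE x in lebesgue. \<bar>a x\<bar> + \<bar>b x\<bar> \<le> 2 * M / w (sqrt R) * Bw w x"
    "AE x in lebesgue. \<bar>a x\<bar> * norm x \<le> 2 * M / w (sqrt R) * int1 w (norm x)"
proof -
  have w0: "w (sqrt R) > 0" using weight_pos[OF w] R by simp
  have M0: "M \<ge> 0" using M(1)[of 0] by linarith
  show "AE x in lebesgue. \<bar>a x\<bar> + \<bar>b x\<bar> \<le> 2 * M / w (sqrt R) * Bw w x"
    using AE_nonzero
  proof eventually_elim
    case (elim x)
    show ?case
    proof (cases "(norm x)\<^sup>2 \<le> R")
      case True
      have "\<bar>a x\<bar> + \<bar>b x\<bar> \<le> 2 * M" using M[of x] by linarith
      also have "\<dots> = 2 * M / w (sqrt R) * w (sqrt R)" using w0 by simp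
      also have "\<dots> \<le> 2 * M / w (sqrt R) * Bw w x"
        using weight_lower_bound(1)[OF w R elim True] M0 w0 by (intro mult_left_mono) auto
      finally show ?thesis .
    next
      case False
      then show ?thesis using z[of x] M0 w0 Bw_ge(4)[OF w, of x] by simp
    qed
  qed
  show "AE x in lebesgue. \<bar>a x\<bar> * norm x \<le> 2 * M / w (sqrt R) * int1 w (norm x)"
    using AE_nonzero
  proof eventually_elim
    case (elim x)
    show ?case
    proof (cases "(norm x)\<^sup>2 \<le> R")
      case True
      have "\<bar>a x\<bar> * norm x \<le> 2 * M * norm x" using M(1)[of x] M0 by (intro mult_right_mono) auto
      also have "\<dots> = 2 * M / w (sqrt R) * (w (sqrt R) * norm x)" using w0 by simp
      also have "\<dots> \<le> 2 * M / w (sqrt R) * int1 w (norm x)"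
        using weight_lower_bound(2)[OF w R elim True] M0 w0 by (intro mult_left_mono) auto
      finally show ?thesis .
    next
      case False
      then show ?thesis using z[of x] M0 w0 int1_nonneg[OF w, of "norm x"] by simp
    qed
  qed
qed

text \<open>The virial identity for a smooth radial potential of compact support. The term
  \<open>\<rho> v \<bullet> \<nabla>\<psi> \<xi>'\<close> of the momentum equation is replaced with the help of the continuity equation,
  whose boundary term vanishes because \<open>\<xi>'(0) = 0\<close>.\<close>

lemma radial_identity:
  assumes rad: "radial G G' G'' R (\<psi> :: real^'n \<Rightarrow> real)" and \<tau>: "\<tau> > 0"
  shows "(\<integral>x. \<rho>\<^sub>0 x * (v\<^sub>0 x \<bullet> x) * radial.a G' x \<partial>lebesgue)
      + (\<integral>z. dens (radial.a G') (radial.b G'') (fst z) (snd z) * tstep \<tau> (snd z) \<partial>spacetime)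
      = (\<integral>z. \<rho> (fst z) (snd z) * \<psi> (fst z) * tstep'' \<tau> (snd z) \<partial>spacetime)" (is ?id)
    and "integrable spacetime (\<lambda>z. \<rho> (fst z) (snd z) * \<psi> (fst z) * tstep'' \<tau> (snd z))" (is ?int)
proof -
  interpret radial G G' G'' R \<psi> by (rule rad)
  let ?\<phi> = "grad \<psi>" and ?\<xi> = "tstep \<tau>" and ?\<xi>' = "tstep' \<tau>" and ?\<xi>'' = "tstep'' \<tau>"
  let ?T = "\<lambda>y x. a x * (norm y)\<^sup>2 + b x * ((y \<bullet> x)\<^sup>2 / (norm x)\<^sup>2)" and ?D = "\<lambda>x. real CARD('n) * a x + b x"
  note tt = tstep_test_time[OF \<tau>]
  have v0: "?\<xi> 0 = 1" "?\<xi>' 0 = 0" using tstep_left[OF \<tau>, of 0] \<tau> by auto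
  have c: "integrable spacetime (\<lambda>z. \<rho> (fst z) (snd z) * \<psi> (fst z) * ?\<xi>'' (snd z))"
    "?\<xi>' 0 * (\<integral>x. \<rho>\<^sub>0 x * \<psi> x \<partial>lebesgue)
      + (\<integral>z. \<rho> (fst z) (snd z) * \<psi> (fst z) * ?\<xi>'' (snd z) \<partial>spacetime)
      + (\<integral>z. \<rho> (fst z) (snd z) * (v (fst z) (snd z) \<bullet> ?\<phi> (fst z)) * ?\<xi>' (snd z) \<partial>spacetime) = 0"
    using weak_continuity_test[OF test tt(2)] by blast+
  show ?int by (rule c(1))
  have m: "integrable spacetime (\<lambda>z. \<rho> (fst z) (snd z) * tensor_contract (v (fst z) (snd z)) ?\<phi> (fst z) * ?\<xi> (snd z))"
    "integrable spacetime (\<lambda>z. p (\<rho> (fst z) (snd z)) * divergence ?\<phi> (fst z) * ?\<xi> (snd z))"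
    "integrable spacetime (\<lambda>z. k * (\<rho> (fst z) (snd z) * (g (fst z) (snd z) \<bullet> ?\<phi> (fst z)) * ?\<xi> (snd z)))"
    "?\<xi> 0 * (\<integral>x. \<rho>\<^sub>0 x * (v\<^sub>0 x \<bullet> ?\<phi> x) \<partial>lebesgue)
      + (\<integral>z. \<rho> (fst z) (snd z) * (v (fst z) (snd z) \<bullet> ?\<phi> (fst z)) * ?\<xi>' (snd z) \<partial>spacetime)
      + (\<integral>z. \<rho> (fst z) (snd z) * tensor_contract (v (fst z) (snd z)) ?\<phi> (fst z) * ?\<xi> (snd z) \<partial>spacetime)
      = - (\<integral>z. p (\<rho> (fst z) (snd z)) * divergence ?\<phi> (fst z) * ?\<xi> (snd z) \<partial>spacetime)
        - k * (\<integral>z. \<rho> (fst z) (snd z) * (g (fst z) (snd z) \<bullet> ?\<phi> (fst z)) * ?\<xi> (snd z) \<partial>spacetime)"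
    using weak_momentum_test[OF field tt(1)] by blast+
  let ?P = "\<lambda>z. (norm (g (fst z) (snd z)))\<^sup>2 / 2 * ?D (fst z)
    - (a (fst z) * (norm (g (fst z) (snd z)))\<^sup>2 + b (fst z) * ((fst z \<bullet> g (fst z) (snd z))\<^sup>2 / (norm (fst z))\<^sup>2))"
  obtain M where M: "M > 0" "\<And>x. \<bar>a x\<bar> \<le> M" "\<And>x. \<bar>b x\<bar> \<le> M" using ab_bounded by blast
  define C where "C = 2 * M / w (sqrt R)"
  have C0: "C \<ge> 0" using M(1) weight_pos[OF w, of "sqrt R"] R by (simp add: C_def)
  have ab: "AE x in lebesgue. \<bar>a x\<bar> + \<bar>b x\<bar> \<le> C * Bw w x"
    unfolding C_def by (rule bounded_support_Bw(1)[OF R M(2,3) ab_zero])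
  have Pmeas: "(\<lambda>z. ?P z * ?\<xi> (snd z)) \<in> borel_measurable spacetime"
  proof -
    have t: "(\<lambda>z::(real^'n) \<times> real. tstep \<tau> (snd z)) \<in> borel_measurable spacetime"
      by (intro time_fun_measurable borel_measurable_continuous_onI tstep_continuous \<tau>)
    note [measurable] = g_measurable space_measurable t space_fun_measurable[OF ab_borel(1)] space_fun_measurable[OF ab_borel(2)]
    show ?thesis by measurable
  qed
  have pois: "k * (\<integral>z. \<rho> (fst z) (snd z) * (g (fst z) (snd z) \<bullet> ?\<phi> (fst z)) * ?\<xi> (snd z) \<partial>spacetime)
      = (\<integral>z. k * ?P z * ?\<xi> (snd z) \<partial>spacetime) \<and> integrable spacetime (\<lambda>z. k * ?P z * ?\<xi> (snd z))"
  proof (cases "k = 0")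
    case False
    \<comment> \<open>Only for \<open>k > 0\<close> does the energy control \<open>|\<nabla>\<Phi>|\<^sup>2\<close>; for \<open>k = 0\<close> there is nothing to show.\<close>
    then have k0: "k > 0" using k by simp
    have Pi: "integrable spacetime (\<lambda>z. ?P z * ?\<xi> (snd z))"
    proof (rule energy_dominated[OF Pmeas])
      show "AE z in spacetime. \<bar>?P z * ?\<xi> (snd z)\<bar> \<le> (real CARD('n) + 2) * C / k *
          (energy (fst z) (snd z) * Bw w (fst z) * indicator {..2 * \<tau>} (snd z))"
        using nonneg_AE AE_spacetime_space[OF ab]
      proof eventually_elim
        case (elim z)
        let ?e = "energy (fst z) (snd z)"
        have "(norm (g (fst z) (snd z)))\<^sup>2 * k \<le> ?e" using elim by (simp add: energy_def mult.commute)
        then have ge: "(norm (g (fst z) (snd z)))\<^sup>2 \<le> ?e / k" using k0 by (simp only: pos_le_divide_eq)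
        have "\<bar>?P z\<bar> \<le> (real CARD('n) + 2) * (\<bar>a (fst z)\<bar> + \<bar>b (fst z)\<bar>) * (norm (g (fst z) (snd z)))\<^sup>2"
          by (rule grad_part_bound)
        also have "\<dots> \<le> (real CARD('n) + 2) * (C * Bw w (fst z)) * (?e / k)"
          using elim ge C0 Bw_ge(4)[OF w] by (intro mult_mono mult_nonneg_nonneg) auto
        finally have d: "\<bar>?P z\<bar> \<le> (real CARD('n) + 2) * C / k * (?e * Bw w (fst z))"
          by (simp add: mult_ac)
        show ?case
        proof (cases "snd z \<le> 2 * \<tau>")
          case True
          have "\<bar>?P z\<bar> * ?\<xi> (snd z) \<le> \<bar>?P z\<bar> * 1" by (intro mult_left_mono tstep_range) simp
          then show ?thesis using d True by (simp add: abs_mult[of _ "?\<xi> (snd z)"] tstep_range)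
        qed (simp add: tstep_right[OF \<tau>])
      qed
    qed (use \<tau> in simp)
    have eq: "(norm (g (fst z) (snd z)))\<^sup>2 / 2 * divergence ?\<phi> (fst z) - tensor_contract (g (fst z) (snd z)) ?\<phi> (fst z)
      = ?P z" for z :: "(real^'n) \<times> real"
      by (simp only: div_eq tensor_eq inner_commute)
    have "integrable spacetime (\<lambda>z. inverse k * (k * (\<rho> (fst z) (snd z) * (g (fst z) (snd z) \<bullet> ?\<phi> (fst z)) * ?\<xi> (snd z))))"
      by (rule integrable_mult_right[OF m(3)])
    then have mi: "integrable spacetime (\<lambda>z. \<rho> (fst z) (snd z) * (g (fst z) (snd z) \<bullet> ?\<phi> (fst z)) * ?\<xi> (snd z))"
      using k0 by (simp only: mult.assoc[symmetric]) simp
    have "(\<integral>z. \<rho> (fst z) (snd z) * (g (fst z) (snd z) \<bullet> ?\<phi> (fst z)) * ?\<xi> (snd z) \<partial>spacetime)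
      = (\<integral>z. ?P z * ?\<xi> (snd z) \<partial>spacetime)"
      using poisson_spacetime[OF sol_parts(3) field sol_parts(6), of ?\<xi>] mi Pi
      unfolding case_prod_unfold eq by blast
    then show ?thesis using Pi by (simp only: mult.assoc integral_mult_right_zero integrable_mult_right)
  qed simp
  have dens_eq: "dens a b (fst z) (snd z) * ?\<xi> (snd z)
    = \<rho> (fst z) (snd z) * tensor_contract (v (fst z) (snd z)) ?\<phi> (fst z) * ?\<xi> (snd z)
      + p (\<rho> (fst z) (snd z)) * divergence ?\<phi> (fst z) * ?\<xi> (snd z) + k * ?P z * ?\<xi> (snd z)" for z
    unfolding dens_def div_eq tensor_eq by (simp only: distrib_right)
  have "(\<integral>z. dens a b (fst z) (snd z) * ?\<xi> (snd z) \<partial>spacetime)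
    = (\<integral>z. \<rho> (fst z) (snd z) * tensor_contract (v (fst z) (snd z)) ?\<phi> (fst z) * ?\<xi> (snd z) \<partial>spacetime)
      + (\<integral>z. p (\<rho> (fst z) (snd z)) * divergence ?\<phi> (fst z) * ?\<xi> (snd z) \<partial>spacetime)
      + (\<integral>z. k * ?P z * ?\<xi> (snd z) \<partial>spacetime)"
    unfolding dens_eq
    by (simp only: Bochner_Integration.integral_add Bochner_Integration.integrable_add m(1,2) pois)
  moreover have "(\<integral>x. \<rho>\<^sub>0 x * (v\<^sub>0 x \<bullet> ?\<phi> x) \<partial>lebesgue) = (\<integral>x. \<rho>\<^sub>0 x * (v\<^sub>0 x \<bullet> x) * a x \<partial>lebesgue)"
    by (simp add: grad_eq mult_ac)
  ultimately show ?id using c(2) m(4) pois unfolding v0 by simp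
qed

end

subsection \<open>Twice continuously differentiable radial potentials\<close>

lemma ex_pderiv_eq: "\<exists>Q. pderiv Q = (P :: real poly)"
proof -
  have psum: "pderiv (\<Sum>i\<in>A. f i) = (\<Sum>i\<in>A. pderiv (f i))" for A :: "nat set" and f :: "nat \<Rightarrow> real poly"
    by (induction A rule: infinite_finite_induct) (simp_all add: pderiv_add)
  have "pderiv (monom (c / real (Suc i)) (Suc i)) = monom c i" for c i
    by (simp add: pderiv_monom)
  then have "pderiv (\<Sum>i\<le>degree P. monom (coeff P i / real (Suc i)) (Suc i)) = (\<Sum>i\<le>degree P. monom (coeff P i) i)"
    by (simp only: psum)
  then show ?thesis using poly_as_sum_of_monoms[of P] by metis
qed

lemma ex_pderiv_eq_value: "\<exists>Q. pderiv Q = (P :: real poly) \<and> poly Q 0 = c"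
proof -
  obtain Q where Q: "pderiv Q = P" using ex_pderiv_eq by blast
  have "pderiv (Q + [:c - poly Q 0:]) = P" by (simp add: pderiv_add Q pderiv_pCons)
  then show ?thesis by (intro exI[of _ "Q + [:c - poly Q 0:]"]) simp
qed

lemma deriv_close:
  fixes f g :: "real \<Rightarrow> real"
  assumes "\<And>s. s \<in> {0..L} \<Longrightarrow> (f has_real_derivative f' s) (at s)" "\<And>s. s \<in> {0..L} \<Longrightarrow> (g has_real_derivative g' s) (at s)"
    and close: "\<And>s. s \<in> {0..L} \<Longrightarrow> \<bar>f' s - g' s\<bar> \<le> e" and "f 0 = g 0" "s \<in> {0..L}"
  shows "\<bar>f s - g s\<bar> \<le> e * L"
proof -
  have "norm ((f s - g s) - (f 0 - g 0)) \<le> e * norm (s - 0)"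
  proof (rule field_differentiable_bound[of "{0..L}" "\<lambda>s. f s - g s" "\<lambda>s. f' s - g' s"])
    show "((\<lambda>s. f s - g s) has_field_derivative f' z - g' z) (at z within {0..L})" if "z \<in> {0..L}" for z
      using DERIV_diff[OF assms(1)[OF that] assms(2)[OF that]] by (rule has_field_derivative_at_within)
  qed (use assms in auto)
  also have "\<dots> \<le> e * L"
  proof -
    have "e \<ge> 0" using close[OF \<open>s \<in> {0..L}\<close>] by linarith
    then show ?thesis using \<open>s \<in> {0..L}\<close> by (intro mult_left_mono) auto
  qed
  finally show ?thesis using \<open>f 0 = g 0\<close> by simp
qed

text \<open>Approximate the second derivative by a polynomial and integrate twice.\<close>

lemma poly_C2_approx:
  fixes H H' H'' :: "real \<Rightarrow> real"
  assumes H: "\<And>s. (H has_real_derivative H' s) (at s)" "\<And>s. (H' has_real_derivative H'' s) (at s)"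
    and cont: "continuous_on UNIV H''" and "L > 0" "e > 0"
  shows "\<exists>Q. \<forall>s\<in>{0..L}. \<bar>poly Q s - H s\<bar> \<le> e \<and> \<bar>poly (pderiv Q) s - H' s\<bar> \<le> e
    \<and> \<bar>poly (pderiv (pderiv Q)) s - H'' s\<bar> \<le> e"
proof -
  define d where "d = e / (1 + L + L * L)"
  have L2: "1 + L + L * L > 0" using \<open>L > 0\<close> by (intro add_pos_pos) auto
  then have d: "d > 0" using \<open>e > 0\<close> by (simp add: d_def)
  have "d * (1 + L + L * L) = e" using L2 by (simp add: d_def)
  then have sum: "d + d * L + d * L * L = e" by (simp add: distrib_left mult.assoc)
  have pos: "d * L > 0" "d * L * L > 0" using d \<open>L > 0\<close> by simp_all
  have le: "d \<le> e" "d * L \<le> e" "d * L * L \<le> e" using sum pos d by linarith+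
  obtain q where q: "real_polynomial_function q" "\<And>s. s \<in> {0..L} \<Longrightarrow> \<bar>H'' s - q s\<bar> < d"
    using Stone_Weierstrass_real_polynomial_function[of "{0..L}" H'' d] cont d continuous_on_subset by blast
  obtain a n where an: "q = (\<lambda>x. \<Sum>i\<le>n. a i * x ^ i)" using q(1) real_polynomial_function_iff_sum by blast
  define P2 where "P2 = (\<Sum>i\<le>n. monom (a i) i)"
  have P2: "poly P2 s = q s" for s by (simp add: P2_def an poly_sum poly_monom)
  obtain P1 where P1: "pderiv P1 = P2" "poly P1 0 = H' 0" using ex_pderiv_eq_value by blast
  obtain Q where Q: "pderiv Q = P1" "poly Q 0 = H 0" using ex_pderiv_eq_value by blast
  have 2: "\<bar>poly P2 s - H'' s\<bar> \<le> d" if "s \<in> {0..L}" for s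
    using q(2)[OF that] by (simp add: P2 abs_minus_commute)
  have 1: "\<bar>poly P1 s - H' s\<bar> \<le> d * L" if "s \<in> {0..L}" for s
    by (rule deriv_close[where f="poly P1" and f'="poly P2" and g=H' and g'=H'', OF _ H(2) 2 P1(2) that])
       (use poly_DERIV[of P1] in \<open>simp add: P1(1)\<close>)
  have 0: "\<bar>poly Q s - H s\<bar> \<le> d * L * L" if "s \<in> {0..L}" for s
    by (rule deriv_close[where f="poly Q" and f'="poly P1" and g=H and g'=H', OF _ H(1) 1 Q(2) that])
       (use poly_DERIV[of Q] in \<open>simp add: Q(1)\<close>)
  show ?thesis
  proof (intro exI[of _ Q] ballI conjI)
    fix s assume s: "s \<in> {0..L}"
    show "\<bar>poly Q s - H s\<bar> \<le> e" using 0[OF s] le(3) by linarith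
    show "\<bar>poly (pderiv Q) s - H' s\<bar> \<le> e" using 1[OF s] le(2) by (simp add: Q(1))
    show "\<bar>poly (pderiv (pderiv Q)) s - H'' s\<bar> \<le> e" using 2[OF s] le(1) by (simp add: Q(1) P1(1))
  qed
qed

lemma tstep_derivs_bounded:
  obtains B where "B > 0" "\<And>\<tau> t. \<tau> > 0 \<Longrightarrow> \<bar>tstep' \<tau> t\<bar> \<le> B / \<tau>" "\<And>\<tau> t. \<tau> > 0 \<Longrightarrow> \<bar>tstep'' \<tau> t\<bar> \<le> B / \<tau>\<^sup>2"
proof -
  obtain B where B: "B > 0" "\<And>y. \<bar>step' y\<bar> \<le> B" "\<And>y. \<bar>step'' y\<bar> \<le> B" using step_derivs_bounded by blast
  show ?thesis
  proof (rule that[OF B(1)])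
    fix \<tau> t :: real assume "\<tau> > 0"
    then show "\<bar>tstep' \<tau> t\<bar> \<le> B / \<tau>" "\<bar>tstep'' \<tau> t\<bar> \<le> B / \<tau>\<^sup>2"
      unfolding tstep'_def tstep''_def abs_divide using B by (simp_all add: divide_right_mono)
  qed
qed

lemma bounded_on_interval:
  fixes f :: "real \<Rightarrow> real"
  assumes "continuous_on UNIV f" obtains K where "\<And>s. s \<in> {0..L} \<Longrightarrow> \<bar>f s\<bar> \<le> K"
proof -
  have "bounded (f ` {0..L})"
    by (intro compact_imp_bounded compact_continuous_image continuous_on_subset[OF assms]) auto
  then obtain K where "\<forall>y\<in>f ` {0..L}. norm y \<le> K" unfolding bounded_iff by blast
  then show ?thesis using that[of K] by simp
qed

abbreviation (input) sqn :: "real^'n::finite \<Rightarrow> real" where "sqn x \<equiv> (norm x)\<^sup>2"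

lemma sqn_comp_borel:
  assumes "continuous_on UNIV f" shows "(\<lambda>x::real^'n::finite. f (sqn x)) \<in> borel_measurable borel"
  by (intro borel_measurable_continuous_onI continuous_on_compose2[OF assms] continuous_intros) auto

context flow begin

lemma moment_integrable: "integrable lebesgue (\<lambda>x. \<rho>\<^sub>0 x * norm (v\<^sub>0 x) * int1 w (norm x))"
proof (rule integrableI_nonneg)
  have m: "\<rho>\<^sub>0 \<in> borel_measurable lebesgue" "v\<^sub>0 \<in> borel_measurable lebesgue"
    using init by (simp_all add: initial_data_def)
  have "(\<lambda>x::real^'n. int1 w (norm x)) \<in> borel_measurable lebesgue"
    using int1_borel[OF w] by (intro measurable_completion) simp
  then show "(\<lambda>x. \<rho>\<^sub>0 x * norm (v\<^sub>0 x) * int1 w (norm x)) \<in> borel_measurable lebesgue"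
    by (intro borel_measurable_times measurable_compose[OF m(2) borel_measurable_norm] m(1))
  have "AE x in lebesgue. \<rho>\<^sub>0 x \<ge> 0" using init by (simp add: initial_data_def)
  then show "AE x in lebesgue. 0 \<le> \<rho>\<^sub>0 x * norm (v\<^sub>0 x) * int1 w (norm x)"
    by eventually_elim (simp add: int1_nonneg[OF w])
qed (rule mom)

text \<open>Passage to the limit on the left-hand side of the virial identity.\<close>

lemma dens_tendsto:
  assumes \<tau>: "\<tau> > 0"
    and m: "\<And>n. an n \<in> borel_measurable borel" "\<And>n. bn n \<in> borel_measurable borel"
      "a \<in> borel_measurable borel" "b \<in> borel_measurable borel"
    and bd: "\<And>n. AE x in lebesgue. \<bar>an n x\<bar> + \<bar>bn n x\<bar> \<le> c * Bw w x"
      "\<And>n. AE x in lebesgue. \<bar>an n x\<bar> * norm x \<le> c * int1 w (norm x)"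
    and lim: "AE x in lebesgue. (\<lambda>n. an n x) \<longlonglongrightarrow> a x" "AE x in lebesgue. (\<lambda>n. bn n x) \<longlonglongrightarrow> b x"
  shows "(\<lambda>n. \<integral>x. \<rho>\<^sub>0 x * (v\<^sub>0 x \<bullet> x) * an n x \<partial>lebesgue) \<longlonglongrightarrow> (\<integral>x. \<rho>\<^sub>0 x * (v\<^sub>0 x \<bullet> x) * a x \<partial>lebesgue)"
    and "(\<lambda>n. \<integral>z. dens (an n) (bn n) (fst z) (snd z) * tstep \<tau> (snd z) \<partial>spacetime)
      \<longlonglongrightarrow> (\<integral>z. dens a b (fst z) (snd z) * tstep \<tau> (snd z) \<partial>spacetime)"
proof -
  have m0: "\<rho>\<^sub>0 \<in> borel_measurable lebesgue" "v\<^sub>0 \<in> borel_measurable lebesgue"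
    using init by (simp_all add: initial_data_def)
  have idm: "(\<lambda>x::real^'n. x) \<in> borel_measurable lebesgue" by (intro measurable_completion) simp
  have r0: "AE x in lebesgue. \<rho>\<^sub>0 x \<ge> 0" using init by (simp add: initial_data_def)
  have ml: "h \<in> borel_measurable borel \<Longrightarrow> h \<in> borel_measurable lebesgue" for h :: "real^'n \<Rightarrow> real"
    by (intro measurable_completion) simp
  show "(\<lambda>n. \<integral>x. \<rho>\<^sub>0 x * (v\<^sub>0 x \<bullet> x) * an n x \<partial>lebesgue) \<longlonglongrightarrow> (\<integral>x. \<rho>\<^sub>0 x * (v\<^sub>0 x \<bullet> x) * a x \<partial>lebesgue)"
  proof (rule integral_dominated_convergence)
    show "(\<lambda>x. \<rho>\<^sub>0 x * (v\<^sub>0 x \<bullet> x) * a x) \<in> borel_measurable lebesgue"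
      "(\<lambda>x. \<rho>\<^sub>0 x * (v\<^sub>0 x \<bullet> x) * an n x) \<in> borel_measurable lebesgue" for n
      by (intro borel_measurable_times borel_measurable_inner m0 idm ml m)+
    show "integrable lebesgue (\<lambda>x. c * (\<rho>\<^sub>0 x * norm (v\<^sub>0 x) * int1 w (norm x)))"
      by (intro integrable_mult_right moment_integrable)
    show "AE x in lebesgue. (\<lambda>n. \<rho>\<^sub>0 x * (v\<^sub>0 x \<bullet> x) * an n x) \<longlonglongrightarrow> \<rho>\<^sub>0 x * (v\<^sub>0 x \<bullet> x) * a x"
      using lim(1) by eventually_elim (intro tendsto_intros)
    show "AE x in lebesgue. norm (\<rho>\<^sub>0 x * (v\<^sub>0 x \<bullet> x) * an n x) \<le> c * (\<rho>\<^sub>0 x * norm (v\<^sub>0 x) * int1 w (norm x))" for n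
      using bd(2)[of n] r0
    proof eventually_elim
      case (elim x)
      have "norm (\<rho>\<^sub>0 x * (v\<^sub>0 x \<bullet> x) * an n x) = \<rho>\<^sub>0 x * \<bar>v\<^sub>0 x \<bullet> x\<bar> * \<bar>an n x\<bar>"
        using elim by (simp add: abs_mult)
      also have "\<dots> \<le> \<rho>\<^sub>0 x * (norm (v\<^sub>0 x) * norm x) * \<bar>an n x\<bar>"
        using elim by (intro mult_right_mono mult_left_mono Cauchy_Schwarz_ineq2) auto
      also have "\<dots> = (\<rho>\<^sub>0 x * norm (v\<^sub>0 x)) * (\<bar>an n x\<bar> * norm x)" by (simp add: mult_ac)
      also have "\<dots> \<le> (\<rho>\<^sub>0 x * norm (v\<^sub>0 x)) * (c * int1 w (norm x))"
        using elim by (intro mult_left_mono) auto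
      finally show ?case by (simp add: mult_ac)
    qed
  qed
  have tm: "(\<lambda>z::(real^'n) \<times> real. tstep \<tau> (snd z)) \<in> borel_measurable spacetime"
    by (intro time_fun_measurable borel_measurable_continuous_onI tstep_continuous \<tau>)
  show "(\<lambda>n. \<integral>z. dens (an n) (bn n) (fst z) (snd z) * tstep \<tau> (snd z) \<partial>spacetime)
      \<longlonglongrightarrow> (\<integral>z. dens a b (fst z) (snd z) * tstep \<tau> (snd z) \<partial>spacetime)"
  proof (rule integral_dominated_convergence)
    show "(\<lambda>z. dens a b (fst z) (snd z) * tstep \<tau> (snd z)) \<in> borel_measurable spacetime"
      "(\<lambda>z. dens (an n) (bn n) (fst z) (snd z) * tstep \<tau> (snd z)) \<in> borel_measurable spacetime" for n
      by (intro borel_measurable_times dens_measurable m tm)+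
    show "integrable spacetime (\<lambda>z. (real CARD('n) + 2) * c * (energy (fst z) (snd z) * Bw w (fst z) * indicator {..2 * \<tau>} (snd z)))"
      using \<tau> by (intro integrable_mult_right energy_integrable) simp
    show "AE z in spacetime. (\<lambda>n. dens (an n) (bn n) (fst z) (snd z) * tstep \<tau> (snd z))
        \<longlonglongrightarrow> dens a b (fst z) (snd z) * tstep \<tau> (snd z)"
      using AE_spacetime_space[OF lim(1)] AE_spacetime_space[OF lim(2)]
    proof eventually_elim
      case (elim z)
      then show ?case unfolding dens_def by (intro tendsto_intros)
    qed
    show "AE z in spacetime. norm (dens (an n) (bn n) (fst z) (snd z) * tstep \<tau> (snd z))
        \<le> (real CARD('n) + 2) * c * (energy (fst z) (snd z) * Bw w (fst z) * indicator {..2 * \<tau>} (snd z))" for n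
      using dens_tstep_bound[OF \<tau> bd(1)[of n]] by (simp only: real_norm_def)
  qed
qed

text \<open>The virial identity for potentials \<open>H(|x|\<^sup>2)\<close> with \<open>H\<close> twice continuously differentiable,
  multiplied by the smooth cut-off, as a limit of polynomial \<open>H\<close>.\<close>

lemma C2_identity:
  assumes m: "m > 0" and \<tau>: "\<tau> > 0"
    and H: "\<And>s. (H has_real_derivative H' s) (at s)" "\<And>s. (H' has_real_derivative H'' s) (at s)"
      "continuous_on UNIV H''"
  shows "(\<integral>x. \<rho>\<^sub>0 x * (v\<^sub>0 x \<bullet> x) * (2 * cut1 H H' m (sqn x)) \<partial>lebesgue)
      + (\<integral>z. dens (\<lambda>x. 2 * cut1 H H' m (sqn x)) (\<lambda>x. 4 * sqn x * cut2 H H' H'' m (sqn x)) (fst z) (snd z)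
          * tstep \<tau> (snd z) \<partial>spacetime)
      = (\<integral>z. \<rho> (fst z) (snd z) * cut0 H m (sqn (fst z)) * tstep'' \<tau> (snd z) \<partial>spacetime)"
    and "integrable spacetime (\<lambda>z. \<rho> (fst z) (snd z) * cut0 H m (sqn (fst z)) * tstep'' \<tau> (snd z))"
proof -
  define L where "L = 2 * m"
  have L: "L > 0" using m by (simp add: L_def)
  have "\<forall>n. \<exists>Q. \<forall>s\<in>{0..L}. \<bar>poly Q s - H s\<bar> \<le> inverse (real (Suc n)) \<and> \<bar>poly (pderiv Q) s - H' s\<bar> \<le> inverse (real (Suc n))
    \<and> \<bar>poly (pderiv (pderiv Q)) s - H'' s\<bar> \<le> inverse (real (Suc n))"
    by (intro allI poly_C2_approx H L) simp
  then obtain Q where Q: "\<And>n s. s \<in> {0..L} \<Longrightarrow> \<bar>poly (Q n) s - H s\<bar> \<le> inverse (real (Suc n))"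
    "\<And>n s. s \<in> {0..L} \<Longrightarrow> \<bar>poly (pderiv (Q n)) s - H' s\<bar> \<le> inverse (real (Suc n))"
    "\<And>n s. s \<in> {0..L} \<Longrightarrow> \<bar>poly (pderiv (pderiv (Q n))) s - H'' s\<bar> \<le> inverse (real (Suc n))"
    by metis
  let ?q = "\<lambda>n. poly (Q n)" and ?q' = "\<lambda>n. poly (pderiv (Q n))" and ?q'' = "\<lambda>n. poly (pderiv (pderiv (Q n)))"
  have inv1: "inverse (real (Suc n)) \<le> 1" for n by (simp add: field_simps)
  have lims: "(\<lambda>n. f n) \<longlonglongrightarrow> l" if "\<And>n. \<bar>f n - l\<bar> \<le> inverse (real (Suc n))" for f and l :: real
  proof -
    have "(\<lambda>n. f n - l) \<longlonglongrightarrow> 0"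
      by (rule Lim_null_comparison[OF _ LIMSEQ_inverse_real_of_nat]) (use that in auto)
    then show ?thesis by (simp add: LIM_zero_iff)
  qed
  have Hc: "continuous_on UNIV H" "continuous_on UNIV H'"
    by (auto intro!: continuous_at_imp_continuous_on intro: DERIV_isCont[OF H(1)] DERIV_isCont[OF H(2)])
  obtain K0 K1 K2 where K0: "\<And>s. s \<in> {0..L} \<Longrightarrow> \<bar>H s\<bar> \<le> K0" and K1: "\<And>s. s \<in> {0..L} \<Longrightarrow> \<bar>H' s\<bar> \<le> K1"
    and K2: "\<And>s. s \<in> {0..L} \<Longrightarrow> \<bar>H'' s\<bar> \<le> K2"
  proof -
    obtain K0 where "\<And>s. s \<in> {0..L} \<Longrightarrow> \<bar>H s\<bar> \<le> K0" by (rule bounded_on_interval[OF Hc(1)]) blast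
    moreover obtain K1 where "\<And>s. s \<in> {0..L} \<Longrightarrow> \<bar>H' s\<bar> \<le> K1" by (rule bounded_on_interval[OF Hc(2)]) blast
    moreover obtain K2 where "\<And>s. s \<in> {0..L} \<Longrightarrow> \<bar>H'' s\<bar> \<le> K2" by (rule bounded_on_interval[OF H(3)]) blast
    ultimately show ?thesis by (rule that)
  qed
  define K where "K = 1 + max K0 (max K1 K2)"
  have K: "\<bar>?q n s\<bar> \<le> K \<and> \<bar>?q' n s\<bar> \<le> K \<and> \<bar>?q'' n s\<bar> \<le> K" if "s \<in> {0..L}" for n s
  proof -
    have KK: "K0 + 1 \<le> K" "K1 + 1 \<le> K" "K2 + 1 \<le> K" by (simp_all add: K_def)
    have tri: "\<bar>x\<bar> \<le> K" if "\<bar>x - y\<bar> \<le> inverse (real (Suc n))" "\<bar>y\<bar> \<le> c" "c + 1 \<le> K" for x y c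
      using that inv1[of n] by linarith
    show ?thesis
      using tri[OF Q(1)[OF that] K0[OF that] KK(1)] tri[OF Q(2)[OF that] K1[OF that] KK(2)]
        tri[OF Q(3)[OF that] K2[OF that] KK(3)] by blast
  qed
  obtain B where B: "B > 0" "\<And>\<tau> t. \<tau> > 0 \<Longrightarrow> \<bar>tstep' \<tau> t\<bar> \<le> B / \<tau>" "\<And>\<tau> t. \<tau> > 0 \<Longrightarrow> \<bar>tstep'' \<tau> t\<bar> \<le> B / \<tau>\<^sup>2"
    using tstep_derivs_bounded by blast
  have Kp: "K \<ge> 0" using K[of 0 0] L by force
  let ?T = "1 + B / m + B / m\<^sup>2"
  have T: "\<bar>tstep m s\<bar> \<le> ?T" "\<bar>tstep' m s\<bar> \<le> ?T" "\<bar>tstep'' m s\<bar> \<le> ?T" "?T \<ge> 0" for s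
  proof -
    have "B / m \<ge> 0" "B / m\<^sup>2 \<ge> 0" using B m by simp_all
    then show "\<bar>tstep m s\<bar> \<le> ?T" "\<bar>tstep' m s\<bar> \<le> ?T" "\<bar>tstep'' m s\<bar> \<le> ?T" "?T \<ge> 0"
      using B(2)[OF m, of s] B(3)[OF m, of s] tstep_range[of m s] by linarith+
  qed
  have prod: "\<bar>x * y\<bar> \<le> K * ?T" if "\<bar>x\<bar> \<le> K" "\<bar>y\<bar> \<le> ?T" for x y
    unfolding abs_mult using that Kp by (intro mult_mono) auto
  have cutK: "\<bar>cut0 (?q n) m s\<bar> \<le> K" "\<bar>cut1 (?q n) (?q' n) m s\<bar> \<le> 2 * (K * ?T)"
    "\<bar>cut2 (?q n) (?q' n) (?q'' n) m s\<bar> \<le> 4 * (K * ?T)" if "s \<ge> 0" for n s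
  proof -
    have "\<bar>cut0 (?q n) m s\<bar> \<le> K \<and> \<bar>cut1 (?q n) (?q' n) m s\<bar> \<le> 2 * (K * ?T)
      \<and> \<bar>cut2 (?q n) (?q' n) (?q'' n) m s\<bar> \<le> 4 * (K * ?T)"
    proof (cases "s \<le> L")
      case True
      then have s: "s \<in> {0..L}" using that by simp
      have "\<bar>?q n s\<bar> * tstep m s \<le> K * 1"
        using K[OF s] Kp by (intro mult_mono tstep_range) auto
      then have "\<bar>cut0 (?q n) m s\<bar> \<le> K" by (simp add: cut0_def abs_mult tstep_range)
      moreover have "\<bar>cut1 (?q n) (?q' n) m s\<bar> \<le> 2 * (K * ?T)"
      proof -
        have "\<bar>?q' n s * tstep m s\<bar> \<le> K * ?T" "\<bar>?q n s * tstep' m s\<bar> \<le> K * ?T"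
          by (intro prod T; use K[OF s, of n] in blast)+
        then show ?thesis unfolding cut1_def by linarith
      qed
      moreover have "\<bar>cut2 (?q n) (?q' n) (?q'' n) m s\<bar> \<le> 4 * (K * ?T)"
      proof -
        have "\<bar>?q'' n s * tstep m s\<bar> \<le> K * ?T" "\<bar>?q' n s * tstep' m s\<bar> \<le> K * ?T" "\<bar>?q n s * tstep'' m s\<bar> \<le> K * ?T"
          by (intro prod T; use K[OF s, of n] in blast)+
        then show ?thesis unfolding cut2_def by linarith
      qed
      ultimately show ?thesis by blast
    next
      case False
      then have "s \<ge> 2 * m" by (simp add: L_def)
      then show ?thesis unfolding cut_right[OF m \<open>s \<ge> 2 * m\<close>] abs_zero
        using Kp mult_nonneg_nonneg[OF Kp T(4)] by auto
    qed
    then show "\<bar>cut0 (?q n) m s\<bar> \<le> K" "\<bar>cut1 (?q n) (?q' n) m s\<bar> \<le> 2 * (K * ?T)"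
      "\<bar>cut2 (?q n) (?q' n) (?q'' n) m s\<bar> \<le> 4 * (K * ?T)" by blast+
  qed
  have cutlim: "(\<lambda>n. cut0 (?q n) m s) \<longlonglongrightarrow> cut0 H m s" "(\<lambda>n. cut1 (?q n) (?q' n) m s) \<longlonglongrightarrow> cut1 H H' m s"
    "(\<lambda>n. cut2 (?q n) (?q' n) (?q'' n) m s) \<longlonglongrightarrow> cut2 H H' H'' m s" if "s \<ge> 0" for s
  proof -
    have "(\<lambda>n. cut0 (?q n) m s) \<longlonglongrightarrow> cut0 H m s \<and> (\<lambda>n. cut1 (?q n) (?q' n) m s) \<longlonglongrightarrow> cut1 H H' m s
      \<and> (\<lambda>n. cut2 (?q n) (?q' n) (?q'' n) m s) \<longlonglongrightarrow> cut2 H H' H'' m s"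
    proof (cases "s \<le> L")
      case True
      then have s: "s \<in> {0..L}" using that by simp
      note l = lims[OF Q(1)[OF s]] lims[OF Q(2)[OF s]] lims[OF Q(3)[OF s]]
      show ?thesis unfolding cut0_def cut1_def cut2_def by (intro conjI tendsto_intros l)
    next
      case False
      then have "s \<ge> 2 * m" by (simp add: L_def)
      then show ?thesis by (simp add: cut_right[OF m])
    qed
    then show "(\<lambda>n. cut0 (?q n) m s) \<longlonglongrightarrow> cut0 H m s" "(\<lambda>n. cut1 (?q n) (?q' n) m s) \<longlonglongrightarrow> cut1 H H' m s"
      "(\<lambda>n. cut2 (?q n) (?q' n) (?q'' n) m s) \<longlonglongrightarrow> cut2 H H' H'' m s" by blast+
  qed
  let ?a = "\<lambda>n x::real^'n. 2 * cut1 (?q n) (?q' n) m (sqn x)"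
  let ?b = "\<lambda>n x::real^'n. 4 * sqn x * cut2 (?q n) (?q' n) (?q'' n) m (sqn x)"
  define M where "M = 4 * (K * ?T) + 4 * L * (4 * (K * ?T))"
  have KT: "K * ?T \<ge> 0" by (rule mult_nonneg_nonneg[OF Kp T(4)])
  have Ma: "\<bar>?a n x\<bar> \<le> M" for n x
  proof -
    have "0 \<le> 4 * L * (4 * (K * ?T))" using KT L by simp
    moreover have "\<bar>?a n x\<bar> = 2 * \<bar>cut1 (?q n) (?q' n) m (sqn x)\<bar>" by (simp only: abs_mult abs_numeral)
    moreover have "\<bar>cut1 (?q n) (?q' n) m (sqn x)\<bar> \<le> 2 * (K * ?T)" by (rule cutK(2)) simp
    ultimately show ?thesis unfolding M_def by linarith
  qed
  have Mb: "\<bar>?b n x\<bar> \<le> M" for n x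
  proof (cases "sqn x \<le> L")
    case True
    have "\<bar>?b n x\<bar> = 4 * sqn x * \<bar>cut2 (?q n) (?q' n) (?q'' n) m (sqn x)\<bar>" by (simp add: abs_mult)
    also have "\<dots> \<le> 4 * L * (4 * (K * ?T))" using True cutK(3)[of "sqn x" n] L by (intro mult_mono) auto
    also have "\<dots> \<le> M" using KT by (simp add: M_def)
    finally show ?thesis .
  next
    case False
    then have "cut2 (?q n) (?q' n) (?q'' n) m (sqn x) = 0" by (simp add: cut_right[OF m] L_def)
    moreover have "M \<ge> 0" using KT L by (simp add: M_def)
    ultimately show ?thesis by simp
  qed
  have zz: "?a n x = 0 \<and> ?b n x = 0" if "sqn x \<ge> L" for n x
    using that by (simp add: cut_right[OF m] L_def)
  have bd: "AE x in lebesgue. \<bar>?a n x\<bar> + \<bar>?b n x\<bar> \<le> 2 * M / w (sqrt L) * Bw w x"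
    "AE x in lebesgue. \<bar>?a n x\<bar> * norm x \<le> 2 * M / w (sqrt L) * int1 w (norm x)" for n
    using bounded_support_Bw[where a="?a n" and b="?b n" and M=M and R=L, OF L] Ma Mb zz by blast+
  have rad: "radial (cut0 (?q n) m) (cut1 (?q n) (?q' n) m) (cut2 (?q n) (?q' n) (?q'' n) m) (2 * m)
    (\<lambda>x::real^'n. cut0 (?q n) m (sqn x))" for n by (rule radial_poly[OF m])
  have ra: "radial.a (cut1 (?q n) (?q' n) m) = ?a n" for n
    by (rule ext) (rule radial.a_def[OF rad])
  have rb: "radial.b (cut2 (?q n) (?q' n) (?q'' n) m) = ?b n" for n
    by (rule ext) (rule radial.b_def[OF rad])
  have id: "(\<integral>x. \<rho>\<^sub>0 x * (v\<^sub>0 x \<bullet> x) * ?a n x \<partial>lebesgue)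
      + (\<integral>z. dens (?a n) (?b n) (fst z) (snd z) * tstep \<tau> (snd z) \<partial>spacetime)
      = (\<integral>z. \<rho> (fst z) (snd z) * cut0 (?q n) m (sqn (fst z)) * tstep'' \<tau> (snd z) \<partial>spacetime)" for n
    using radial_identity(1)[OF rad \<tau>, of n] unfolding ra rb .
  have int: "integrable spacetime (\<lambda>z. \<rho> (fst z) (snd z) * cut0 (?q n) m (sqn (fst z)) * tstep'' \<tau> (snd z))" for n
    by (rule radial_identity(2)[OF rad \<tau>])
  let ?aH = "\<lambda>x::real^'n. 2 * cut1 H H' m (sqn x)" and ?bH = "\<lambda>x::real^'n. 4 * sqn x * cut2 H H' H'' m (sqn x)"
  have am: "?a n \<in> borel_measurable borel" "?b n \<in> borel_measurable borel" for n
    using radial.ab_borel[OF rad, of n] by (simp_all only: ra rb)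
  have a0m: "?aH \<in> borel_measurable borel" "?bH \<in> borel_measurable borel"
  proof -
    have c: "continuous_on UNIV (\<lambda>s. 2 * cut1 H H' m s)" "continuous_on UNIV (\<lambda>s. 4 * s * cut2 H H' H'' m s)"
      unfolding cut1_def cut2_def by (intro continuous_intros Hc H(3) tstep_continuous[OF m] tstep''_continuous)+
    show "?aH \<in> borel_measurable borel" "?bH \<in> borel_measurable borel"
      using sqn_comp_borel[OF c(1)] sqn_comp_borel[OF c(2)] by simp_all
  qed
  have l1: "(\<lambda>n. ?a n x) \<longlonglongrightarrow> ?aH x" "(\<lambda>n. ?b n x) \<longlonglongrightarrow> ?bH x" for x
    by (intro tendsto_intros cutlim; simp)+
  note lim = dens_tendsto[OF \<tau> am a0m bd AE_I2[OF l1(1)] AE_I2[OF l1(2)]]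
  \<comment> \<open>On the support of the cut-off potentials, \<open>|x|\<^sup>2 \<le> L\<close>, the step function that falls on
    \<open>[L, 2L]\<close> equals one; it provides the integrable majorant of the right-hand side.\<close>
  have one: "integrable spacetime (\<lambda>z. \<rho> (fst z) (snd z) * cut0 (poly 1) L (sqn (fst z)) * tstep'' \<tau> (snd z))"
    by (rule radial_identity(2)[OF radial_poly[OF L] \<tau>])
  have tm: "(\<lambda>z::(real^'n) \<times> real. tstep'' \<tau> (snd z)) \<in> borel_measurable spacetime"
    by (intro time_fun_measurable borel_measurable_continuous_onI tstep''_continuous)
  have c0m: "(\<lambda>z::(real^'n) \<times> real. cut0 H m (sqn (fst z))) \<in> borel_measurable spacetime"
  proof (rule space_fun_measurable, rule sqn_comp_borel)
    show "continuous_on UNIV (cut0 H m)" unfolding cut0_def[abs_def]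
      by (intro continuous_intros Hc tstep_continuous m)
  qed
  have maj: "\<bar>\<rho> (fst z) (snd z) * cut0 (?q n) m (sqn (fst z)) * tstep'' \<tau> (snd z)\<bar>
    \<le> K * \<bar>\<rho> (fst z) (snd z) * cut0 (poly 1) L (sqn (fst z)) * tstep'' \<tau> (snd z)\<bar>" for n z
  proof (cases "sqn (fst z) \<le> L")
    case True
    then have "cut0 (poly 1) L (sqn (fst z)) = 1" using tstep_left(1)[OF L True] by (simp add: cut0_def)
    moreover have "\<bar>cut0 (?q n) m (sqn (fst z))\<bar> \<le> K" by (rule cutK(1)) simp
    ultimately show ?thesis
      using mult_left_mono[of "\<bar>cut0 (?q n) m (sqn (fst z))\<bar>" K "\<bar>\<rho> (fst z) (snd z)\<bar> * \<bar>tstep'' \<tau> (snd z)\<bar>"]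
      by (simp add: abs_mult mult_ac)
  next
    case False
    then have "cut0 (?q n) m (sqn (fst z)) = 0" by (intro cut_right(1) m) (simp add: L_def)
    then show ?thesis using Kp by simp
  qed
  have D: "integrable spacetime (\<lambda>z. \<rho> (fst z) (snd z) * cut0 H m (sqn (fst z)) * tstep'' \<tau> (snd z))"
    "(\<lambda>n. \<integral>z. \<rho> (fst z) (snd z) * cut0 (?q n) m (sqn (fst z)) * tstep'' \<tau> (snd z) \<partial>spacetime)
      \<longlonglongrightarrow> (\<integral>z. \<rho> (fst z) (snd z) * cut0 H m (sqn (fst z)) * tstep'' \<tau> (snd z) \<partial>spacetime)"
  proof -
    have A: "(\<lambda>z. \<rho> (fst z) (snd z) * cut0 H m (sqn (fst z)) * tstep'' \<tau> (snd z)) \<in> borel_measurable spacetime"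
      by (intro borel_measurable_times rho_measurable c0m tm)
    have C: "integrable spacetime (\<lambda>z. K * \<bar>\<rho> (fst z) (snd z) * cut0 (poly 1) L (sqn (fst z)) * tstep'' \<tau> (snd z)\<bar>)"
      by (intro integrable_mult_right integrable_abs one)
    have E: "AE z in spacetime. (\<lambda>n. \<rho> (fst z) (snd z) * cut0 (?q n) m (sqn (fst z)) * tstep'' \<tau> (snd z))
        \<longlonglongrightarrow> \<rho> (fst z) (snd z) * cut0 H m (sqn (fst z)) * tstep'' \<tau> (snd z)"
      by (rule AE_I2, intro tendsto_intros cutlim) simp
    have F: "AE z in spacetime. norm (\<rho> (fst z) (snd z) * cut0 (?q n) m (sqn (fst z)) * tstep'' \<tau> (snd z))
        \<le> K * \<bar>\<rho> (fst z) (snd z) * cut0 (poly 1) L (sqn (fst z)) * tstep'' \<tau> (snd z)\<bar>" for n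
      by (rule AE_I2) (simp only: real_norm_def maj)
    show "integrable spacetime (\<lambda>z. \<rho> (fst z) (snd z) * cut0 H m (sqn (fst z)) * tstep'' \<tau> (snd z))"
      by (rule integrable_dominated_convergence[OF A borel_measurable_integrable[OF int] C E F])
    show "(\<lambda>n. \<integral>z. \<rho> (fst z) (snd z) * cut0 (?q n) m (sqn (fst z)) * tstep'' \<tau> (snd z) \<partial>spacetime)
      \<longlonglongrightarrow> (\<integral>z. \<rho> (fst z) (snd z) * cut0 H m (sqn (fst z)) * tstep'' \<tau> (snd z) \<partial>spacetime)"
      by (rule integral_dominated_convergence[OF A borel_measurable_integrable[OF int] C E F])
  qed
  show "integrable spacetime (\<lambda>z. \<rho> (fst z) (snd z) * cut0 H m (sqn (fst z)) * tstep'' \<tau> (snd z))" by (rule D(1))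
  show "(\<integral>x. \<rho>\<^sub>0 x * (v\<^sub>0 x \<bullet> x) * ?aH x \<partial>lebesgue)
      + (\<integral>z. dens ?aH ?bH (fst z) (snd z) * tstep \<tau> (snd z) \<partial>spacetime)
      = (\<integral>z. \<rho> (fst z) (snd z) * cut0 H m (sqn (fst z)) * tstep'' \<tau> (snd z) \<partial>spacetime)"
    using LIMSEQ_unique[OF tendsto_add[OF lim, unfolded id] D(2)] .
qed

end

section \<open>Approximation of the weight\<close>

lemma int1_diff_bounds:
  assumes u: "admissible_weight u" and rs: "0 \<le> r" "r \<le> s" and lo: "\<And>x. r < x \<Longrightarrow> x \<le> s \<Longrightarrow> l \<le> u x"
    and hi: "\<And>x. r < x \<Longrightarrow> x \<le> s \<Longrightarrow> u x \<le> h"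
  shows "l * (s - r) \<le> int1 u s - int1 u r" "int1 u s - int1 u r \<le> h * (s - r)"
proof -
  have i: "integrable lebesgue (\<lambda>x. indicator {0..t} x *\<^sub>R u x)" for t
    using weight_set_integrable[OF u] by (simp add: set_integrable_def)
  have ie: "indicator {0..s} x *\<^sub>R u x - indicator {0..r} x *\<^sub>R u x = indicator {r<..s} x * u x" for x
    using rs by (auto simp: indicator_def)
  have d: "int1 u s - int1 u r = (\<integral>x. indicator {r<..s} x * u x \<partial>lebesgue)"
    unfolding int1_def set_lebesgue_integral_def Bochner_Integration.integral_diff[OF i i, symmetric] ie ..
  have ii: "integrable lebesgue (\<lambda>x. indicator {r<..s} x * u x)"
    using Bochner_Integration.integrable_diff[OF i[of s] i[of r]] unfolding ie .
  have ind: "integrable lebesgue (indicator {r<..s} :: real \<Rightarrow> real)"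
    by (rule integrable_real_indicator) (simp_all add: rs)
  have c: "(\<integral>x. indicator {r<..s} x * c \<partial>lebesgue) = c * (s - r)" for c :: real
    using rs by (simp add: mult.commute)
  show "l * (s - r) \<le> int1 u s - int1 u r"
    unfolding d c[symmetric]
    by (rule integral_mono[OF integrable_mult_left[OF ind] ii]) (auto simp: indicator_def lo)
  show "int1 u s - int1 u r \<le> h * (s - r)"
    unfolding d c[symmetric]
    by (rule integral_mono[OF ii integrable_mult_left[OF ind]]) (auto simp: indicator_def hi)
qed

text \<open>Averaging the weight, made constant on \<open>[0, 2\<delta>]\<close>, over the interval \<open>[r, r + \<delta>]\<close> to the right
  of \<open>r\<close> produces a continuous function below the weight.\<close>

definition flatten :: "real \<Rightarrow> (real \<Rightarrow> real) \<Rightarrow> real \<Rightarrow> real" where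
  "flatten \<delta> w r = w (max r (2 * \<delta>))"

definition average :: "real \<Rightarrow> (real \<Rightarrow> real) \<Rightarrow> real \<Rightarrow> real" where
  "average \<delta> w r = (int1 (flatten \<delta> w) (r + \<delta>) - int1 (flatten \<delta> w) r) / \<delta>"

context
  fixes w :: "real \<Rightarrow> real" and \<delta> :: real
  assumes w: "admissible_weight w" and \<delta>: "\<delta> > 0"
begin

lemma flatten_le: "r > 0 \<Longrightarrow> flatten \<delta> w r \<le> w r"
  unfolding flatten_def by (rule weight_antimono[OF w]) auto

lemma flatten_bounds: "0 < flatten \<delta> w r" "flatten \<delta> w r \<le> w (2 * \<delta>)" "r \<le> s \<Longrightarrow> flatten \<delta> w s \<le> flatten \<delta> w r"
proof -
  have "0 < max r (2 * \<delta>)" using \<delta> by simp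
  then show "0 < flatten \<delta> w r" unfolding flatten_def by (rule weight_pos[OF w])
  show "flatten \<delta> w r \<le> w (2 * \<delta>)" unfolding flatten_def by (rule weight_antimono[OF w]) (use \<delta> in auto)
  show "flatten \<delta> w s \<le> flatten \<delta> w r" if "r \<le> s"
    unfolding flatten_def by (rule weight_antimono[OF w]) (use \<delta> that in auto)
qed

lemma flatten_admissible: "admissible_weight (flatten \<delta> w)"
  unfolding admissible_weight_def
proof (intro conjI allI impI)
  fix R :: real
  have "mono (\<lambda>r. - flatten \<delta> w r)" by (simp add: mono_def flatten_bounds(3))
  then have "(\<lambda>r. - flatten \<delta> w r) \<in> borel_measurable borel" by (rule borel_measurable_mono)
  then have "(\<lambda>r. - (- flatten \<delta> w r)) \<in> borel_measurable borel" by (rule borel_measurable_uminus)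
  then have m: "flatten \<delta> w \<in> borel_measurable lebesgue" by (intro measurable_completion) simp
  show "set_integrable lebesgue {0..R} (flatten \<delta> w)"
    unfolding set_integrable_def
  proof (rule Bochner_Integration.integrable_bound[OF integrable_mult_left[OF indicator_interval_integrable]])
    show "(\<lambda>x. indicator {0..R} x *\<^sub>R flatten \<delta> w x) \<in> borel_measurable lebesgue"
      by (intro borel_measurable_scaleR borel_measurable_indicator m) simp
    show "AE x in lebesgue. norm (indicator {0..R} x *\<^sub>R flatten \<delta> w x) \<le> norm (indicator {0..R} x * w (2 * \<delta>))"
    proof (rule AE_I2)
      fix x
      show "norm (indicator {0..R} x *\<^sub>R flatten \<delta> w x) \<le> norm (indicator {0..R} x * w (2 * \<delta>))"
        using flatten_bounds(1,2)[of x] by (auto simp: indicator_def)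
    qed
  qed
next
  show "0 < flatten \<delta> w r" for r by (rule flatten_bounds)
  show "antimono_on {0<..} (flatten \<delta> w)" by (simp add: monotone_on_def flatten_bounds(3))
qed

lemma average_bounds:
  assumes "r \<ge> 0"
  shows "flatten \<delta> w (r + \<delta>) \<le> average \<delta> w r" "average \<delta> w r \<le> flatten \<delta> w r"
proof -
  have b: "flatten \<delta> w (r + \<delta>) * (r + \<delta> - r) \<le> int1 (flatten \<delta> w) (r + \<delta>) - int1 (flatten \<delta> w) r"
    "int1 (flatten \<delta> w) (r + \<delta>) - int1 (flatten \<delta> w) r \<le> flatten \<delta> w r * (r + \<delta> - r)"
    by (rule int1_diff_bounds(1)[OF flatten_admissible assms _ _ flatten_bounds(2)],
        use \<delta> in simp, rule flatten_bounds(3), simp,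
        rule int1_diff_bounds(2)[OF flatten_admissible assms _ less_imp_le[OF flatten_bounds(1)]],
        use \<delta> in simp, rule flatten_bounds(3), simp)
  then show "flatten \<delta> w (r + \<delta>) \<le> average \<delta> w r" "average \<delta> w r \<le> flatten \<delta> w r"
    using \<delta> by (simp_all add: average_def pos_le_divide_eq pos_divide_le_eq)
qed

lemma average_nonneg: "r \<ge> 0 \<Longrightarrow> 0 \<le> average \<delta> w r"
  using average_bounds(1)[of r] flatten_bounds(1)[of "r + \<delta>"] by linarith

lemma average_le: "r > 0 \<Longrightarrow> average \<delta> w r \<le> w r"
  using average_bounds(2)[of r] flatten_le[of r] by linarith

lemma average_const: "0 \<le> r \<Longrightarrow> r \<le> \<delta> \<Longrightarrow> average \<delta> w r = w (2 * \<delta>)"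
  using average_bounds[of r] by (simp add: flatten_def max_def split: if_splits)

lemma int1_flatten_lipschitz:
  assumes "r \<le> s" shows "\<bar>int1 (flatten \<delta> w) s - int1 (flatten \<delta> w) r\<bar> \<le> w (2 * \<delta>) * (s - r)"
proof -
  have w0: "0 \<le> w (2 * \<delta>)" using weight_pos[OF w, of "2 * \<delta>"] \<delta> by simp
  have "\<bar>int1 (flatten \<delta> w) s - int1 (flatten \<delta> w) r\<bar> = int1 (flatten \<delta> w) s - int1 (flatten \<delta> w) r"
    using int1_mono[OF flatten_admissible assms] by simp
  also have "\<dots> \<le> w (2 * \<delta>) * (s - r)"
  proof (cases "r \<ge> 0")
    case True
    show ?thesis by (rule int1_diff_bounds(2)[OF flatten_admissible True assms])
      (rule less_imp_le[OF flatten_bounds(1)], rule flatten_bounds(2))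
  next
    case False
    show ?thesis
    proof (cases "s \<ge> 0")
      case True
      have "int1 (flatten \<delta> w) s - int1 (flatten \<delta> w) 0 \<le> w (2 * \<delta>) * (s - 0)"
        by (rule int1_diff_bounds(2)[OF flatten_admissible order_refl True])
          (rule less_imp_le[OF flatten_bounds(1)], rule flatten_bounds(2))
      also have "\<dots> \<le> w (2 * \<delta>) * (s - r)" using w0 False by (intro mult_left_mono) auto
      finally show ?thesis using False by (simp add: int1_nonpos)
    next
      case False
      then show ?thesis using assms w0 by (simp add: int1_nonpos)
    qed
  qed
  finally show ?thesis .
qed

lemma average_continuous: "continuous_on A (average \<delta> w)"
proof -
  have "(w (2 * \<delta>))-lipschitz_on UNIV (int1 (flatten \<delta> w))"
  proof (rule lipschitz_onI)
    fix r s :: real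
    show "dist (int1 (flatten \<delta> w) r) (int1 (flatten \<delta> w) s) \<le> w (2 * \<delta>) * dist r s"
      using int1_flatten_lipschitz[of r s] int1_flatten_lipschitz[of s r]
      by (cases "r \<le> s") (auto simp: dist_real_def abs_minus_commute)
  qed (use weight_pos[OF w, of "2 * \<delta>"] \<delta> in simp)
  then have c: "continuous_on UNIV (int1 (flatten \<delta> w))" by (rule lipschitz_on_continuous_on)
  show ?thesis unfolding average_def[abs_def]
    by (intro continuous_intros continuous_on_compose2[OF c]) (use \<delta> in auto)
qed

end

lemma int1_deriv:
  assumes c: "continuous_on {0..} h" and "r > 0"
  shows "(int1 h has_real_derivative h r) (at r)"
proof -
  have eq: "int1 h s = integral {0..s} h" if "s \<ge> 0" for s
    unfolding int1_def
    by (rule set_lebesgue_integral_eq_integral(2)) (intro absolutely_integrable_continuous_real continuous_on_subset[OF c], auto)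
  have "((\<lambda>s. integral {0..s} h) has_real_derivative h r) (at r within {0..r + 1})"
    by (rule integral_has_real_derivative[OF continuous_on_subset[OF c]]) (use \<open>r > 0\<close> in auto)
  moreover have "at r within {0..r + 1} = at r" using \<open>r > 0\<close> by (intro at_within_interior) auto
  ultimately have "((\<lambda>s. integral {0..s} h) has_real_derivative h r) (at r)" by simp
  then show ?thesis
    by (rule has_field_derivative_transform_within_open[of _ _ _ "{0<..}"]) (use \<open>r > 0\<close> eq in auto)
qed

lemma int1_cong: "(\<And>x. 0 \<le> x \<Longrightarrow> x \<le> r \<Longrightarrow> f x = h x) \<Longrightarrow> int1 f r = int1 h r"
  unfolding int1_def by (rule set_lebesgue_integral_cong) auto

lemma int1_const: assumes "r \<ge> 0" shows "int1 (\<lambda>_. c) r = c * r"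
  using assms by (simp add: int1_def set_lebesgue_integral_def mult.commute)

lemma int1_linear: assumes "r \<ge> 0" shows "int1 (\<lambda>x. c * x) r = c * r\<^sup>2 / 2"
proof -
  have "int1 (\<lambda>x. c * x) r = integral {0..r} (\<lambda>x. c * x)"
    unfolding int1_def
    by (rule set_lebesgue_integral_eq_integral(2)) (intro absolutely_integrable_continuous_real continuous_intros)
  also have "((\<lambda>x. c * x) has_integral (c * r\<^sup>2 / 2 - c * 0\<^sup>2 / 2)) {0..r}"
    by (rule fundamental_theorem_of_calculus[OF assms])
       (auto intro!: derivative_eq_intros simp: has_real_derivative_iff_has_vector_derivative[symmetric])
  then have "integral {0..r} (\<lambda>x. c * x) = c * r\<^sup>2 / 2" by (intro integral_unique) simp
  finally show ?thesis .
qed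

lemma int1_le:
  assumes c: "continuous_on {0..} h" and w: "set_integrable lebesgue {0..r} w"
    and le: "\<And>x. 0 < x \<Longrightarrow> h x \<le> w x"
  shows "int1 h r \<le> int1 w r"
  unfolding int1_def set_lebesgue_integral_def
proof (rule integral_mono_AE)
  have "h absolutely_integrable_on {0..r}"
    by (intro absolutely_integrable_continuous_real continuous_on_subset[OF c]) auto
  then show "integrable lebesgue (\<lambda>x. indicator {0..r} x *\<^sub>R h x)" by (simp add: set_integrable_def)
  have "AE x in lebesgue. x \<noteq> (0::real)" by (rule AE_completion) (rule AE_lborel_singleton)
  then show "AE x in lebesgue. indicator {0..r} x *\<^sub>R h x \<le> indicator {0..r} x *\<^sub>R w x"
    by eventually_elim (auto simp: indicator_def intro!: le)
qed (use w in \<open>simp add: set_integrable_def\<close>)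

lemma int1_nonneg_fun: "(\<And>x. 0 \<le> x \<Longrightarrow> 0 \<le> h x) \<Longrightarrow> 0 \<le> int1 h r"
  unfolding int1_def set_lebesgue_integral_def by (rule integral_nonneg_AE) (auto simp: indicator_def)

text \<open>The radial potential, as a function of \<open>s = |x|\<^sup>2\<close>, whose second radial derivative is the
  average; it is linear near the origin.\<close>

definition pot :: "real \<Rightarrow> (real \<Rightarrow> real) \<Rightarrow> real \<Rightarrow> real" where
  "pot \<delta> w s = (if s < \<delta>\<^sup>2 then w (2 * \<delta>) * s / 2 else int1 (int1 (average \<delta> w)) (sqrt s))"
definition pot' :: "real \<Rightarrow> (real \<Rightarrow> real) \<Rightarrow> real \<Rightarrow> real" where
  "pot' \<delta> w s = (if s < \<delta>\<^sup>2 then w (2 * \<delta>) / 2 else int1 (average \<delta> w) (sqrt s) / (2 * sqrt s))"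
definition pot'' :: "real \<Rightarrow> (real \<Rightarrow> real) \<Rightarrow> real \<Rightarrow> real" where
  "pot'' \<delta> w s = (if s < \<delta>\<^sup>2 then 0 else (average \<delta> w (sqrt s) - int1 (average \<delta> w) (sqrt s) / sqrt s) / (4 * s))"

context
  fixes w :: "real \<Rightarrow> real" and \<delta> :: real
  assumes w: "admissible_weight w" and \<delta>: "\<delta> > 0"
begin

private abbreviation "V \<equiv> int1 (average \<delta> w)"

lemma V_near_0: "0 \<le> r \<Longrightarrow> r \<le> \<delta> \<Longrightarrow> V r = w (2 * \<delta>) * r"
proof -
  assume r: "0 \<le> r" "r \<le> \<delta>"
  have "V r = int1 (\<lambda>_. w (2 * \<delta>)) r" by (rule int1_cong) (use r in \<open>simp add: average_const[OF w \<delta>]\<close>)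
  then show ?thesis using r by (simp add: int1_const)
qed

lemma VV_near_0: "0 \<le> r \<Longrightarrow> r \<le> \<delta> \<Longrightarrow> int1 V r = w (2 * \<delta>) * r\<^sup>2 / 2"
proof -
  assume r: "0 \<le> r" "r \<le> \<delta>"
  have "int1 V r = int1 (\<lambda>x. w (2 * \<delta>) * x) r" by (rule int1_cong) (use r in \<open>simp add: V_near_0\<close>)
  then show ?thesis using r by (simp add: int1_linear)
qed

lemma V_deriv: "r > 0 \<Longrightarrow> (V has_real_derivative average \<delta> w r) (at r)"
  by (rule int1_deriv[OF average_continuous[OF w \<delta>]])

lemma V_continuous: "continuous_on {0..} V"
proof (rule continuous_on_eq_continuous_within[THEN iffD2], rule ballI)
  fix r :: real assume "r \<in> {0..}"
  show "continuous (at r within {0..}) V"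
  proof (cases "r = 0")
    case False
    then have "r > 0" using \<open>r \<in> {0..}\<close> by simp
    from DERIV_isCont[OF V_deriv[OF this]] show ?thesis by (rule continuous_at_imp_continuous_at_within)
  next
    case True
    have "continuous (at r within {0..}) (\<lambda>r. w (2 * \<delta>) * r)" by (intro continuous_intros)
    then show ?thesis
      by (rule continuous_transform_within[where \<delta>=\<delta>]) (use \<delta> True in \<open>auto simp: V_near_0 dist_real_def\<close>)
  qed
qed

lemma VV_deriv: "r > 0 \<Longrightarrow> (int1 V has_real_derivative V r) (at r)"
  by (rule int1_deriv[OF V_continuous])

lemma pot_pos:
  assumes "s > 0"
  shows "pot \<delta> w s = int1 V (sqrt s)" "pot' \<delta> w s = V (sqrt s) / (2 * sqrt s)"
    "pot'' \<delta> w s = (average \<delta> w (sqrt s) - V (sqrt s) / sqrt s) / (4 * s)"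
proof -
  have "pot \<delta> w s = int1 V (sqrt s) \<and> pot' \<delta> w s = V (sqrt s) / (2 * sqrt s)
    \<and> pot'' \<delta> w s = (average \<delta> w (sqrt s) - V (sqrt s) / sqrt s) / (4 * s)"
  proof (cases "s < \<delta>\<^sup>2")
    case True
    then have "sqrt s < \<delta>" using \<delta> real_sqrt_less_mono[OF True] by simp
    then have r: "0 \<le> sqrt s" "sqrt s \<le> \<delta>" "sqrt s > 0" using assms by simp_all
    have "V (sqrt s) / sqrt s = w (2 * \<delta>)" using V_near_0[OF r(1,2)] r(3) by simp
    moreover have "average \<delta> w (sqrt s) = w (2 * \<delta>)" by (rule average_const[OF w \<delta> r(1,2)])
    moreover have "int1 V (sqrt s) = w (2 * \<delta>) * s / 2" using VV_near_0[OF r(1,2)] assms by simp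
    moreover have "V (sqrt s) / (2 * sqrt s) = (V (sqrt s) / sqrt s) / 2" by simp
    ultimately show ?thesis using True by (simp only: pot_def pot'_def pot''_def if_True diff_self div_0 simp_thms)
  qed (simp add: pot_def pot'_def pot''_def)
  then show "pot \<delta> w s = int1 V (sqrt s)" "pot' \<delta> w s = V (sqrt s) / (2 * sqrt s)"
    "pot'' \<delta> w s = (average \<delta> w (sqrt s) - V (sqrt s) / sqrt s) / (4 * s)" by blast+
qed

lemma pot_derivs:
  "(pot \<delta> w has_real_derivative pot' \<delta> w s) (at s)" "(pot' \<delta> w has_real_derivative pot'' \<delta> w s) (at s)"
  "continuous (at s) (pot'' \<delta> w)"
proof -
  have "(pot \<delta> w has_real_derivative pot' \<delta> w s) (at s) \<and> (pot' \<delta> w has_real_derivative pot'' \<delta> w s) (at s)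
    \<and> continuous (at s) (pot'' \<delta> w)"
  proof (cases "s < \<delta>\<^sup>2")
    case True
    have o: "open {..<\<delta>\<^sup>2}" "s \<in> {..<\<delta>\<^sup>2}" using True by auto
    have "((\<lambda>s. w (2 * \<delta>) * s / 2) has_real_derivative w (2 * \<delta>) / 2) (at s)" by (auto intro!: derivative_eq_intros)
    then have "(pot \<delta> w has_real_derivative w (2 * \<delta>) / 2) (at s)"
      by (rule has_field_derivative_transform_within_open[OF _ o]) (simp add: pot_def)
    moreover have "((\<lambda>s. w (2 * \<delta>) / 2) has_real_derivative 0) (at s)" by simp
    then have "(pot' \<delta> w has_real_derivative 0) (at s)"
      by (rule has_field_derivative_transform_within_open[OF _ o]) (simp add: pot'_def)
    moreover have "((\<lambda>s. 0::real) has_real_derivative 0) (at s)" by simp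
    then have "(pot'' \<delta> w has_real_derivative 0) (at s)"
      by (rule has_field_derivative_transform_within_open[OF _ o]) (simp add: pot''_def)
    ultimately show ?thesis using True by (simp add: pot'_def pot''_def DERIV_isCont)
  next
    case False
    then have s: "s > 0" using \<delta> by (meson less_le_trans not_less zero_less_power)
    have o: "open {0::real<..}" "s \<in> {0<..}" using s by auto
    have r: "sqrt s > 0" using s by simp
    have sq: "(sqrt has_real_derivative inverse (sqrt s) / 2) (at s)" by (rule DERIV_real_sqrt[OF s])
    have dV: "((\<lambda>s. V (sqrt s)) has_real_derivative average \<delta> w (sqrt s) * (inverse (sqrt s) / 2)) (at s)"
      by (rule DERIV_chain2[OF V_deriv[OF r] sq])
    have "((\<lambda>s. int1 V (sqrt s)) has_real_derivative V (sqrt s) * (inverse (sqrt s) / 2)) (at s)"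
      by (rule DERIV_chain2[OF VV_deriv[OF r] sq])
    moreover have "V (sqrt s) * (inverse (sqrt s) / 2) = pot' \<delta> w s"
      unfolding pot_pos(2)[OF s] by (simp add: inverse_eq_divide)
    ultimately have 1: "(pot \<delta> w has_real_derivative pot' \<delta> w s) (at s)"
      using has_field_derivative_transform_within_open[OF _ o, of "\<lambda>s. int1 V (sqrt s)" _ "pot \<delta> w"] pot_pos(1) by simp
    have "((\<lambda>s. V (sqrt s) / (2 * sqrt s)) has_real_derivative
        (average \<delta> w (sqrt s) * (inverse (sqrt s) / 2) * (2 * sqrt s) - V (sqrt s) * (2 * (inverse (sqrt s) / 2)))
          / ((2 * sqrt s) * (2 * sqrt s))) (at s)"
      by (rule DERIV_divide[OF dV DERIV_cmult[OF sq]]) (use r in simp)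
    moreover have "(average \<delta> w (sqrt s) * (inverse (sqrt s) / 2) * (2 * sqrt s) - V (sqrt s) * (2 * (inverse (sqrt s) / 2)))
          / ((2 * sqrt s) * (2 * sqrt s)) = pot'' \<delta> w s"
    proof -
      have "average \<delta> w (sqrt s) * (inverse (sqrt s) / 2) * (2 * sqrt s) = average \<delta> w (sqrt s)"
        using r by simp
      moreover have "V (sqrt s) * (2 * (inverse (sqrt s) / 2)) = V (sqrt s) / sqrt s" by (simp add: inverse_eq_divide)
      moreover have "(2 * sqrt s) * (2 * sqrt s) = 4 * s" using s by simp
      ultimately show ?thesis unfolding pot_pos(3)[OF s] by (simp only:)
    qed
    ultimately have 2: "(pot' \<delta> w has_real_derivative pot'' \<delta> w s) (at s)"
      using has_field_derivative_transform_within_open[OF _ o, of "\<lambda>s. V (sqrt s) / (2 * sqrt s)" _ "pot' \<delta> w"] pot_pos(2) by simp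
    have "isCont (\<lambda>s. (average \<delta> w (sqrt s) - V (sqrt s) / sqrt s) / (4 * s)) s"
    proof -
      have "isCont (average \<delta> w) (sqrt s)"
        using average_continuous[OF w \<delta>, of UNIV] by (simp add: continuous_on_eq_continuous_at)
      then have "isCont (\<lambda>s. average \<delta> w (sqrt s)) s" by (intro isCont_o2[OF DERIV_isCont[OF sq]])
      then show ?thesis using DERIV_isCont[OF dV] DERIV_isCont[OF sq] s by (intro continuous_intros) auto
    qed
    moreover have "\<forall>\<^sub>F t in nhds s. (average \<delta> w (sqrt t) - V (sqrt t) / sqrt t) / (4 * t) = pot'' \<delta> w t"
      using eventually_nhds_in_open[OF o] by eventually_elim (simp add: pot_pos(3))
    ultimately have 3: "isCont (pot'' \<delta> w) s" by (simp add: isCont_cong)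
    show ?thesis using 1 2 3 by blast
  qed
  then show "(pot \<delta> w has_real_derivative pot' \<delta> w s) (at s)" "(pot' \<delta> w has_real_derivative pot'' \<delta> w s) (at s)"
    "continuous (at s) (pot'' \<delta> w)" by blast+
qed

lemma V_bounds: "0 \<le> V r" "V r \<le> int1 w r" "0 \<le> int1 V r" "int1 V r \<le> int2 w r"
proof -
  show V0: "0 \<le> V r" for r by (rule int1_nonneg_fun) (rule average_nonneg[OF w \<delta>])
  show V1: "V r \<le> int1 w r" for r
    by (rule int1_le[OF average_continuous[OF w \<delta>] weight_set_integrable[OF w] average_le[OF w \<delta>]])
  show "0 \<le> int1 V r" by (rule int1_nonneg_fun) (rule V0)
  have "int1 V r \<le> int1 (int1 w) r"
    by (rule int1_le[OF V_continuous int1_set_integrable[OF w] V1])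
  then show "int1 V r \<le> int2 w r" by (simp add: int2_def int1_def)
qed

end

text \<open>A non-increasing weight is continuous outside a countable set, and there the averages converge.\<close>

lemma weight_continuity_points:
  assumes w: "admissible_weight w" shows "countable {r. r > 0 \<and> \<not> isCont w r}"
proof -
  have "mono_on {0<..} (\<lambda>r. - w r)" using weight_antimono[OF w] by (auto simp: monotone_on_def)
  then have "countable {r \<in> {0<..}. \<not> isCont (\<lambda>r. - w r) r}" by (intro mono_on_ctble_discont_open) auto
  moreover have "isCont w r" if "isCont (\<lambda>r. - w r) r" for r
    using continuous_minus[OF that] by simp
  ultimately show ?thesis by (elim countable_subset[rotated]) auto
qed

lemma average_tendsto:
  assumes w: "admissible_weight w" and r: "r > 0" and c: "isCont w r"
  shows "(\<lambda>n. average (inverse (real (Suc n))) w r) \<longlonglongrightarrow> w r"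
proof -
  let ?d = "\<lambda>n. inverse (real (Suc n))"
  have "(\<lambda>n. r + ?d n) \<longlonglongrightarrow> r + 0" by (intro tendsto_intros LIMSEQ_inverse_real_of_nat)
  then have lo: "(\<lambda>n. w (r + ?d n)) \<longlonglongrightarrow> w r" using isCont_tendsto_compose[OF c] by simp
  have "\<forall>\<^sub>F n in sequentially. ?d n < r / 2"
    using order_tendstoD(2)[OF LIMSEQ_inverse_real_of_nat, of "r / 2"] r by simp
  then have ev: "\<forall>\<^sub>F n in sequentially. w (r + ?d n) \<le> average (?d n) w r"
  proof eventually_elim
    case (elim n)
    have d: "?d n > 0" by simp
    have "max (r + ?d n) (2 * ?d n) = r + ?d n" using elim r d by (intro max_absorb1) linarith
    then have "flatten (?d n) w (r + ?d n) = w (r + ?d n)" by (simp only: flatten_def)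
    then show ?case using average_bounds(1)[OF w d, of r] r by simp
  qed
  have "average (?d n) w r \<le> w r" for n by (rule average_le[OF w _ r]) simp
  then show ?thesis by (intro tendsto_sandwich[OF ev _ lo tendsto_const]) simp
qed

lemma AE_countable_complement: "countable C \<Longrightarrow> AE x in lebesgue. x \<notin> (C :: real set)"
proof (rule AE_completion)
  assume "countable C"
  then have "C \<in> null_sets lborel" by (rule countable_imp_null_set_lborel)
  then show "AE x in lborel. x \<notin> C" by (rule AE_not_in)
qed

lemma int1_average_tendsto:
  assumes w: "admissible_weight w"
  shows "(\<lambda>n. int1 (average (inverse (real (Suc n))) w) r) \<longlonglongrightarrow> int1 w r"
  unfolding int1_def set_lebesgue_integral_def
proof (rule integral_dominated_convergence)
  have d: "inverse (real (Suc n)) > 0" for n by simp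
  show iw: "integrable lebesgue (\<lambda>x. indicator {0..r} x *\<^sub>R w x)"
    using weight_set_integrable[OF w] by (simp add: set_integrable_def)
  then show "(\<lambda>x. indicator {0..r} x *\<^sub>R w x) \<in> borel_measurable lebesgue" by simp
  have x0: "AE x in lebesgue. x \<noteq> (0::real)" by (rule AE_completion) (rule AE_lborel_singleton)
  show "(\<lambda>x. indicator {0..r} x *\<^sub>R average (inverse (real (Suc n))) w x) \<in> borel_measurable lebesgue" for n
  proof (intro borel_measurable_scaleR borel_measurable_indicator measurable_completion)
    show "average (inverse (real (Suc n))) w \<in> borel_measurable lborel"
      using average_continuous[OF w d, of UNIV n] by (simp add: borel_measurable_continuous_onI)
  qed simp
  show "AE x in lebesgue. (\<lambda>n. indicator {0..r} x *\<^sub>R average (inverse (real (Suc n))) w x) \<longlonglongrightarrow> indicator {0..r} x *\<^sub>R w x"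
    using AE_countable_complement[OF weight_continuity_points[OF w]] x0
  proof eventually_elim
    case (elim x)
    show ?case
    proof (cases "x \<in> {0..r}")
      case True
      then have "x > 0" using elim by auto
      then show ?thesis using average_tendsto[OF w \<open>x > 0\<close>] elim by (intro tendsto_intros) auto
    qed simp
  qed
  show "AE x in lebesgue. norm (indicator {0..r} x *\<^sub>R average (inverse (real (Suc n))) w x) \<le> indicator {0..r} x *\<^sub>R w x" for n
    using x0
  proof eventually_elim
    case (elim x)
    show ?case
    proof (cases "x \<in> {0..r}")
      case True
      then have "x > 0" using elim by auto
      then show ?thesis using True average_le[OF w d \<open>x > 0\<close>, of n] average_nonneg[OF w d, of x n] by simp
    qed simp
  qed
qed

lemma AE_norm_notin_countable:
  assumes "countable C" shows "AE x in lebesgue. norm (x :: real^'n::finite) \<notin> C"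
proof -
  have "{x :: real^'n. norm x \<in> C} = (\<Union>r\<in>C. sphere 0 r)" by auto
  moreover have "negligible (\<Union>r\<in>C. sphere (0 :: real^'n) r)"
    using assms negligible_countable_Union[of "(\<lambda>r. sphere (0 :: real^'n) r) ` C"] negligible_sphere by blast
  ultimately have "{x :: real^'n. norm x \<in> C} \<in> null_sets lebesgue"
    by (simp add: negligible_iff_null_sets)
  then show ?thesis by (rule AE_I'[where P="\<lambda>x. norm x \<notin> C"]) auto
qed

section \<open>The virial inequality\<close>

context flow begin

text \<open>The coefficients of the limiting potential, whose gradient is \<open>x / |x|\<close> times the
  primitive of the weight.\<close>

definition alim :: "real^'n \<Rightarrow> real" where "alim x = int1 w (norm x) / norm x"
definition blim :: "real^'n \<Rightarrow> real" where "blim x = wt w (norm x) - alim x"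

lemma lim_borel: "alim \<in> borel_measurable borel" "blim \<in> borel_measurable borel"
proof -
  note [measurable] = wt_borel[OF w] int1_borel[OF w]
  show "alim \<in> borel_measurable borel" unfolding alim_def[abs_def] by measurable
  then show "blim \<in> borel_measurable borel" unfolding blim_def[abs_def] by measurable
qed

lemma lim_bound: "\<bar>alim x\<bar> + \<bar>blim x\<bar> \<le> 2 * Bw w x"
proof -
  have "0 \<le> alim x" "0 \<le> wt w (norm x)" "0 \<le> int2 w (norm x) / (norm x)\<^sup>2"
    using int1_nonneg[OF w] int2_nonneg[OF w] weight_pos[OF w] by (auto simp: alim_def wt_def less_imp_le)
  moreover have "Bw w x = wt w (norm x) + alim x + int2 w (norm x) / (norm x)\<^sup>2"
    by (simp add: Bw_def alim_def)
  ultimately show ?thesis unfolding blim_def by linarith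
qed

text \<open>The coefficients of the cut-off potential of an average are dominated by the weights. Where
  the derivatives of the cut-off do not vanish, \<open>m \<le> |x|\<^sup>2 \<le> 2m\<close>, so that powers of \<open>1 / m\<close> are
  bounded by powers of \<open>2 / |x|\<^sup>2\<close>.\<close>

lemma cut_average_bounds:
  fixes x :: "real^'n"
  assumes B: "B > 0" "\<And>\<tau> t. \<tau> > 0 \<Longrightarrow> \<bar>tstep' \<tau> t\<bar> \<le> B / \<tau>" "\<And>\<tau> t. \<tau> > 0 \<Longrightarrow> \<bar>tstep'' \<tau> t\<bar> \<le> B / \<tau>\<^sup>2"
    and m: "m > 0" and \<delta>: "\<delta> > 0" and x: "x \<noteq> 0"
  defines "a \<equiv> 2 * cut1 (pot \<delta> w) (pot' \<delta> w) m (sqn x)"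
    and "b \<equiv> 4 * sqn x * cut2 (pot \<delta> w) (pot' \<delta> w) (pot'' \<delta> w) m (sqn x)"
  shows "\<bar>a\<bar> + \<bar>b\<bar> \<le> (2 + 28 * B) * Bw w x" "\<bar>a\<bar> * norm x \<le> (2 + 28 * B) * int1 w (norm x)"
proof -
  define r where "r = norm x"
  define s where "s = sqn x"
  have r: "r > 0" using x by (simp add: r_def)
  have s: "s > 0" "sqrt s = r" "s = r\<^sup>2" using x by (simp_all add: s_def r_def)
  define V where "V = int1 (average \<delta> w) r / r"
  define P where "P = int1 (int1 (average \<delta> w)) r"
  define I where "I = int1 w r / r"
  define J where "J = int2 w r / r\<^sup>2"
  define h where "h = average \<delta> w r"
  note Vb = V_bounds[OF w \<delta>, of r]
  have V: "0 \<le> V" "V \<le> I" using Vb(1,2) r by (simp_all add: V_def I_def divide_right_mono)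
  have P: "0 \<le> P" "P / s \<le> J" using Vb(3,4) s by (simp_all add: P_def J_def divide_right_mono)
  have h: "0 \<le> h" "h \<le> w r" using average_nonneg[OF w \<delta>, of r] average_le[OF w \<delta>, of r] r by (simp_all add: h_def)
  have I0: "0 \<le> I" using V by linarith
  have J0: "0 \<le> J" using P s by (meson divide_nonneg_pos order.trans)
  have \<sigma>: "0 \<le> tstep m s" "tstep m s \<le> 1" by (rule tstep_range)+
  have \<sigma>1: "\<bar>tstep' m s\<bar> \<le> 2 * B / s"
  proof (cases "s \<ge> 2 * m")
    case True
    then show ?thesis using tstep_right[OF m True] B(1) s by simp
  next
    case False
    have "B / m \<le> B / (s / 2)" by (rule divide_left_mono) (use False B(1) s m in auto)
    then show ?thesis using B(2)[OF m, of s] by (simp add: mult.commute)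
  qed
  have \<sigma>2: "\<bar>tstep'' m s\<bar> \<le> 4 * B / s\<^sup>2"
  proof (cases "s \<ge> 2 * m")
    case True
    then show ?thesis using tstep_right[OF m True] B(1) s by simp
  next
    case False
    have "(s / 2)\<^sup>2 \<le> m\<^sup>2" by (rule power_mono) (use False s in auto)
    then have "B / m\<^sup>2 \<le> B / (s / 2)\<^sup>2" by (rule divide_left_mono) (use B(1) s m in auto)
    then show ?thesis using B(3)[OF m, of s] by (simp add: power_divide mult.commute)
  qed
  have a: "a = V * tstep m s + 2 * (P * tstep' m s)"
    unfolding a_def s_def[symmetric] cut1_def pot_pos[OF w \<delta> s(1)] s(2) P_def[symmetric] V_def by simp
  have b: "b = (h - V) * tstep m s + 4 * (V * (s * tstep' m s)) + 4 * (P * (s * tstep'' m s))"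
    unfolding b_def s_def[symmetric] cut2_def pot_pos[OF w \<delta> s(1)] s(2) P_def[symmetric] V_def[symmetric] h_def[symmetric]
    using s(1) V_def by (simp add: field_simps)
  have Vs: "\<bar>V * tstep m s\<bar> \<le> I"
    using mult_mono[OF V(2) \<sigma>(2) I0 \<sigma>(1)] V \<sigma> by (simp add: abs_mult)
  have Ps: "\<bar>P * tstep' m s\<bar> \<le> 2 * B * J"
  proof -
    have "\<bar>P * tstep' m s\<bar> \<le> P * (2 * B / s)"
      unfolding abs_mult abs_of_nonneg[OF P(1)] using \<sigma>1 P(1) by (rule mult_left_mono)
    also have "\<dots> = 2 * B * (P / s)" by simp
    also have "\<dots> \<le> 2 * B * J" using P B(1) by (intro mult_left_mono) auto
    finally show ?thesis .
  qed
  have a_le: "\<bar>a\<bar> \<le> I + 4 * (B * J)" unfolding a using Vs Ps by linarith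
  have hV: "\<bar>(h - V) * tstep m s\<bar> \<le> w r + I"
  proof -
    have "\<bar>h - V\<bar> * tstep m s \<le> \<bar>h - V\<bar> * 1" by (intro mult_left_mono \<sigma>) simp
    then show ?thesis using h V \<sigma> by (simp add: abs_mult)
  qed
  have b2: "\<bar>V * (s * tstep' m s)\<bar> \<le> I * (2 * B)"
  proof -
    have "s * \<bar>tstep' m s\<bar> \<le> s * (2 * B / s)" using \<sigma>1 s by (intro mult_left_mono) auto
    then have "s * \<bar>tstep' m s\<bar> \<le> 2 * B" using s by simp
    with V(2) have "V * (s * \<bar>tstep' m s\<bar>) \<le> I * (2 * B)"
      by (rule mult_mono[OF _ _ I0]) (use s(1) in simp)
    then show ?thesis using V s by (simp add: abs_mult)
  qed
  have b3: "\<bar>P * (s * tstep'' m s)\<bar> \<le> 4 * B * J"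
  proof -
    have "s * \<bar>tstep'' m s\<bar> \<le> s * (4 * B / s\<^sup>2)" using \<sigma>2 s by (intro mult_left_mono) auto
    also have "\<dots> = 4 * B / s" using s(1) by (simp add: power2_eq_square)
    finally have "P * (s * \<bar>tstep'' m s\<bar>) \<le> P * (4 * B / s)" using P by (intro mult_left_mono) auto
    also have "\<dots> = 4 * B * (P / s)" by simp
    also have "\<dots> \<le> 4 * B * J" using P B(1) by (intro mult_left_mono) auto
    finally show ?thesis using P s by (simp add: abs_mult)
  qed
  have b_le: "\<bar>b\<bar> \<le> w r + I + 8 * (B * I) + 16 * (B * J)"
    unfolding b using hV b2 b3 by (simp add: mult_ac)
  have BI: "0 \<le> B * I" "0 \<le> B * J" "0 \<le> B * w r" using B(1) I0 J0 h by simp_all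
  have wr: "0 \<le> w r" using h by linarith
  have "\<bar>a\<bar> + \<bar>b\<bar> \<le> (2 + 28 * B) * (w r + I + J)"
    using a_le b_le BI wr I0 J0 by (simp add: distrib_left distrib_right)
  also have "w r + I + J = Bw w x" using r by (simp add: Bw_def wt_def r_def I_def J_def)
  finally show "\<bar>a\<bar> + \<bar>b\<bar> \<le> (2 + 28 * B) * Bw w x" .
  have "J \<le> I"
  proof -
    have "int2 w r / r\<^sup>2 \<le> (r * int1 w r) / r\<^sup>2" using int2_le[OF w, of r] r by (intro divide_right_mono) auto
    then show ?thesis using r by (simp add: I_def J_def power2_eq_square)
  qed
  then have "B * J \<le> B * I" using B(1) by simp
  then have "\<bar>a\<bar> \<le> (2 + 28 * B) * I" using a_le BI I0 by (simp add: distrib_right)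
  then have "\<bar>a\<bar> * r \<le> (2 + 28 * B) * I * r" using r by (intro mult_right_mono) auto
  then show "\<bar>a\<bar> * norm x \<le> (2 + 28 * B) * int1 w (norm x)" using r by (simp add: I_def r_def)
qed

lemma cut_average_tendsto:
  fixes x :: "real^'n"
  assumes x: "x \<noteq> 0" and c: "isCont w (norm x)"
  defines "d \<equiv> \<lambda>n. inverse (real (Suc n))"
  shows "(\<lambda>n. 2 * cut1 (pot (d n) w) (pot' (d n) w) (real (Suc n)) (sqn x)) \<longlonglongrightarrow> alim x"
    "(\<lambda>n. 4 * sqn x * cut2 (pot (d n) w) (pot' (d n) w) (pot'' (d n) w) (real (Suc n)) (sqn x)) \<longlonglongrightarrow> blim x"
proof -
  have r: "norm x > 0" and s: "sqn x > 0" and d: "d n > 0" for n using x by (simp_all add: d_def)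
  obtain n0 :: nat where n0: "sqn x \<le> real n0" using real_arch_simple by blast
  have p: "pot' (d n) w (sqn x) = int1 (average (d n) w) (norm x) / (2 * norm x)"
    "pot'' (d n) w (sqn x) = (average (d n) w (norm x) - int1 (average (d n) w) (norm x) / norm x) / (4 * sqn x)" for n
    using pot_pos[OF w d s, of n] by simp_all
  have e: "2 * cut1 (pot (d n) w) (pot' (d n) w) (real (Suc n)) (sqn x) = int1 (average (d n) w) (norm x) / norm x \<and>
    4 * sqn x * cut2 (pot (d n) w) (pot' (d n) w) (pot'' (d n) w) (real (Suc n)) (sqn x)
      = average (d n) w (norm x) - int1 (average (d n) w) (norm x) / norm x" if "n \<ge> n0" for n
  proof -
    have le: "sqn x \<le> real (Suc n)" using n0 that by simp
    have t: "tstep (real (Suc n)) (sqn x) = 1" "tstep' (real (Suc n)) (sqn x) = 0" "tstep'' (real (Suc n)) (sqn x) = 0"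
      by (rule tstep_left[OF _ le]; simp)+
    show ?thesis unfolding cut1_def cut2_def t p using s by simp
  qed
  have l: "(\<lambda>n. int1 (average (d n) w) (norm x) / norm x) \<longlonglongrightarrow> alim x"
    unfolding alim_def d_def by (intro tendsto_intros int1_average_tendsto[OF w]) (use r in simp)
  show "(\<lambda>n. 2 * cut1 (pot (d n) w) (pot' (d n) w) (real (Suc n)) (sqn x)) \<longlonglongrightarrow> alim x"
  proof (rule Lim_transform_eventually[OF l])
    show "\<forall>\<^sub>F n in sequentially. int1 (average (d n) w) (norm x) / norm x
        = 2 * cut1 (pot (d n) w) (pot' (d n) w) (real (Suc n)) (sqn x)"
      unfolding eventually_sequentially using e by metis
  qed
  have l2: "(\<lambda>n. average (d n) w (norm x) - int1 (average (d n) w) (norm x) / norm x) \<longlonglongrightarrow> blim x"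
  proof -
    have "(\<lambda>n. average (d n) w (norm x)) \<longlonglongrightarrow> w (norm x)" unfolding d_def by (rule average_tendsto[OF w r c])
    then have "(\<lambda>n. average (d n) w (norm x) - int1 (average (d n) w) (norm x) / norm x) \<longlonglongrightarrow> w (norm x) - alim x"
      using l by (rule tendsto_diff)
    then show ?thesis using r by (simp add: blim_def wt_def)
  qed
  show "(\<lambda>n. 4 * sqn x * cut2 (pot (d n) w) (pot' (d n) w) (pot'' (d n) w) (real (Suc n)) (sqn x)) \<longlonglongrightarrow> blim x"
  proof (rule Lim_transform_eventually[OF l2])
    show "\<forall>\<^sub>F n in sequentially. average (d n) w (norm x) - int1 (average (d n) w) (norm x) / norm x
        = 4 * sqn x * cut2 (pot (d n) w) (pot' (d n) w) (pot'' (d n) w) (real (Suc n)) (sqn x)"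
      unfolding eventually_sequentially using e by metis
  qed
qed

lemma cut0_pot_bound:
  assumes \<delta>: "\<delta> > 0" shows "\<bar>cut0 (pot \<delta> w) m (sqn x)\<bar> \<le> int2 w (norm (x :: real^'n))"
proof (cases "x = 0")
  case True
  then show ?thesis using \<delta> int2_nonneg[OF w] by (simp add: cut0_def pot_def)
next
  case False
  then have "pot \<delta> w (sqn x) = int1 (int1 (average \<delta> w)) (norm x)" using pot_pos(1)[OF w \<delta>, of "sqn x"] by simp
  then have p: "0 \<le> pot \<delta> w (sqn x)" "pot \<delta> w (sqn x) \<le> int2 w (norm x)" using V_bounds(3,4)[OF w \<delta>] by simp_all
  have "pot \<delta> w (sqn x) * tstep m (sqn x) \<le> pot \<delta> w (sqn x) * 1" by (intro mult_left_mono tstep_range p)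
  then show ?thesis using p tstep_range(1)[of m "sqn x"] by (simp add: cut0_def abs_mult)
qed

text \<open>On \<open>[\<tau>, 2\<tau>]\<close> with \<open>\<tau> \<ge> 1\<close> one has \<open>1 + t\<^sup>2 \<le> 5 \<tau>\<^sup>2\<close>, whence the factor \<open>5\<close>.\<close>

lemma rhs_bound:
  assumes B: "B > 0" "\<And>\<tau> t. \<tau> > 0 \<Longrightarrow> \<bar>tstep'' \<tau> t\<bar> \<le> B / \<tau>\<^sup>2"
    and \<tau>: "\<tau> \<ge> 1" and e: "e \<ge> 0"
    and A: "(\<integral>\<^sup>+ (x, t). ennreal (\<rho> x t / (1 + t\<^sup>2) * int2 w (norm x)) \<partial>lebesgue_on (UNIV \<times> {\<tau>..2*\<tau>})) \<le> ennreal e"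
    and G: "\<And>x. \<bar>G x\<bar> \<le> int2 w (norm x)"
    and i: "integrable spacetime (\<lambda>z. \<rho> (fst z) (snd z) * G (fst z) * tstep'' \<tau> (snd z))"
  shows "(\<integral>z. \<rho> (fst z) (snd z) * G (fst z) * tstep'' \<tau> (snd z) \<partial>spacetime) \<le> 5 * B * e"
proof -
  let ?f = "\<lambda>z. \<rho> (fst z) (snd z) * G (fst z) * tstep'' \<tau> (snd z)"
  let ?h = "\<lambda>z. \<rho> (fst z) (snd z) / (1 + (snd z)\<^sup>2) * int2 w (norm (fst z))"
  let ?i = "\<lambda>z::(real^'n) \<times> real. indicator {\<tau>..2*\<tau>} (snd z) :: ennreal"
  have hm: "?h \<in> borel_measurable spacetime"
  proof -
    have "(\<lambda>x::real^'n. int2 w (norm x)) \<in> borel_measurable borel" using int2_borel[OF w] by simp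
    from space_fun_measurable[OF this]
    have 1: "(\<lambda>z::(real^'n) \<times> real. int2 w (norm (fst z))) \<in> borel_measurable spacetime" .
    have 2: "(\<lambda>z::(real^'n) \<times> real. 1 + (snd z)\<^sup>2) \<in> borel_measurable spacetime"
      by (rule time_fun_measurable) simp
    show ?thesis by (intro borel_measurable_times borel_measurable_divide rho_measurable 1 2)
  qed
  have "ennreal (norm (\<integral>z. ?f z \<partial>spacetime)) \<le> (\<integral>\<^sup>+ z. ennreal (norm (?f z)) \<partial>spacetime)"
    by (rule integral_norm_bound_ennreal[OF i])
  also have "\<dots> \<le> (\<integral>\<^sup>+ z. ennreal (5 * B) * (ennreal (?h z) * ?i z) \<partial>spacetime)"
  proof (rule nn_integral_mono_AE)
    show "AE z in spacetime. ennreal (norm (?f z)) \<le> ennreal (5 * B) * (ennreal (?h z) * ?i z)"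
      using nonneg_AE
    proof eventually_elim
      case (elim z)
      show ?case
      proof (cases "snd z \<in> {\<tau>..2*\<tau>}")
        case False
        then have "tstep'' \<tau> (snd z) = 0" using tstep_left(3)[of \<tau> "snd z"] tstep_right(3)[of \<tau> "snd z"] \<tau> by force
        then show ?thesis by simp
      next
        case True
        have "1 \<le> \<tau>\<^sup>2" using power_mono[of 1 \<tau> 2] \<tau> by simp
        moreover have "(snd z)\<^sup>2 \<le> (2 * \<tau>)\<^sup>2" by (rule power_mono) (use True \<tau> in auto)
        ultimately have t2: "1 + (snd z)\<^sup>2 \<le> 5 * \<tau>\<^sup>2" by (simp add: power_mult_distrib)
        have pos: "1 + (snd z)\<^sup>2 > 0" by (simp add: add_pos_nonneg)
        have "B * (1 + (snd z)\<^sup>2) \<le> B * (5 * \<tau>\<^sup>2)" by (rule mult_left_mono[OF t2]) (use B(1) in simp)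
        then have "B / \<tau>\<^sup>2 \<le> 5 * B / (1 + (snd z)\<^sup>2)" using pos \<tau> by (simp add: field_simps)
        then have t: "\<bar>tstep'' \<tau> (snd z)\<bar> \<le> 5 * B / (1 + (snd z)\<^sup>2)" using B(2)[of \<tau> "snd z"] \<tau> by linarith
        have "norm (?f z) = \<rho> (fst z) (snd z) * (\<bar>G (fst z)\<bar> * \<bar>tstep'' \<tau> (snd z)\<bar>)"
          using elim by (simp add: abs_mult)
        also have "\<dots> \<le> \<rho> (fst z) (snd z) * (int2 w (norm (fst z)) * (5 * B / (1 + (snd z)\<^sup>2)))"
          using elim G t int2_nonneg[OF w] by (intro mult_left_mono mult_mono) auto
        also have "\<dots> = 5 * B * ?h z" by simp
        finally have "ennreal (norm (?f z)) \<le> ennreal (5 * B * ?h z)" by (rule ennreal_leI)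
        also have "\<dots> = ennreal (5 * B) * ennreal (?h z)" using B(1) by (intro ennreal_mult') simp
        finally show ?thesis using True by simp
      qed
    qed
  qed
  also have "\<dots> = ennreal (5 * B) * (\<integral>\<^sup>+ z. ennreal (?h z) * ?i z \<partial>spacetime)"
  proof (rule nn_integral_cmult)
    have "?i \<in> borel_measurable spacetime"
    proof -
      have "(\<lambda>z::(real^'n) \<times> real. indicator {\<tau>..2*\<tau>} (snd z) :: real) \<in> borel_measurable spacetime"
        by (rule time_fun_measurable) simp
      then have "(\<lambda>z::(real^'n) \<times> real. ennreal (indicator {\<tau>..2*\<tau>} (snd z))) \<in> borel_measurable spacetime" by simp
      then show ?thesis by (simp only: ennreal_indicator)
    qed
    then show "(\<lambda>z. ennreal (?h z) * ?i z) \<in> borel_measurable spacetime"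
      using hm by (intro borel_measurable_times_ennreal) simp_all
  qed
  also have "(\<integral>\<^sup>+ z. ennreal (?h z) * ?i z \<partial>spacetime)
      = (\<integral>\<^sup>+ z. ennreal (?h z) * ?i z * indicator (UNIV \<times> {0..}) z \<partial>lebesgue)"
    by (rule nn_integral_restrict_space) (simp add: spacetime_set)
  also have "\<dots> = (\<integral>\<^sup>+ z. ennreal (?h z) * indicator (UNIV \<times> {\<tau>..2*\<tau>}) z \<partial>lebesgue)"
    by (rule nn_integral_cong) (use \<tau> in \<open>auto simp: indicator_def\<close>)
  also have "\<dots> = (\<integral>\<^sup>+ z. ennreal (?h z) \<partial>lebesgue_on (UNIV \<times> {\<tau>..2*\<tau>}))"
    by (rule nn_integral_restrict_space[symmetric]) (simp add: borel_closed closed_Times)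
  also have "ennreal (5 * B) * \<dots> \<le> ennreal (5 * B) * ennreal e"
    using A by (intro mult_left_mono) (simp_all add: case_prod_unfold)
  also have "\<dots> = ennreal (5 * B * e)" using B(1) by (intro ennreal_mult'[symmetric]) simp
  finally have "norm (\<integral>z. ?f z \<partial>spacetime) \<le> 5 * B * e" using B(1) e by (simp add: ennreal_le_iff)
  then show ?thesis by simp
qed

lemma limit_inequality:
  assumes B: "B > 0" "\<And>\<tau> t. \<tau> > 0 \<Longrightarrow> \<bar>tstep' \<tau> t\<bar> \<le> B / \<tau>" "\<And>\<tau> t. \<tau> > 0 \<Longrightarrow> \<bar>tstep'' \<tau> t\<bar> \<le> B / \<tau>\<^sup>2"
    and \<tau>: "\<tau> \<ge> 1" and e: "e \<ge> 0"
    and A: "(\<integral>\<^sup>+ (x, t). ennreal (\<rho> x t / (1 + t\<^sup>2) * int2 w (norm x)) \<partial>lebesgue_on (UNIV \<times> {\<tau>..2*\<tau>})) \<le> ennreal e"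
  shows "(\<integral>x. \<rho>\<^sub>0 x * (v\<^sub>0 x \<bullet> x) * alim x \<partial>lebesgue)
    + (\<integral>z. dens alim blim (fst z) (snd z) * tstep \<tau> (snd z) \<partial>spacetime) \<le> 5 * B * e"
proof -
  have \<tau>0: "\<tau> > 0" using \<tau> by simp
  define d where "d n = inverse (real (Suc n))" for n
  define m where "m n = real (Suc n)" for n
  have d: "d n > 0" and m: "m n > 0" for n by (simp_all add: d_def m_def)
  define a where "a n x = 2 * cut1 (pot (d n) w) (pot' (d n) w) (m n) (sqn x)" for n and x :: "real^'n"
  define b where "b n x = 4 * sqn x * cut2 (pot (d n) w) (pot' (d n) w) (pot'' (d n) w) (m n) (sqn x)" for n and x :: "real^'n"
  have c0: "continuous_on UNIV (pot (d n) w)" "continuous_on UNIV (pot' (d n) w)" "continuous_on UNIV (pot'' (d n) w)" for n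
    using pot_derivs[OF w d] DERIV_isCont by (simp_all add: continuous_on_eq_continuous_at) blast+
  have cc: "continuous_on UNIV (\<lambda>s. 2 * cut1 (pot (d n) w) (pot' (d n) w) (m n) s)"
    "continuous_on UNIV (\<lambda>s. 4 * s * cut2 (pot (d n) w) (pot' (d n) w) (pot'' (d n) w) (m n) s)" for n
    unfolding cut1_def cut2_def by (intro continuous_intros c0 tstep_continuous[OF m] tstep''_continuous)+
  have meas: "a n \<in> borel_measurable borel" "b n \<in> borel_measurable borel" for n
    unfolding a_def b_def using sqn_comp_borel[OF cc(1)[of n]] sqn_comp_borel[OF cc(2)[of n]] by simp_all
  have bd: "AE x in lebesgue. \<bar>a n x\<bar> + \<bar>b n x\<bar> \<le> (2 + 28 * B) * Bw w x"
    "AE x in lebesgue. \<bar>a n x\<bar> * norm x \<le> (2 + 28 * B) * int1 w (norm x)" for n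
  proof -
    have "\<bar>a n x\<bar> + \<bar>b n x\<bar> \<le> (2 + 28 * B) * Bw w x" "\<bar>a n x\<bar> * norm x \<le> (2 + 28 * B) * int1 w (norm x)"
      if "x \<noteq> 0" for x
      unfolding a_def b_def using cut_average_bounds[OF B m[of n] d[of n] that] by blast+
    then show "AE x in lebesgue. \<bar>a n x\<bar> + \<bar>b n x\<bar> \<le> (2 + 28 * B) * Bw w x"
      "AE x in lebesgue. \<bar>a n x\<bar> * norm x \<le> (2 + 28 * B) * int1 w (norm x)"
      using AE_nonzero[where 'n='n] by (auto elim: eventually_mono)
  qed
  have lim: "AE x in lebesgue. (\<lambda>n. a n x) \<longlonglongrightarrow> alim x" "AE x in lebesgue. (\<lambda>n. b n x) \<longlonglongrightarrow> blim x"
  proof -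
    have ae: "AE x in lebesgue. x \<noteq> 0 \<and> isCont w (norm (x::real^'n))"
      using AE_nonzero AE_norm_notin_countable[OF weight_continuity_points[OF w]]
      by eventually_elim auto
    show "AE x in lebesgue. (\<lambda>n. a n x) \<longlonglongrightarrow> alim x" "AE x in lebesgue. (\<lambda>n. b n x) \<longlonglongrightarrow> blim x"
      unfolding a_def b_def d_def m_def
      using ae cut_average_tendsto by (auto elim: eventually_mono)
  qed
  have "(\<lambda>n. (\<integral>x. \<rho>\<^sub>0 x * (v\<^sub>0 x \<bullet> x) * a n x \<partial>lebesgue)
      + (\<integral>z. dens (a n) (b n) (fst z) (snd z) * tstep \<tau> (snd z) \<partial>spacetime))
    \<longlonglongrightarrow> (\<integral>x. \<rho>\<^sub>0 x * (v\<^sub>0 x \<bullet> x) * alim x \<partial>lebesgue)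
      + (\<integral>z. dens alim blim (fst z) (snd z) * tstep \<tau> (snd z) \<partial>spacetime)"
    by (rule tendsto_add[OF dens_tendsto[OF \<tau>0 meas lim_borel bd lim]])
  moreover have "(\<integral>x. \<rho>\<^sub>0 x * (v\<^sub>0 x \<bullet> x) * a n x \<partial>lebesgue)
      + (\<integral>z. dens (a n) (b n) (fst z) (snd z) * tstep \<tau> (snd z) \<partial>spacetime) \<le> 5 * B * e" for n
  proof -
    note id = C2_identity[OF m[of n] \<tau>0 pot_derivs(1)[OF w d[of n]] pot_derivs(2)[OF w d[of n]] c0(3)[of n]]
    have "(\<integral>z. \<rho> (fst z) (snd z) * cut0 (pot (d n) w) (m n) (sqn (fst z)) * tstep'' \<tau> (snd z) \<partial>spacetime) \<le> 5 * B * e"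
      by (rule rhs_bound[OF B(1,3) \<tau> e A cut0_pot_bound[OF d] id(2)])
    then show ?thesis using id(1) unfolding a_def b_def by simp
  qed
  ultimately show ?thesis by (intro LIMSEQ_le_const2) auto
qed

text \<open>The limit \<open>\<tau> \<rightarrow> \<infinity>\<close>, by monotone convergence.\<close>

lemma virial_inequality:
  assumes B: "B > 0" "\<And>\<tau> t. \<tau> > 0 \<Longrightarrow> \<bar>tstep' \<tau> t\<bar> \<le> B / \<tau>" "\<And>\<tau> t. \<tau> > 0 \<Longrightarrow> \<bar>tstep'' \<tau> t\<bar> \<le> B / \<tau>\<^sup>2"
    and K: "K\<^sub>1 \<ge> 0" and A: "condition_A w K\<^sub>1 \<rho>"
    and nn: "AE z in spacetime. dens alim blim (fst z) (snd z) \<ge> 0"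
  shows "enn2ereal (\<integral>\<^sup>+ z. ennreal (dens alim blim (fst z) (snd z)) \<partial>spacetime)
    + ereal (\<integral>x. \<rho>\<^sub>0 x * (v\<^sub>0 x \<bullet> x) * alim x \<partial>lebesgue) \<le> ereal (5 * B * K\<^sub>1)"
proof -
  let ?D = "\<lambda>z. dens alim blim (fst z) (snd z)"
  define I0 where "I0 = (\<integral>x. \<rho>\<^sub>0 x * (v\<^sub>0 x \<bullet> x) * alim x \<partial>lebesgue)"
  define X where "X = (\<integral>\<^sup>+ z. ennreal (?D z) \<partial>spacetime)"
  let ?F = "\<lambda>\<tau>. \<integral>\<^sup>+ (x, t). ennreal (\<rho> x t / (1 + t\<^sup>2) * int2 w (norm x)) \<partial>lebesgue_on (UNIV \<times> {\<tau>..2*\<tau>})"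
  have Dm: "(\<lambda>z. ennreal (?D z)) \<in> borel_measurable spacetime" using dens_measurable[OF lim_borel] by simp
  have step: "X \<le> ennreal (5 * B * e - I0) \<and> 0 \<le> 5 * B * e - I0" if e: "e > K\<^sub>1" for e
  proof -
    have e0: "e \<ge> 0" "e > 0" using e K by auto
    have "Limsup at_top ?F < ennreal e"
      using A e K e0 unfolding condition_A_def by (meson le_less_trans ennreal_lessI)
    then have "\<forall>\<^sub>F \<tau> in at_top. ?F \<tau> < ennreal e" by (rule Limsup_lessD)
    then obtain \<tau>0 where \<tau>0: "\<And>\<tau>. \<tau> \<ge> \<tau>0 \<Longrightarrow> ?F \<tau> < ennreal e" unfolding eventually_at_top_linorder by blast
    have bound: "(\<integral>\<^sup>+ z. ennreal (?D z) * indicator {..T} (snd z) \<partial>spacetime) \<le> ennreal (5 * B * e - I0)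
        \<and> 0 \<le> 5 * B * e - I0" for T
    proof -
      define \<tau> where "\<tau> = max 1 (max T \<tau>0)"
      have \<tau>: "\<tau> \<ge> 1" "\<tau> \<ge> T" "\<tau> \<ge> \<tau>0" by (simp_all add: \<tau>_def)
      have \<tau>p: "\<tau> > 0" using \<tau>(1) by simp
      have ineq: "I0 + (\<integral>z. ?D z * tstep \<tau> (snd z) \<partial>spacetime) \<le> 5 * B * e"
        unfolding I0_def by (rule limit_inequality[OF B \<tau>(1) e0(1) less_imp_le[OF \<tau>0[OF \<tau>(3)]]])
      have Di: "integrable spacetime (\<lambda>z. ?D z * tstep \<tau> (snd z))"
        by (rule dens_integrable[OF \<tau>p lim_borel, where c=2]) (rule AE_I2, rule lim_bound)
      have Dn: "AE z in spacetime. 0 \<le> ?D z * tstep \<tau> (snd z)"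
        using nn by eventually_elim (simp add: tstep_range)
      have "(\<integral>\<^sup>+ z. ennreal (?D z) * indicator {..T} (snd z) \<partial>spacetime)
        \<le> (\<integral>\<^sup>+ z. ennreal (?D z * tstep \<tau> (snd z)) \<partial>spacetime)"
      proof (rule nn_integral_mono)
        fix z :: "(real^'n) \<times> real"
        show "ennreal (?D z) * indicator {..T} (snd z) \<le> ennreal (?D z * tstep \<tau> (snd z))"
          using tstep_left(1)[OF \<tau>p, of "snd z"] \<tau>(2) by (auto simp: indicator_def)
      qed
      also have "\<dots> = ennreal (\<integral>z. ?D z * tstep \<tau> (snd z) \<partial>spacetime)"
        by (rule nn_integral_eq_integral[OF Di Dn])
      also have "\<dots> \<le> ennreal (5 * B * e - I0)" using ineq by (intro ennreal_leI) linarith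
      finally show ?thesis using ineq integral_nonneg_AE[OF Dn] by simp
    qed
    have "(\<lambda>n. \<integral>\<^sup>+ z. ennreal (?D z) * indicator {..real n} (snd z) \<partial>spacetime) \<longlonglongrightarrow> X"
      unfolding X_def
    proof (rule nn_integral_LIMSEQ)
      show "incseq (\<lambda>n z. ennreal (?D z) * indicator {..real n} (snd z))"
        by (auto simp: incseq_def le_fun_def indicator_def)
      show "(\<lambda>z. ennreal (?D z) * indicator {..real n} (snd z)) \<in> borel_measurable spacetime" for n
      proof (rule borel_measurable_times_ennreal[OF Dm])
        have "(\<lambda>z::(real^'n) \<times> real. indicator {..real n} (snd z) :: real) \<in> borel_measurable spacetime"
          by (rule time_fun_measurable) simp
        then have "(\<lambda>z::(real^'n) \<times> real. ennreal (indicator {..real n} (snd z))) \<in> borel_measurable spacetime" by simp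
        then show "(\<lambda>z::(real^'n) \<times> real. indicator {..real n} (snd z) :: ennreal) \<in> borel_measurable spacetime"
          by (simp only: ennreal_indicator)
      qed
      fix z :: "(real^'n) \<times> real"
      obtain n0 :: nat where "snd z \<le> real n0" using real_arch_simple by blast
      then have "\<forall>\<^sub>F n in sequentially. ennreal (?D z) * indicator {..real n} (snd z) = ennreal (?D z)"
        by (auto simp: eventually_sequentially indicator_def intro!: exI[of _ n0])
      then show "(\<lambda>n. ennreal (?D z) * indicator {..real n} (snd z)) \<longlonglongrightarrow> ennreal (?D z)" by (rule tendsto_eventually)
    qed
    then have "X \<le> ennreal (5 * B * e - I0)"
      by (rule LIMSEQ_le_const2) (use bound in blast)
    then show ?thesis using bound[of 0] by blast
  qed
  have Xfin: "X \<noteq> \<top>" using step[of "K\<^sub>1 + 1"] by (metis ennreal_neq_top less_add_one neq_top_trans)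
  then obtain x where x: "X = ennreal x" "x \<ge> 0" by (cases X) auto
  have "x + I0 \<le> 5 * B * K\<^sub>1 + \<epsilon>" if "\<epsilon> > 0" for \<epsilon>
  proof -
    have "\<epsilon> / (5 * B) > 0" using that B(1) by simp
    then have s: "ennreal x \<le> ennreal (5 * B * (K\<^sub>1 + \<epsilon> / (5 * B)) - I0)" "0 \<le> 5 * B * (K\<^sub>1 + \<epsilon> / (5 * B)) - I0"
      using step[of "K\<^sub>1 + \<epsilon> / (5 * B)"] unfolding x(1) by auto
    then have "x \<le> 5 * B * (K\<^sub>1 + \<epsilon> / (5 * B)) - I0" by (simp only: ennreal_le_iff)
    moreover have "5 * B * (K\<^sub>1 + \<epsilon> / (5 * B)) = 5 * B * K\<^sub>1 + \<epsilon>" using B(1) by (simp add: distrib_left)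
    ultimately show ?thesis by linarith
  qed
  then have "x + I0 \<le> 5 * B * K\<^sub>1" by (rule field_le_epsilon)
  then show ?thesis unfolding X_def[symmetric] I0_def[symmetric] x(1) using x(2) by (simp add: enn2ereal_ennreal)
qed

end

section \<open>The two cases\<close>

context flow begin

lemma moment_eq: "\<rho>\<^sub>0 x * (v\<^sub>0 x \<bullet> x) * alim x = \<rho>\<^sub>0 x * (v\<^sub>0 x \<bullet> (x /\<^sub>R norm x)) * int1 w (norm x)"
  by (simp add: alim_def divide_inverse)

text \<open>The flux of the limiting potential, grouped as in the conclusion for \<open>N \<ge> 3\<close>.\<close>

lemma dens_lim_eq:
  assumes x: "x \<noteq> 0"
  shows "dens alim blim x t =
     \<rho> x t * (w (norm x) * ((v x t \<bullet> x)\<^sup>2 / (norm x)\<^sup>2)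
        + int1 w (norm x) / norm x * ((norm (v x t))\<^sup>2 - (v x t \<bullet> x)\<^sup>2 / (norm x)\<^sup>2))
   + p (\<rho> x t) * (w (norm x) + (real CARD('n) - 1) / norm x * int1 w (norm x))
   + (real CARD('n) - 3) * k / 2 * ((norm (g x t))\<^sup>2 / norm x * int1 w (norm x))
   + k * ((int1 w (norm x) / norm x - w (norm x)) * ((x \<bullet> g x t)\<^sup>2 / (norm x)\<^sup>2))
   + k / 2 * ((norm (g x t))\<^sup>2 * w (norm x))"
proof -
  define I where "I = int1 w (norm x) / norm x"
  define q where "q = (v x t \<bullet> x)\<^sup>2 / (norm x)\<^sup>2"
  define q' where "q' = (x \<bullet> g x t)\<^sup>2 / (norm x)\<^sup>2"
  define W where "W = w (norm x)"
  have c: "alim x = I" "blim x = W - I" using x by (simp_all add: alim_def blim_def I_def W_def wt_def)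
  have e: "(real CARD('n) - 1) / norm x * int1 w (norm x) = (real CARD('n) - 1) * I"
    "(norm (g x t))\<^sup>2 / norm x * int1 w (norm x) = (norm (g x t))\<^sup>2 * I" by (simp_all add: I_def)
  show ?thesis
    unfolding dens_def c e I_def[symmetric] q_def[symmetric] q'_def[symmetric] W_def[symmetric]
    by (simp add: field_simps)
qed

lemma quot_le: "(y \<bullet> x)\<^sup>2 / (norm x)\<^sup>2 \<le> (norm y)\<^sup>2" for x y :: "real^'n"
  using quad_bound[of 0 y 1 x] by simp

lemma weight_le_mean: "x \<noteq> 0 \<Longrightarrow> w (norm x) \<le> int1 w (norm x) / norm x" for x :: "real^'n"
  using int1_ge[OF w, of "norm x"] by (simp add: pos_le_divide_eq mult.commute)

lemma lim_terms_nonneg: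
  assumes x: "x \<noteq> 0" and nn: "\<rho> x t \<ge> 0" "p (\<rho> x t) \<ge> 0"
  shows "0 \<le> \<rho> x t * (w (norm x) * ((v x t \<bullet> x)\<^sup>2 / (norm x)\<^sup>2)
        + int1 w (norm x) / norm x * ((norm (v x t))\<^sup>2 - (v x t \<bullet> x)\<^sup>2 / (norm x)\<^sup>2))"
    "0 \<le> p (\<rho> x t) * (w (norm x) + (real CARD('n) - 1) / norm x * int1 w (norm x))"
    "0 \<le> (norm (g x t))\<^sup>2 / norm x * int1 w (norm x)"
    "0 \<le> (int1 w (norm x) / norm x - w (norm x)) * ((x \<bullet> g x t)\<^sup>2 / (norm x)\<^sup>2)"
    "0 \<le> (norm (g x t))\<^sup>2 * w (norm x)"
proof -
  have W: "0 < w (norm x)" using weight_pos[OF w] x by simp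
  have I: "0 \<le> int1 w (norm x)" by (rule int1_nonneg[OF w])
  have n: "real CARD('n) - 1 \<ge> 0" by (simp add: Suc_le_eq)
  have q: "(v x t \<bullet> x)\<^sup>2 / (norm x)\<^sup>2 \<le> (norm (v x t))\<^sup>2" by (rule quot_le)
  show "0 \<le> \<rho> x t * (w (norm x) * ((v x t \<bullet> x)\<^sup>2 / (norm x)\<^sup>2)
        + int1 w (norm x) / norm x * ((norm (v x t))\<^sup>2 - (v x t \<bullet> x)\<^sup>2 / (norm x)\<^sup>2))"
    using W I q nn by (intro mult_nonneg_nonneg add_nonneg_nonneg divide_nonneg_nonneg) auto
  show "0 \<le> p (\<rho> x t) * (w (norm x) + (real CARD('n) - 1) / norm x * int1 w (norm x))"
    using W I n nn by (intro mult_nonneg_nonneg add_nonneg_nonneg divide_nonneg_nonneg) auto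
  show "0 \<le> (norm (g x t))\<^sup>2 / norm x * int1 w (norm x)" using I by simp
  show "0 \<le> (int1 w (norm x) / norm x - w (norm x)) * ((x \<bullet> g x t)\<^sup>2 / (norm x)\<^sup>2)"
    using weight_le_mean[OF x] by (intro mult_nonneg_nonneg) auto
  show "0 \<le> (norm (g x t))\<^sup>2 * w (norm x)" using W by simp
qed

lemma nonzero_nonneg_AE: "AE z in spacetime. fst z \<noteq> 0 \<and> \<rho> (fst z) (snd z) \<ge> 0 \<and> p (\<rho> (fst z) (snd z)) \<ge> 0"
  using nonneg_AE AE_spacetime_space[OF AE_nonzero] by eventually_elim simp

lemma nn_integral_dens_split:
  assumes N: "CARD('n) \<ge> 3"
  shows "(\<integral>\<^sup>+ z. ennreal (dens alim blim (fst z) (snd z)) \<partial>spacetime) =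
    (\<integral>\<^sup>+ (x, t). ennreal (\<rho> x t * (w (norm x) * ((v x t \<bullet> x)\<^sup>2 / (norm x)\<^sup>2) +
        int1 w (norm x) / norm x * ((norm (v x t))\<^sup>2 - (v x t \<bullet> x)\<^sup>2 / (norm x)\<^sup>2))) \<partial>spacetime)
   + (\<integral>\<^sup>+ (x, t). ennreal (p (\<rho> x t) *
        (w (norm x) + (real CARD('n) - 1) / norm x * int1 w (norm x))) \<partial>spacetime)
   + ennreal ((real CARD('n) - 3) * k / 2) *
       (\<integral>\<^sup>+ (x, t). ennreal ((norm (g x t))\<^sup>2 / norm x * int1 w (norm x)) \<partial>spacetime)
   + ennreal k * (\<integral>\<^sup>+ (x, t). ennreal ((int1 w (norm x) / norm x - w (norm x)) *
        ((x \<bullet> g x t)\<^sup>2 / (norm x)\<^sup>2)) \<partial>spacetime)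
   + ennreal (k / 2) * (\<integral>\<^sup>+ (x, t). ennreal ((norm (g x t))\<^sup>2 * w (norm x)) \<partial>spacetime)"
proof -
  \<comment> \<open>The weight enters through its Borel version, which agrees with it off the origin.\<close>
  define f1 where "f1 W x t = \<rho> x t * (W * ((v x t \<bullet> x)\<^sup>2 / (norm x)\<^sup>2)
        + int1 w (norm x) / norm x * ((norm (v x t))\<^sup>2 - (v x t \<bullet> x)\<^sup>2 / (norm x)\<^sup>2))" for W t and x :: "real^'n"
  define f2 where "f2 W x t = p (\<rho> x t) * (W + (real CARD('n) - 1) / norm x * int1 w (norm x))" for W :: real and t and x :: "real^'n"
  define f3 where "f3 x t = (norm (g x t))\<^sup>2 / norm x * int1 w (norm x)" for t and x :: "real^'n"
  define f4 where "f4 W x t = (int1 w (norm x) / norm x - W) * ((x \<bullet> g x t)\<^sup>2 / (norm x)\<^sup>2)" for W t and x :: "real^'n"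
  define f5 where "f5 W x t = (norm (g x t))\<^sup>2 * W" for W t and x :: "real^'n"
  let ?W = "\<lambda>x::real^'n. wt w (norm x)" and ?w = "\<lambda>x::real^'n. w (norm x)"
  let ?c = "(real CARD('n) - 3) * k / 2"
  have c0: "?c \<ge> 0" "k / 2 \<ge> 0" using N k by simp_all
  have wm: "(\<lambda>z::(real^'n) \<times> real. ?W (fst z)) \<in> borel_measurable spacetime"
    by (rule space_fun_measurable) (use wt_borel[OF w] in simp)
  have im: "(\<lambda>z::(real^'n) \<times> real. int1 w (norm (fst z))) \<in> borel_measurable spacetime"
    by (rule space_fun_measurable) (use int1_borel[OF w] in simp)
  note [measurable] = rho_measurable v_measurable g_measurable p_measurable space_measurable wm im
  have m1[measurable]: "(\<lambda>z. f1 (?W (fst z)) (fst z) (snd z)) \<in> borel_measurable spacetime"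
    unfolding f1_def by measurable
  have m2[measurable]: "(\<lambda>z. f2 (?W (fst z)) (fst z) (snd z)) \<in> borel_measurable spacetime"
    unfolding f2_def by measurable
  have m3[measurable]: "(\<lambda>z. f3 (fst z) (snd z)) \<in> borel_measurable spacetime"
    unfolding f3_def by measurable
  have m4[measurable]: "(\<lambda>z. f4 (?W (fst z)) (fst z) (snd z)) \<in> borel_measurable spacetime"
    unfolding f4_def by measurable
  have m5[measurable]: "(\<lambda>z. f5 (?W (fst z)) (fst z) (snd z)) \<in> borel_measurable spacetime"
    unfolding f5_def by measurable
  have Ww: "AE z in spacetime. ?W (fst z) = ?w (fst (z :: (real^'n) \<times> real))"
    using AE_spacetime_space[OF AE_nonzero] by eventually_elim (simp add: wt_def)
  have sw: "(\<integral>\<^sup>+ z. ennreal (f (?w (fst z)) (fst z) (snd z)) \<partial>spacetime)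
      = (\<integral>\<^sup>+ z. ennreal (f (?W (fst z)) (fst z) (snd z)) \<partial>spacetime)" for f :: "real \<Rightarrow> real^'n \<Rightarrow> real \<Rightarrow> real"
    by (rule nn_integral_cong_AE) (use Ww in \<open>auto elim: eventually_mono\<close>)
  have "(\<integral>\<^sup>+ z. ennreal (dens alim blim (fst z) (snd z)) \<partial>spacetime)
    = (\<integral>\<^sup>+ z. ennreal (f1 (?W (fst z)) (fst z) (snd z)) + ennreal (f2 (?W (fst z)) (fst z) (snd z))
        + ennreal ?c * ennreal (f3 (fst z) (snd z)) + ennreal k * ennreal (f4 (?W (fst z)) (fst z) (snd z))
        + ennreal (k / 2) * ennreal (f5 (?W (fst z)) (fst z) (snd z)) \<partial>spacetime)"
  proof (rule nn_integral_cong_AE)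
    show "AE z in spacetime. ennreal (dens alim blim (fst z) (snd z)) =
      ennreal (f1 (?W (fst z)) (fst z) (snd z)) + ennreal (f2 (?W (fst z)) (fst z) (snd z))
        + ennreal ?c * ennreal (f3 (fst z) (snd z)) + ennreal k * ennreal (f4 (?W (fst z)) (fst z) (snd z))
        + ennreal (k / 2) * ennreal (f5 (?W (fst z)) (fst z) (snd z))"
      using nonzero_nonneg_AE Ww
    proof eventually_elim
      case (elim z)
      obtain x t where z: "z = (x, t)" by (cases z)
      have e: "x \<noteq> 0" "\<rho> x t \<ge> 0" "p (\<rho> x t) \<ge> 0" "?W x = ?w x" using elim by (simp_all add: z)
      note nn = lim_terms_nonneg[OF e(1-3), folded f1_def f2_def f3_def f4_def f5_def]
      have d: "dens alim blim x t = f1 (?w x) x t + f2 (?w x) x t + ?c * f3 x t + k * f4 (?w x) x t + k / 2 * f5 (?w x) x t"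
        unfolding dens_lim_eq[OF e(1)] f1_def f2_def f3_def f4_def f5_def ..
      have p: "0 \<le> ?c * f3 x t" "0 \<le> k * f4 (?w x) x t" "0 \<le> k / 2 * f5 (?w x) x t"
        by (rule mult_nonneg_nonneg[OF c0(1) nn(3)], rule mult_nonneg_nonneg[OF k nn(4)],
            rule mult_nonneg_nonneg[OF c0(2) nn(5)])
      have "ennreal (dens alim blim x t) = ennreal (f1 (?w x) x t) + ennreal (f2 (?w x) x t)
          + ennreal (?c * f3 x t) + ennreal (k * f4 (?w x) x t) + ennreal (k / 2 * f5 (?w x) x t)"
        unfolding d using nn(1,2) p by (simp only: ennreal_plus add_nonneg_nonneg)
      then show ?case unfolding z fst_conv snd_conv e(4)
        by (simp only: ennreal_mult'[OF c0(1)] ennreal_mult'[OF k] ennreal_mult'[OF c0(2)])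
    qed
  qed
  also have "\<dots> = (\<integral>\<^sup>+ z. ennreal (f1 (?W (fst z)) (fst z) (snd z)) \<partial>spacetime)
      + (\<integral>\<^sup>+ z. ennreal (f2 (?W (fst z)) (fst z) (snd z)) \<partial>spacetime)
      + ennreal ?c * (\<integral>\<^sup>+ z. ennreal (f3 (fst z) (snd z)) \<partial>spacetime)
      + ennreal k * (\<integral>\<^sup>+ z. ennreal (f4 (?W (fst z)) (fst z) (snd z)) \<partial>spacetime)
      + ennreal (k / 2) * (\<integral>\<^sup>+ z. ennreal (f5 (?W (fst z)) (fst z) (snd z)) \<partial>spacetime)"
  proof -
    have e: "(\<lambda>z. ennreal (f1 (?W (fst z)) (fst z) (snd z))) \<in> borel_measurable spacetime"
      "(\<lambda>z. ennreal (f2 (?W (fst z)) (fst z) (snd z))) \<in> borel_measurable spacetime"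
      "(\<lambda>z. ennreal (f3 (fst z) (snd z))) \<in> borel_measurable spacetime"
      "(\<lambda>z. ennreal (f4 (?W (fst z)) (fst z) (snd z))) \<in> borel_measurable spacetime"
      "(\<lambda>z. ennreal (f5 (?W (fst z)) (fst z) (snd z))) \<in> borel_measurable spacetime"
      by measurable
    show ?thesis
      by (simp only: nn_integral_add nn_integral_cmult e borel_measurable_add borel_measurable_times_ennreal
          borel_measurable_const)
  qed
  finally show ?thesis
    unfolding sw[of f1, symmetric] sw[of f2, symmetric] sw[of f4, symmetric] sw[of f5, symmetric]
    unfolding f1_def f2_def f3_def f4_def f5_def case_prod_unfold .
qed

lemma dens_lim_nonneg:
  assumes N: "CARD('n) \<ge> 3"
  shows "AE z in spacetime. dens alim blim (fst z) (snd z) \<ge> 0"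
  using nonzero_nonneg_AE
proof eventually_elim
  case (elim z)
  have c: "(real CARD('n) - 3) * k / 2 \<ge> 0" "k / 2 \<ge> 0" using N k by simp_all
  have nz: "fst z \<noteq> 0" using elim by simp
  show ?case
    unfolding dens_lim_eq[OF nz]
    by (intro add_nonneg_nonneg lim_terms_nonneg mult_nonneg_nonneg[OF c(1)] mult_nonneg_nonneg[OF k]
        mult_nonneg_nonneg[OF c(2)]) (use elim in auto)
qed

lemma virial_case_3:
  assumes B: "B > 0" "\<And>\<tau> t. \<tau> > 0 \<Longrightarrow> \<bar>tstep' \<tau> t\<bar> \<le> B / \<tau>" "\<And>\<tau> t. \<tau> > 0 \<Longrightarrow> \<bar>tstep'' \<tau> t\<bar> \<le> B / \<tau>\<^sup>2"
    and N: "CARD('n) \<ge> 3" and K: "K\<^sub>1 \<ge> 0" and A: "condition_A w K\<^sub>1 \<rho>"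
  shows "enn2ereal
            ((\<integral>\<^sup>+ (x, t). ennreal (\<rho> x t *
                 (w (norm x) * ((v x t \<bullet> x)\<^sup>2 / (norm x)\<^sup>2) +
                  int1 w (norm x) / norm x *
                    ((norm (v x t))\<^sup>2 - (v x t \<bullet> x)\<^sup>2 / (norm x)\<^sup>2))) \<partial>spacetime)
           + (\<integral>\<^sup>+ (x, t). ennreal (p (\<rho> x t) *
                 (w (norm x) + (real CARD('n) - 1) / norm x * int1 w (norm x))) \<partial>spacetime)
           + ennreal ((real CARD('n) - 3) * k / 2) *
               (\<integral>\<^sup>+ (x, t). ennreal ((norm (wgrad \<Phi> x t))\<^sup>2 / norm x * int1 w (norm x))
                 \<partial>spacetime)
           + ennreal k *
               (\<integral>\<^sup>+ (x, t). ennreal ((int1 w (norm x) / norm x - w (norm x)) *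
                 ((x \<bullet> wgrad \<Phi> x t)\<^sup>2 / (norm x)\<^sup>2)) \<partial>spacetime)
           + ennreal (k / 2) *
               (\<integral>\<^sup>+ (x, t). ennreal ((norm (wgrad \<Phi> x t))\<^sup>2 * w (norm x)) \<partial>spacetime))
          + ereal (\<integral>x. \<rho>\<^sub>0 x * (v\<^sub>0 x \<bullet> (x /\<^sub>R norm x)) * int1 w (norm x) \<partial>lebesgue)
          \<le> ereal (5 * B * K\<^sub>1)"
  using virial_inequality[OF B K A dens_lim_nonneg[OF N]]
  unfolding nn_integral_dens_split[OF N] moment_eq .

end

subsection \<open>The constant weight in dimension two\<close>

lemma admissible_one: "admissible_weight (\<lambda>_. 1)"
proof -
  have "set_integrable lebesgue {0..R} (\<lambda>_. 1::real)" for R :: real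
    using indicator_interval_integrable[of R] by (simp add: set_integrable_def)
  then show ?thesis by (simp add: admissible_weight_def monotone_on_def)
qed

lemma int1_one: "r \<ge> 0 \<Longrightarrow> int1 (\<lambda>_. 1) r = r"
  using int1_const[of r 1] by simp

lemma int2_one:
  assumes "r \<ge> 0" shows "int2 (\<lambda>_. 1) r = r\<^sup>2 / 2"
proof -
  have "int2 (\<lambda>_. 1) r = int1 (int1 (\<lambda>_. 1)) r" by (simp only: int2_def int1_def[of "int1 (\<lambda>_. 1)"])
  also have "\<dots> = int1 (\<lambda>x. 1 * x) r" by (rule int1_cong) (simp add: int1_one)
  finally show ?thesis using int1_linear[OF assms, of 1] by simp
qed

lemma condition_A_one:
  assumes "condition_A2 K\<^sub>1 \<rho>" shows "condition_A (\<lambda>_. 1) K\<^sub>1 \<rho>"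
  unfolding condition_A_def
proof (rule order.trans[OF Limsup_mono[OF always_eventually]])
  show "Limsup at_top (\<lambda>\<tau>. \<integral>\<^sup>+ (x, t). ennreal (\<rho> x t / (1 + t\<^sup>2) * (norm x)\<^sup>2)
      \<partial>lebesgue_on (UNIV \<times> {\<tau>..2*\<tau>})) \<le> ennreal K\<^sub>1"
    using assms by (simp only: condition_A2_def)
  show "\<forall>\<tau>. (\<integral>\<^sup>+ (x, t). ennreal (\<rho> x t / (1 + t\<^sup>2) * int2 (\<lambda>_. 1) (norm x)) \<partial>lebesgue_on (UNIV \<times> {\<tau>..2*\<tau>}))
    \<le> (\<integral>\<^sup>+ (x, t). ennreal (\<rho> x t / (1 + t\<^sup>2) * (norm x)\<^sup>2) \<partial>lebesgue_on (UNIV \<times> {\<tau>..2*\<tau>}))"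
  proof (intro allI nn_integral_mono, clarify)
    fix x :: "real^2" and t :: real
    define y where "y = \<rho> x t / (1 + t\<^sup>2)"
    have "ennreal (y * ((norm x)\<^sup>2 / 2)) \<le> ennreal (y * (norm x)\<^sup>2)"
    proof (cases "y \<ge> 0")
      case True
      then show ?thesis by (intro ennreal_leI mult_left_mono) auto
    next
      case False
      then have "y * ((norm x)\<^sup>2 / 2) \<le> 0" by (intro mult_nonpos_nonneg) auto
      then show ?thesis by (simp add: ennreal_neg)
    qed
    then show "ennreal (\<rho> x t / (1 + t\<^sup>2) * int2 (\<lambda>_. 1) (norm x)) \<le> ennreal (\<rho> x t / (1 + t\<^sup>2) * (norm x)\<^sup>2)"
      by (simp only: y_def int2_one[OF norm_ge_zero])
  qed
qed

lemma nn_integral_strip: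
  fixes f :: "(real^'n::finite) \<times> real \<Rightarrow> ennreal"
  assumes "a \<ge> 0"
  shows "(\<integral>\<^sup>+ z. f z \<partial>lebesgue_on (UNIV \<times> {a..b})) = (\<integral>\<^sup>+ z. f z * indicator {a..b} (snd z) \<partial>spacetime)"
proof -
  have "(\<integral>\<^sup>+ z. f z \<partial>lebesgue_on (UNIV \<times> {a..b})) = (\<integral>\<^sup>+ z. f z * indicator (UNIV \<times> {a..b}) z \<partial>lebesgue)"
    by (rule nn_integral_restrict_space) (simp add: borel_closed closed_Times)
  also have "\<dots> = (\<integral>\<^sup>+ z. f z * indicator {a..b} (snd z) * indicator (UNIV \<times> {0..}) z \<partial>lebesgue)"
    by (rule nn_integral_cong) (use assms in \<open>auto simp: indicator_def\<close>)
  also have "\<dots> = (\<integral>\<^sup>+ z. f z * indicator {a..b} (snd z) \<partial>spacetime)"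
    by (rule nn_integral_restrict_space[symmetric]) (simp add: spacetime_set)
  finally show ?thesis .
qed

text \<open>For \<open>w = 1\<close> the weight of the energy is at most \<open>1 + 1 + 1 / 2\<close>.\<close>

lemma (in solution) condition_B_one:
  assumes fin: "\<And>T. T > 0 \<Longrightarrow> (\<integral>\<^sup>+ (x, t). ennreal (\<rho> x t * (norm (v x t))\<^sup>2 + p (\<rho> x t) + k * (norm (wgrad \<Phi> x t))\<^sup>2)
       \<partial>lebesgue_on (UNIV \<times> {0..T})) < \<infinity>"
  shows "condition_B k p (\<lambda>_. 1) \<rho> v \<Phi>"
  unfolding condition_B_def
proof (intro allI impI)
  fix T :: real assume T: "T > 0"
  let ?W = "\<lambda>x::real^'n. 1 + int1 (\<lambda>_. 1) (norm x) / norm x + int2 (\<lambda>_. 1) (norm x) / (norm x)\<^sup>2"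
  let ?i = "\<lambda>z::(real^'n) \<times> real. indicator {0..T} (snd z) :: ennreal"
  have W: "0 \<le> ?W x" "?W x \<le> 3" for x
    by (cases "x = 0"; simp add: int1_one int2_one)+
  have im: "?i \<in> borel_measurable spacetime"
  proof -
    have "(\<lambda>z::(real^'n) \<times> real. indicator {0..T} (snd z) :: real) \<in> borel_measurable spacetime"
      by (rule time_fun_measurable) simp
    then have "(\<lambda>z::(real^'n) \<times> real. ennreal (indicator {0..T} (snd z))) \<in> borel_measurable spacetime" by simp
    then show ?thesis by (simp only: ennreal_indicator)
  qed
  have "(\<integral>\<^sup>+ z. ennreal (energy (fst z) (snd z) * ?W (fst z)) * ?i z \<partial>spacetime)
    \<le> (\<integral>\<^sup>+ z. ennreal 3 * (ennreal (energy (fst z) (snd z)) * ?i z) \<partial>spacetime)"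
  proof (rule nn_integral_mono_AE)
    show "AE z in spacetime. ennreal (energy (fst z) (snd z) * ?W (fst z)) * ?i z
      \<le> ennreal 3 * (ennreal (energy (fst z) (snd z)) * ?i z)"
      using energy_nonneg
    proof eventually_elim
      case (elim z)
      have "energy (fst z) (snd z) * ?W (fst z) \<le> energy (fst z) (snd z) * 3"
        by (rule mult_left_mono[OF W(2) elim])
      then have "ennreal (energy (fst z) (snd z) * ?W (fst z)) \<le> ennreal (3 * energy (fst z) (snd z))"
        by (intro ennreal_leI) (simp only: mult.commute)
      also have "\<dots> = ennreal 3 * ennreal (energy (fst z) (snd z))" by (rule ennreal_mult') simp
      finally show ?case unfolding mult.assoc[symmetric] by (rule mult_right_mono) simp
    qed
  qed
  also have "\<dots> = ennreal 3 * (\<integral>\<^sup>+ z. ennreal (energy (fst z) (snd z)) * ?i z \<partial>spacetime)"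
    by (rule nn_integral_cmult, intro borel_measurable_times_ennreal im) (use energy_measurable in simp)
  also have "\<dots> < \<infinity>"
    using fin[OF T] nn_integral_strip[of 0 T "\<lambda>z. ennreal (energy (fst z) (snd z))"]
    by (simp add: energy_def case_prod_unfold ennreal_mult_less_top)
  finally show "(\<integral>\<^sup>+ (x, t). ennreal ((\<rho> x t * (norm (v x t))\<^sup>2 + p (\<rho> x t) + k * (norm (wgrad \<Phi> x t))\<^sup>2) * ?W x)
       \<partial>lebesgue_on (UNIV \<times> {0..T})) < \<infinity>"
    using nn_integral_strip[of 0 T "\<lambda>z. ennreal (energy (fst z) (snd z) * ?W (fst z))"]
    by (simp only: energy_def case_prod_unfold order_refl)
qed

lemma virial_case_2:
  fixes \<rho>\<^sub>0 :: "real^2 \<Rightarrow> real"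
  assumes step: "B > 0" "\<And>\<tau> t. \<tau> > 0 \<Longrightarrow> \<bar>tstep' \<tau> t\<bar> \<le> B / \<tau>" "\<And>\<tau> t. \<tau> > 0 \<Longrightarrow> \<bar>tstep'' \<tau> t\<bar> \<le> B / \<tau>\<^sup>2"
    and K: "K\<^sub>1 \<ge> 0" and k: "k \<ge> 0" and init: "initial_data \<rho>\<^sub>0 v\<^sub>0"
    and mom: "(\<integral>\<^sup>+ x. ennreal (\<rho>\<^sub>0 x * norm (v\<^sub>0 x) * norm x) \<partial>lebesgue) < \<infinity>"
    and sol: "global_weak_solution k p \<rho>\<^sub>0 v\<^sub>0 \<rho> v \<Phi>"
    and A: "condition_A2 K\<^sub>1 \<rho>" and B2: "condition_B2 k p \<rho> v \<Phi>"
  shows "enn2ereal (\<integral>\<^sup>+ (x, t). ennreal (\<rho> x t * (norm (v x t))\<^sup>2 + 2 * p (\<rho> x t)) \<partial>spacetime)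
          + ereal (\<integral>x. \<rho>\<^sub>0 x * (v\<^sub>0 x \<bullet> x) \<partial>lebesgue) \<le> ereal (5 * B * K\<^sub>1)"
proof -
  interpret solution k p \<rho>\<^sub>0 v\<^sub>0 \<rho> v \<Phi> by unfold_locales (fact k init sol)+
  interpret flow k p \<rho>\<^sub>0 v\<^sub>0 \<rho> v \<Phi> "\<lambda>_. 1"
  proof
    show "admissible_weight (\<lambda>_. 1)" by (rule admissible_one)
    show "condition_B k p (\<lambda>_. 1) \<rho> v \<Phi>"
      by (rule condition_B_one) (use B2 in \<open>simp only: condition_B2_def\<close>)
    show "(\<integral>\<^sup>+ x. ennreal (\<rho>\<^sub>0 x * norm (v\<^sub>0 x) * int1 (\<lambda>_. 1) (norm x)) \<partial>lebesgue) < \<infinity>"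
      using mom by (simp only: int1_one[OF norm_ge_zero])
  qed
  have ab: "alim x = 1" "blim x = 0" if "x \<noteq> 0" for x
    using that by (simp_all add: alim_def blim_def wt_def int1_one)
  have d: "dens alim blim x t = \<rho> x t * (norm (v x t))\<^sup>2 + 2 * p (\<rho> x t)" if "x \<noteq> 0" for x t
    unfolding dens_def ab[OF that] by simp
  have nn: "AE z in spacetime. dens alim blim (fst z) (snd z) \<ge> 0"
    using nonzero_nonneg_AE by eventually_elim (simp add: d)
  have eq: "(\<integral>\<^sup>+ z. ennreal (dens alim blim (fst z) (snd z)) \<partial>spacetime)
    = (\<integral>\<^sup>+ (x, t). ennreal (\<rho> x t * (norm (v x t))\<^sup>2 + 2 * p (\<rho> x t)) \<partial>spacetime)"
    unfolding case_prod_unfold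
  proof (rule nn_integral_cong_AE)
    show "AE z in spacetime. ennreal (dens alim blim (fst z) (snd z))
      = ennreal (\<rho> (fst z) (snd z) * (norm (v (fst z) (snd z)))\<^sup>2 + 2 * p (\<rho> (fst z) (snd z)))"
      using nonzero_nonneg_AE by eventually_elim (simp add: d)
  qed
  have "\<rho>\<^sub>0 x * (v\<^sub>0 x \<bullet> x) * alim x = \<rho>\<^sub>0 x * (v\<^sub>0 x \<bullet> x)" for x
    by (cases "x = 0") (simp_all add: ab)
  then show ?thesis
    using virial_inequality[OF step K condition_A_one[OF A] nn] unfolding eq by (simp only:)
qed

text \<open>The nonnegative part of the inequality may be dropped; this excludes solutions with too
  large a momentum.\<close>

lemma no_solution_ereal:
  assumes "enn2ereal X + ereal a \<le> ereal b" shows "a \<le> b"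
proof -
  have "0 + ereal a \<le> enn2ereal X + ereal a" by (rule add_right_mono) simp
  then show ?thesis using order.trans[OF _ assms] by (metis add_0 ereal_less_eq(3))
qed

theorem theorem1p2:
  fixes k :: real and p :: "real \<Rightarrow> real"
  assumes "k \<ge> 0" and "pressure_law p"
  shows "\<exists>C>0.
    (CARD('n::finite) \<ge> 3 \<longrightarrow>
      (\<forall>w K\<^sub>1 (\<rho>\<^sub>0 :: real^'n \<Rightarrow> real) v\<^sub>0.
        admissible_weight w \<and> K\<^sub>1 \<ge> 0 \<and> initial_data \<rho>\<^sub>0 v\<^sub>0 \<and>
        (\<integral>\<^sup>+ x. ennreal (\<rho>\<^sub>0 x * norm (v\<^sub>0 x) * int1 w (norm x)) \<partial>lebesgue) < \<infinity> \<longrightarrow>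
        (\<forall>\<rho> v \<Phi>.
          global_weak_solution k p \<rho>\<^sub>0 v\<^sub>0 \<rho> v \<Phi> \<and>
          condition_A w K\<^sub>1 \<rho> \<and> condition_B k p w \<rho> v \<Phi> \<longrightarrow>
          enn2ereal
            ((\<integral>\<^sup>+ (x, t). ennreal (\<rho> x t *
                 (w (norm x) * ((v x t \<bullet> x)\<^sup>2 / (norm x)\<^sup>2) +
                  int1 w (norm x) / norm x *
                    ((norm (v x t))\<^sup>2 - (v x t \<bullet> x)\<^sup>2 / (norm x)\<^sup>2))) \<partial>spacetime)
           + (\<integral>\<^sup>+ (x, t). ennreal (p (\<rho> x t) *
                 (w (norm x) + (real CARD('n) - 1) / norm x * int1 w (norm x))) \<partial>spacetime)
           + ennreal ((real CARD('n) - 3) * k / 2) *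
               (\<integral>\<^sup>+ (x, t). ennreal ((norm (wgrad \<Phi> x t))\<^sup>2 / norm x * int1 w (norm x))
                 \<partial>spacetime)
           + ennreal k *
               (\<integral>\<^sup>+ (x, t). ennreal ((int1 w (norm x) / norm x - w (norm x)) *
                 ((x \<bullet> wgrad \<Phi> x t)\<^sup>2 / (norm x)\<^sup>2)) \<partial>spacetime)
           + ennreal (k / 2) *
               (\<integral>\<^sup>+ (x, t). ennreal ((norm (wgrad \<Phi> x t))\<^sup>2 * w (norm x)) \<partial>spacetime))
          + ereal (\<integral>x. \<rho>\<^sub>0 x * (v\<^sub>0 x \<bullet> (x /\<^sub>R norm x)) * int1 w (norm x) \<partial>lebesgue)
          \<le> ereal (C * K\<^sub>1)) \<and>
        ((\<integral>x. \<rho>\<^sub>0 x * (v\<^sub>0 x \<bullet> (x /\<^sub>R norm x)) * int1 w (norm x) \<partial>lebesgue) > C * K\<^sub>1 \<longrightarrow>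
          \<not> (\<exists>\<rho> v \<Phi>. global_weak_solution k p \<rho>\<^sub>0 v\<^sub>0 \<rho> v \<Phi> \<and>
                condition_A w K\<^sub>1 \<rho> \<and> condition_B k p w \<rho> v \<Phi>)))) \<and>
    (\<forall>K\<^sub>1 (\<rho>\<^sub>0 :: real^2 \<Rightarrow> real) v\<^sub>0.
        K\<^sub>1 \<ge> 0 \<and> initial_data \<rho>\<^sub>0 v\<^sub>0 \<and>
        (\<integral>\<^sup>+ x. ennreal (\<rho>\<^sub>0 x * norm (v\<^sub>0 x) * norm x) \<partial>lebesgue) < \<infinity> \<longrightarrow>
        (\<forall>\<rho> v \<Phi>.
          global_weak_solution k p \<rho>\<^sub>0 v\<^sub>0 \<rho> v \<Phi> \<and>
          condition_A2 K\<^sub>1 \<rho> \<and> condition_B2 k p \<rho> v \<Phi> \<longrightarrow>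
          enn2ereal (\<integral>\<^sup>+ (x, t). ennreal (\<rho> x t * (norm (v x t))\<^sup>2 + 2 * p (\<rho> x t)) \<partial>spacetime)
          + ereal (\<integral>x. \<rho>\<^sub>0 x * (v\<^sub>0 x \<bullet> x) \<partial>lebesgue)
          \<le> ereal (C * K\<^sub>1)) \<and>
        ((\<integral>x. \<rho>\<^sub>0 x * (v\<^sub>0 x \<bullet> x) \<partial>lebesgue) > C * K\<^sub>1 \<longrightarrow>
          \<not> (\<exists>\<rho> v \<Phi>. global_weak_solution k p \<rho>\<^sub>0 v\<^sub>0 \<rho> v \<Phi> \<and>
                condition_A2 K\<^sub>1 \<rho> \<and> condition_B2 k p \<rho> v \<Phi>)))"
proof -
  obtain B where B: "B > 0" "\<And>\<tau> t. \<tau> > 0 \<Longrightarrow> \<bar>tstep' \<tau> t\<bar> \<le> B / \<tau>" "\<And>\<tau> t. \<tau> > 0 \<Longrightarrow> \<bar>tstep'' \<tau> t\<bar> \<le> B / \<tau>\<^sup>2"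
    using tstep_derivs_bounded by blast
  have flowI: "flow k p \<rho>\<^sub>0 v\<^sub>0 \<rho> v \<Phi> w"
    if "admissible_weight w" "initial_data \<rho>\<^sub>0 v\<^sub>0"
      "(\<integral>\<^sup>+ x. ennreal (\<rho>\<^sub>0 x * norm (v\<^sub>0 x) * int1 w (norm x)) \<partial>lebesgue) < \<infinity>"
      "global_weak_solution k p \<rho>\<^sub>0 v\<^sub>0 \<rho> v \<Phi>" "condition_B k p w \<rho> v \<Phi>"
    for \<rho>\<^sub>0 :: "real^'n \<Rightarrow> real" and v\<^sub>0 \<rho> v \<Phi> w
    by unfold_locales (fact assms that)+
  show ?thesis
    apply (rule exI[of _ "5 * B"], intro conjI impI allI)
    subgoal using B(1) by simp
    subgoal premises prems for w K\<^sub>1 \<rho>\<^sub>0 v\<^sub>0 \<rho> v \<Phi>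
      by (rule flow.virial_case_3[OF flowI B]) (use prems in blast)+
    subgoal premises prems for w K\<^sub>1 \<rho>\<^sub>0 v\<^sub>0
    proof
      assume "\<exists>\<rho> v \<Phi>. global_weak_solution k p \<rho>\<^sub>0 v\<^sub>0 \<rho> v \<Phi> \<and> condition_A w K\<^sub>1 \<rho> \<and> condition_B k p w \<rho> v \<Phi>"
      then obtain \<rho> v \<Phi> where s: "global_weak_solution k p \<rho>\<^sub>0 v\<^sub>0 \<rho> v \<Phi>" "condition_A w K\<^sub>1 \<rho>" "condition_B k p w \<rho> v \<Phi>"
        by blast
      have f: "flow k p \<rho>\<^sub>0 v\<^sub>0 \<rho> v \<Phi> w" by (rule flowI) (use prems s in blast)+
      have "K\<^sub>1 \<ge> 0" using prems by blast
      from no_solution_ereal[OF flow.virial_case_3[OF f B prems(1) this s(2)]] prems(3) show False by linarith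
    qed
    subgoal premises prems for K\<^sub>1 \<rho>\<^sub>0 v\<^sub>0 \<rho> v \<Phi>
      by (rule virial_case_2[OF B _ assms(1)]) (use prems in blast)+
    subgoal premises prems for K\<^sub>1 \<rho>\<^sub>0 v\<^sub>0
    proof
      assume "\<exists>\<rho> v \<Phi>. global_weak_solution k p \<rho>\<^sub>0 v\<^sub>0 \<rho> v \<Phi> \<and> condition_A2 K\<^sub>1 \<rho> \<and> condition_B2 k p \<rho> v \<Phi>"
      then obtain \<rho> v \<Phi> where s: "global_weak_solution k p \<rho>\<^sub>0 v\<^sub>0 \<rho> v \<Phi>" "condition_A2 K\<^sub>1 \<rho>" "condition_B2 k p \<rho> v \<Phi>"
        by blast
      have i: "K\<^sub>1 \<ge> 0" "initial_data \<rho>\<^sub>0 v\<^sub>0" "(\<integral>\<^sup>+ x. ennreal (\<rho>\<^sub>0 x * norm (v\<^sub>0 x) * norm x) \<partial>lebesgue) < \<infinity>"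
        using prems by blast+
      from no_solution_ereal[OF virial_case_2[OF B i(1) assms(1) i(2,3) s]] prems(2) show False by linarith
    qed
    done
qed

end
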